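(* Let $H$ be a regular multiplier Hopf algebra over $\mathbb{C}$ and let $(\delta,\sigma)$ be a modular pair in involution for $H$. Each of the maps $\delta_i$ ($0\le i\le n+1$) extends to a map from $M_0^n(H)$ to $M_0^{n+1}(H)$, and similarly each of the maps $\sigma_i$ ($1\le i\le n+1$) extends to a map from $M_0^{n+1}(H)$ to $M_0^n(H)$.
   Context: All algebras are over $\mathbb{C}$, associative, possibly non-unital, with non-degenerate product. $M(A)$ denotes the multiplier algebra of $A$ (pairs $(\alpha_L,\alpha_R)$ of linear maps $A\to A$ with $\alpha_L(ab)=\alpha_L(a)b$, $\alpha_R(ab)=a\alpha_R(b)$, $a\,\alpha_L(b)=\alpha_R(a)\,b$); $A\subset M(A)$ canonically. A multiplier Hopf algebra is an algebra $H$ with a homomorphism $\Delta:H\to M(H\otimes H)$ such that $W_R(a\otimes b)=\Delta(a)(1\otimes b)$ and $W_L(a\otimes b)=(a\otimes 1)\Delta(b)$ are well-defined bijective maps $H\otimes H\to H\otimes H$, and $\Delta$ is coassociative: $(a\otimes1\otimes1)\,(\Delta\otimes\mathrm{id})(\Delta(b)(1\otimes c))=(\mathrm{id}\otimes\Delta)((a\otimes1)\Delta(b))\,(1\otimes1\otimes c)$. It is regular if $H$ with $\Delta$ composed with the flip is again a multiplier Hopf algebra. $\epsilon:H\to\mathbb{C}$ denotes the counit (a homomorphism) and $S:H\to H$ the (bijective) antipode. Non-degenerate homomorphisms such as $\Delta$, $\epsilon$ and characters are extended uniquely to multiplier algebras. A modular pair in involution is a pair $(\delta,\sigma)$ where $\delta$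 is a character of $H$, $\sigma\in M(H)$ is group-like, $\Delta(\sigma)=\sigma\otimes\sigma$, $\delta(\sigma)=1$, and the map $S_{(\delta,\sigma)}:H\to H$ given by $\delta(a)S_{(\delta,\sigma)}(h)=(\delta\otimes S)W_L(a\otimes h)$ ($a,h\in H$) satisfies $S_{(\delta,\sigma)}^2(h)=\sigma h\sigma^{-1}$, where $\sigma^{-1}=S(\sigma)$. (Only $\sigma$ enters the maps below.) $M^n(H)=M(H^{\otimes n})$, with $M^0(H)=\mathbb{C}$. $N(H)$ is the subalgebra of $M(H)$ generated by $H$, $1$ and $\sigma$. $M_0^n(H)$ is the subspace of all $z\in M^n(H)$ such that for every $i=1,\dots,n$ and every $w_i=a_1\otimes\cdots\otimes a_{i-1}\otimes 1\otimes a_{i+1}\otimes\cdots\otimes a_n$ with $a_j\in H$, both $zw_i$ and $w_iz$ lie in $H\otimes\cdots\otimes N(H)\otimes\cdots\otimes H$ ($N(H)$ in the $i$-th place); $M_0^0(H)=\mathbb{C}$. On $H^{\otimes n}$ (with values in multipliers) the maps are: $\delta_0(h^1\otimes\cdots\otimes h^n)=1\otimes h^1\otimes\cdots\otimes h^n$; $\delta_{n+1}(h^1\otimes\cdots\otimes h^n)=h^1\otimes\cdots\otimes h^n\otimes\sigma$; $\delta_i(h^1\otimes\cdots\otimes h^n)=h^1\otimes\cdots\otimes\Delta(h^i)\otimes\cdots\otimes h^n$ for $1\le i\le n$; $\sigma_i(h^1\otimes\cdots\otimes h^n)=\epsilon(h^i)\,h^1\otimes\cdots\otimes h^{i-1}\otimes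 h^{i+1}\otimes\cdots\otimes h^n$ for $1\le i\le n$. "Extends" refers to the canonical extension to multipliers: $\delta_0(y)=1\otimes y$, $\delta_{n+1}(y)=y\otimes\sigma$; for $1\le i\le n$, $\delta_i(y)\,(\delta_i(x)w)=\delta_i(yx)\,w$ and $(w\,\delta_i(x))\,\delta_i(y)=w\,\delta_i(xy)$ for $x\in H^{\otimes n}$, $w\in H^{\otimes(n+1)}$; and, for $y$ a multiplier of $H^{\otimes n}$, $\epsilon(a_i)\,\sigma_i(y)(a_1\otimes\cdots\otimes a_{i-1}\otimes a_{i+1}\otimes\cdots\otimes a_n)=\sigma_i(y(a_1\otimes\cdots\otimes a_n))$ for all $a_j\in H$, and analogously for multiplication from the other side. *)

theory Defs
  imports Complex_Main "HOL-Library.Poly_Mapping" "HOL-Library.FuncSet"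
begin

section \<open>Complex algebras\<close>

class complex_vector = ab_group_add +
  fixes scaleC :: "complex \<Rightarrow> 'a \<Rightarrow> 'a" (infixr "*\<^sub>C" 75)
  assumes scaleC_add_right: "c *\<^sub>C (x + y) = c *\<^sub>C x + c *\<^sub>C y"
    and scaleC_add_left: "(c + d) *\<^sub>C x = c *\<^sub>C x + d *\<^sub>C x"
    and scaleC_scaleC: "c *\<^sub>C d *\<^sub>C x = (c * d) *\<^sub>C x"
    and scaleC_one: "1 *\<^sub>C x = x"

text \<open>Associative and possibly non-unital, as \<^class>\<open>ring\<close> is.\<close>

class complex_algebra = complex_vector + ring +
  assumes mult_scaleC_left: "(c *\<^sub>C x) * y = c *\<^sub>C (x * y)"
    and mult_scaleC_right: "x * (c *\<^sub>C y) = c *\<^sub>C (x * y)"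

global_interpretation complex_vector:
  vector_space "scaleC :: complex \<Rightarrow> 'a \<Rightarrow> 'a :: complex_vector"
  by unfold_locales (simp_all add: scaleC_add_right scaleC_add_left scaleC_scaleC scaleC_one)

abbreviation clinear :: "('a::complex_vector \<Rightarrow> 'b::complex_vector) \<Rightarrow> bool" where
  "clinear \<equiv> Vector_Spaces.linear scaleC scaleC"

definition clinear_on :: "'a::complex_vector set \<Rightarrow> ('a \<Rightarrow> 'b::complex_vector) \<Rightarrow> bool" where
  "clinear_on A f \<longleftrightarrow>
     (\<forall>x\<in>A. \<forall>y\<in>A. f (x + y) = f x + f y) \<and> (\<forall>c. \<forall>x\<in>A. f (c *\<^sub>C x) = c *\<^sub>C f x)"

definition algebra_hom :: "('a::complex_algebra \<Rightarrow> 'b::{complex_vector, times}) \<Rightarrow> bool" where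
  "algebra_hom f \<longleftrightarrow> clinear f \<and> (\<forall>a b. f (a * b) = f a * f b)"

instantiation complex :: complex_algebra
begin
definition scaleC_complex :: "complex \<Rightarrow> complex \<Rightarrow> complex" where
  "scaleC_complex = (*)"
instance
  by standard (simp_all add: scaleC_complex_def algebra_simps)
end

instantiation poly_mapping :: (type, complex_vector) complex_vector
begin
definition scaleC_poly_mapping :: "complex \<Rightarrow> ('a \<Rightarrow>\<^sub>0 'b) \<Rightarrow> ('a \<Rightarrow>\<^sub>0 'b)" where
  "scaleC_poly_mapping c = Poly_Mapping.map (scaleC c)"

lemma lookup_scaleC: "Poly_Mapping.lookup (c *\<^sub>C p) k = c *\<^sub>C Poly_Mapping.lookup p k" for p :: "'a \<Rightarrow>\<^sub>0 'b"
  unfolding scaleC_poly_mapping_def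
  by transfer (simp add: when_def)

instance
  by standard
    (auto intro!: poly_mapping_eqI simp: lookup_scaleC lookup_add scaleC_add_right
      scaleC_add_left scaleC_scaleC scaleC_one)
end

section \<open>Tensor powers\<close>

text \<open>
  All tensor powers of a vector space live in one type, the direct sum over \<open>n\<close> of
  its \<open>n\<close>-fold tensor powers. It is the free vector space on lists modulo
  multilinearity in each entry; the list \<open>[h1, ..., hn]\<close> represents the elementary tensor
  of \<open>h1, ..., hn\<close>. There is no relation between lists of length 0, so the 0-th power
  is the field of scalars.
\<close>

definition multilinear_relations :: "('a::complex_vector list \<Rightarrow>\<^sub>0 complex) set" where
  "multilinear_relations =
     {Poly_Mapping.single (us @ (x + y) # vs) 1 - Poly_Mapping.single (us @ x # vs) 1
        - Poly_Mapping.single (us @ y # vs) 1 |us x y vs. True} \<union>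
     {Poly_Mapping.single (us @ (c *\<^sub>C x) # vs) 1
        - c *\<^sub>C Poly_Mapping.single (us @ x # vs) 1 |us c x vs. True}"

quotient_type (overloaded) 'a tens = "'a::complex_vector list \<Rightarrow>\<^sub>0 complex" /
  "\<lambda>p q. p - q \<in> complex_vector.span multilinear_relations"
proof (rule equivpI)
  show "reflp (\<lambda>p q. p - q \<in> complex_vector.span (multilinear_relations :: ('a list \<Rightarrow>\<^sub>0 complex) set))"
    by (auto simp: reflp_def complex_vector.span_zero)
  show "symp (\<lambda>p q. p - q \<in> complex_vector.span (multilinear_relations :: ('a list \<Rightarrow>\<^sub>0 complex) set))"
    by (rule sympI) (drule complex_vector.span_neg, simp)
  show "transp (\<lambda>p q. p - q \<in> complex_vector.span (multilinear_relations :: ('a list \<Rightarrow>\<^sub>0 complex) set))"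
  proof (rule transpI)
    fix p q r :: "'a list \<Rightarrow>\<^sub>0 complex"
    assume "p - q \<in> complex_vector.span multilinear_relations"
      and "q - r \<in> complex_vector.span multilinear_relations"
    then have "(p - q) + (q - r) \<in> complex_vector.span multilinear_relations"
      by (rule complex_vector.span_add)
    then show "p - r \<in> complex_vector.span multilinear_relations"
      by simp
  qed
qed

instantiation tens :: (complex_vector) complex_vector
begin

lift_definition zero_tens :: "'a tens" is 0 .

lift_definition plus_tens :: "'a tens \<Rightarrow> 'a tens \<Rightarrow> 'a tens" is "(+)"
  by (drule (1) complex_vector.span_add) (simp add: algebra_simps)

lift_definition uminus_tens :: "'a tens \<Rightarrow> 'a tens" is uminus
  by (drule complex_vector.span_neg) (simp add: algebra_simps)

lift_definition minus_tens :: "'a tens \<Rightarrow> 'a tens \<Rightarrow> 'a tens" is "(-)"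
  by (drule (1) complex_vector.span_diff) (simp add: algebra_simps)

lift_definition scaleC_tens :: "complex \<Rightarrow> 'a tens \<Rightarrow> 'a tens" is scaleC
  by (simp flip: complex_vector.scale_right_diff_distrib add: complex_vector.span_scale)

instance
  by standard
    (transfer; simp add: complex_vector.span_zero algebra_simps scaleC_add_right
      scaleC_add_left scaleC_scaleC scaleC_one)+

end

lift_definition tensor :: "'a::complex_vector list \<Rightarrow> 'a tens" is
  "\<lambda>xs. Poly_Mapping.single xs 1" .

definition tpow :: "nat \<Rightarrow> 'a::complex_vector tens set" where
  "tpow n = complex_vector.span {tensor xs |xs. length xs = n}"

definition multilinear :: "('a::complex_vector list \<Rightarrow> 'b::complex_vector) \<Rightarrow> bool" where
  "multilinear f \<longleftrightarrow>
     (\<forall>us x y vs. f (us @ (x + y) # vs) = f (us @ x # vs) + f (us @ y # vs)) \<and>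
     (\<forall>us c x vs. f (us @ (c *\<^sub>C x) # vs) = c *\<^sub>C f (us @ x # vs))"

definition formal_sum :: "('a list \<Rightarrow> 'b::complex_vector) \<Rightarrow> ('a list \<Rightarrow>\<^sub>0 complex) \<Rightarrow> 'b" where
  "formal_sum f p = (\<Sum>xs\<in>Poly_Mapping.keys p. Poly_Mapping.lookup p xs *\<^sub>C f xs)"

text \<open>
  \<open>tens_lift f\<close> is the linear map with value \<open>f xs\<close> on the elementary
  tensor of \<open>xs\<close>. It is meaningful only for multilinear \<open>f\<close>: see
  \<open>tens_lift_tensor\<close> and \<open>clinear_tens_lift\<close> below.
\<close>

definition tens_lift :: "('a::complex_vector list \<Rightarrow> 'b::complex_vector) \<Rightarrow> 'a tens \<Rightarrow> 'b" where
  "tens_lift f t = formal_sum f (rep_tens t)"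

lemma formal_sum_superset:
  assumes "finite K" "Poly_Mapping.keys p \<subseteq> K"
  shows "formal_sum f p = (\<Sum>xs\<in>K. Poly_Mapping.lookup p xs *\<^sub>C f xs)"
  unfolding formal_sum_def
  by (rule sum.mono_neutral_left) (use assms in \<open>auto simp: in_keys_iff\<close>)

lemma clinear_formal_sum: "clinear (formal_sum f)"
proof unfold_locales
  fix p q :: "'a list \<Rightarrow>\<^sub>0 complex" and c
  let ?K = "Poly_Mapping.keys p \<union> Poly_Mapping.keys q"
  have "formal_sum f (p + q) = (\<Sum>xs\<in>?K. Poly_Mapping.lookup (p + q) xs *\<^sub>C f xs)"
    by (rule formal_sum_superset) (simp_all add: Poly_Mapping.keys_add)
  then show "formal_sum f (p + q) = formal_sum f p + formal_sum f q"
    by (simp add: lookup_add scaleC_add_left sum.distrib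
        formal_sum_superset[of ?K p f] formal_sum_superset[of ?K q f])
  have "formal_sum f (c *\<^sub>C p)
      = (\<Sum>xs\<in>Poly_Mapping.keys p. Poly_Mapping.lookup (c *\<^sub>C p) xs *\<^sub>C f xs)"
    by (rule formal_sum_superset) (auto simp: in_keys_iff lookup_scaleC scaleC_complex_def)
  then show "formal_sum f (c *\<^sub>C p) = c *\<^sub>C formal_sum f p"
    by (simp add: formal_sum_def lookup_scaleC scaleC_complex_def complex_vector.scale_sum_right)
qed

lemma formal_sum_single: "formal_sum f (Poly_Mapping.single xs 1) = f xs"
  by (simp add: formal_sum_def scaleC_one)

lemma tens_lift_abs:
  assumes "multilinear f"
  shows "tens_lift f (abs_tens p) = formal_sum f p"
proof -
  interpret F: Vector_Spaces.linear scaleC scaleC "formal_sum f"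
    by (rule clinear_formal_sum)
  have gen: "formal_sum f r = 0" if "r \<in> multilinear_relations" for r
    using that assms unfolding multilinear_relations_def multilinear_def
    by (auto simp: F.diff F.scale formal_sum_single)
  have span: "formal_sum f r = 0" if "r \<in> complex_vector.span multilinear_relations" for r
    using that
    by (induction rule: complex_vector.span_induct_alt) (simp_all add: F.zero F.add F.scale gen)
  have "rep_tens (abs_tens p) - p \<in> complex_vector.span multilinear_relations"
    by (rule Quotient3_rep_abs[OF Quotient3_tens])
      (simp add: complex_vector.span_zero)
  then have "formal_sum f (rep_tens (abs_tens p) - p) = 0"
    by (rule span)
  then show ?thesis
    by (simp add: tens_lift_def F.diff)
qed

lemma tens_lift_tensor: "multilinear f \<Longrightarrow> tens_lift f (tensor xs) = f xs"
  by (simp add: tensor.abs_eq tens_lift_abs formal_sum_single)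

lemma clinear_tens_lift:
  assumes "multilinear f"
  shows "clinear (tens_lift f)"
proof -
  interpret F: Vector_Spaces.linear scaleC scaleC "formal_sum f"
    by (rule clinear_formal_sum)
  show ?thesis
  proof unfold_locales
    fix s t :: "'a tens" and c
    show "tens_lift f (s + t) = tens_lift f s + tens_lift f t"
      by (induction s rule: tens.abs_induct, induction t rule: tens.abs_induct)
        (simp only: plus_tens.abs_eq tens_lift_abs[OF assms] F.add)
    show "tens_lift f (c *\<^sub>C s) = c *\<^sub>C tens_lift f s"
      by (induction s rule: tens.abs_induct)
        (simp only: scaleC_tens.abs_eq tens_lift_abs[OF assms] F.scale)
  qed
qed

lemma tensor_multilinear: "multilinear tensor"
  unfolding multilinear_def
proof (intro conjI allI)
  fix us vs :: "'a list" and x y :: 'a and c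
  have "Poly_Mapping.single (us @ (x + y) # vs) 1 -
      (Poly_Mapping.single (us @ x # vs) 1 + Poly_Mapping.single (us @ y # vs) 1)
    \<in> complex_vector.span multilinear_relations"
    by (rule complex_vector.span_base, unfold multilinear_relations_def diff_diff_add) blast
  then show "tensor (us @ (x + y) # vs) = tensor (us @ x # vs) + tensor (us @ y # vs)"
    by (simp only: tensor.abs_eq plus_tens.abs_eq scaleC_tens.abs_eq tens.abs_eq_iff)
  have "Poly_Mapping.single (us @ (c *\<^sub>C x) # vs) 1 - c *\<^sub>C Poly_Mapping.single (us @ x # vs) 1
    \<in> complex_vector.span multilinear_relations"
    by (rule complex_vector.span_base, unfold multilinear_relations_def) blast
  then show "tensor (us @ (c *\<^sub>C x) # vs) = c *\<^sub>C tensor (us @ x # vs)"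
    by (simp only: tensor.abs_eq plus_tens.abs_eq scaleC_tens.abs_eq tens.abs_eq_iff)
qed

lemmas tensor_add = tensor_multilinear[unfolded multilinear_def, THEN conjunct1, rule_format]
  and tensor_scaleC = tensor_multilinear[unfolded multilinear_def, THEN conjunct2, rule_format]

lemma tens_induct [case_names zero add]:
  assumes "P 0" and "\<And>c xs t. P t \<Longrightarrow> P (c *\<^sub>C tensor xs + t)"
  shows "P t"
proof (induction t rule: tens.abs_induct)
  case (1 p)
  have single: "abs_tens (Poly_Mapping.single xs c) = c *\<^sub>C tensor xs" for xs :: "'a list" and c
  proof -
    have "Poly_Mapping.single xs c = c *\<^sub>C Poly_Mapping.single xs 1"
      by (rule poly_mapping_eqI) (simp add: lookup_scaleC lookup_single when_def scaleC_complex_def)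
    then show ?thesis
      by (simp add: tensor.abs_eq scaleC_tens.abs_eq)
  qed
  have "p = (\<Sum>k\<in>Poly_Mapping.keys p. Poly_Mapping.single k (Poly_Mapping.lookup p k))"
    by (rule poly_mapping_eqI)
      (simp add: lookup_sum lookup_single when_def sum.delta' in_keys_iff)
  moreover have "P (abs_tens (\<Sum>k\<in>K. Poly_Mapping.single k (Poly_Mapping.lookup p k)))"
    if "finite K" for K
    using that
  proof (induction K rule: finite_induct)
    case empty
    then show ?case
      using assms(1) by (simp add: zero_tens.abs_eq)
  next
    case (insert k K)
    then show ?case
      by (simp add: plus_tens.abs_eq[symmetric] single assms(2))
  qed
  ultimately show ?case
    by (metis finite_keys)
qed

text \<open>
  The product is entrywise on each tensor power; distinct tensor powers annihilate each
  other. Thus each \<open>tpow n\<close> carries the usual product of a tensor power of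
  an algebra.
\<close>

definition tensor_mult :: "'a::complex_algebra list \<Rightarrow> 'a list \<Rightarrow> 'a tens" where
  "tensor_mult xs ys = (if length xs = length ys then tensor (map2 (*) xs ys) else 0)"

lemma multilinear_tensor_mult_right: "multilinear (tensor_mult xs)"
proof -
  have *: "tensor_mult xs (us @ y # vs) =
      (if length xs = length us + Suc (length vs)
       then tensor (map2 (*) (take (length us) xs) us @
         (xs ! length us * y) # map2 (*) (drop (Suc (length us)) xs) vs) else 0)" for us y vs
  proof (cases "length xs = length us + Suc (length vs)")
    case True
    then have "map2 (*) xs (us @ y # vs) = map2 (*) (take (length us) xs @
        xs ! length us # drop (Suc (length us)) xs) (us @ y # vs)"
      using id_take_nth_drop[of "length us" xs] by simp
    with True show ?thesis
      by (simp add: tensor_mult_def)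
  qed (simp add: tensor_mult_def)
  show ?thesis
    unfolding multilinear_def *
    by (simp add: distrib_left mult_scaleC_right tensor_add tensor_scaleC)
qed

lemma multilinear_tensor_mult_left: "multilinear (\<lambda>xs. tensor_mult xs ys)"
proof -
  have *: "tensor_mult (us @ x # vs) ys =
      (if length ys = length us + Suc (length vs)
       then tensor (map2 (*) us (take (length us) ys) @
         (x * ys ! length us) # map2 (*) vs (drop (Suc (length us)) ys)) else 0)" for us x vs
  proof (cases "length ys = length us + Suc (length vs)")
    case True
    then have "map2 (*) (us @ x # vs) ys = map2 (*) (us @ x # vs) (take (length us) ys @
        ys ! length us # drop (Suc (length us)) ys)"
      using id_take_nth_drop[of "length us" ys] by simp
    with True show ?thesis
      by (auto simp: tensor_mult_def)
  qed (auto simp: tensor_mult_def)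
  show ?thesis
    unfolding multilinear_def *
    by (simp add: distrib_right mult_scaleC_left tensor_add tensor_scaleC)
qed

instantiation tens :: (complex_algebra) complex_algebra
begin

definition times_tens :: "'a tens \<Rightarrow> 'a tens \<Rightarrow> 'a tens" where
  "s * t = tens_lift (\<lambda>xs. tens_lift (tensor_mult xs) t) s"

lemma clinear_times_right: "clinear ((*) s)" for s :: "'a tens"
proof -
  interpret L: Vector_Spaces.linear scaleC scaleC "tens_lift (tensor_mult xs)"
    for xs :: "'a list"
    by (rule clinear_tens_lift[OF multilinear_tensor_mult_right])
  show ?thesis
    by unfold_locales
      (simp_all add: times_tens_def tens_lift_def[of _ s] formal_sum_def L.add L.scale
        scaleC_add_right sum.distrib complex_vector.scale_sum_right mult.commute)
qed

lemma tensor_times: "tensor xs * t = tens_lift (tensor_mult xs) t"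
  and clinear_times_left: "clinear (\<lambda>s. s * t)" for t :: "'a tens"
proof -
  have m: "multilinear (\<lambda>xs. tens_lift (tensor_mult xs) t)"
    using multilinear_tensor_mult_left[where 'a = 'a, unfolded multilinear_def]
    by (simp add: multilinear_def tens_lift_def formal_sum_def scaleC_add_right sum.distrib
        complex_vector.scale_sum_right mult.commute)
  show "tensor xs * t = tens_lift (tensor_mult xs) t"
    by (simp add: times_tens_def tens_lift_tensor[OF m])
  show "clinear (\<lambda>s. s * t)"
    unfolding times_tens_def using clinear_tens_lift[OF m] .
qed

lemma tensor_times_tensor: "tensor xs * tensor ys = tensor_mult xs ys"
  by (simp add: tensor_times tens_lift_tensor[OF multilinear_tensor_mult_right])

instance
proof
  fix r s t :: "'a tens" and c :: complex
  interpret R: Vector_Spaces.linear scaleC scaleC "(*) s" for s :: "'a tens"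
    by (rule clinear_times_right)
  interpret L: Vector_Spaces.linear scaleC scaleC "\<lambda>s. s * t" for t :: "'a tens"
    by (rule clinear_times_left)
  show "(r + s) * t = r * t + s * t" "r * (s + t) = r * s + r * t"
    by (rule L.add R.add)+
  show "(c *\<^sub>C s) * t = c *\<^sub>C (s * t)" "s * (c *\<^sub>C t) = c *\<^sub>C (s * t)"
    by (rule L.scale R.scale)+
  have 0: "tensor xs * tensor ys * tensor zs = tensor xs * (tensor ys * tensor zs)"
    for xs ys zs :: "'a list"
    by (auto simp: tensor_times_tensor tensor_mult_def L.zero R.zero intro!: arg_cong[of _ _ tensor]
        nth_equalityI simp: mult.assoc)
  have 1: "tensor xs * tensor ys * t = tensor xs * (tensor ys * t)" for xs ys t
    by (induction t rule: tens_induct) (simp_all add: R.zero R.add R.scale 0)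
  have 2: "tensor xs * s * t = tensor xs * (s * t)" for xs s t
    by (induction s rule: tens_induct) (simp_all add: L.zero L.add L.scale R.zero R.add R.scale 1)
  show "r * s * t = r * (s * t)"
    by (induction r rule: tens_induct) (simp_all add: L.zero L.add L.scale R.zero R.add R.scale 2)
qed

end

text \<open>
  \<open>lift n f\<close> is the linear map on the \<open>n\<close>-th tensor power determined by a map
  \<open>f\<close> that is multilinear on lists of length \<open>n\<close>; it is 0 off that tensor
  power.
\<close>

definition lift :: "nat \<Rightarrow> ('a::complex_vector list \<Rightarrow> 'b::complex_vector) \<Rightarrow> 'a tens \<Rightarrow> 'b" where
  "lift n f t = (if t \<in> tpow n then tens_lift (\<lambda>xs. if length xs = n then f xs else 0) t else 0)"

lemma tensor_in_tpow: "length xs = n \<Longrightarrow> tensor xs \<in> tpow n"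
  by (auto simp: tpow_def intro: complex_vector.span_base)

lemma lift_tensor:
  assumes "multilinear (\<lambda>xs. if length xs = n then f xs else 0)" "length xs = n"
  shows "lift n f (tensor xs) = f xs"
  by (simp add: lift_def tensor_in_tpow assms tens_lift_tensor)

lemma clinear_on_lift:
  assumes "multilinear (\<lambda>xs. if length xs = n then f xs else 0)"
  shows "clinear_on (tpow n) (lift n f)"
proof -
  interpret F: Vector_Spaces.linear scaleC scaleC
    "tens_lift (\<lambda>xs. if length xs = n then f xs else 0)"
    by (rule clinear_tens_lift[OF assms])
  show ?thesis
    by (auto simp: clinear_on_def lift_def F.add F.scale tpow_def
        complex_vector.span_add complex_vector.span_scale)
qed


section \<open>Multiplier algebras\<close>

text \<open>
  A multiplier \<open>m\<close> is the pair of the maps \<open>a \<mapsto> m a\<close> and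
  \<open>a \<mapsto> a m\<close>.
\<close>

datatype 'a multiplier = Multiplier (lmul: "'a \<Rightarrow> 'a") (rmul: "'a \<Rightarrow> 'a")

instantiation multiplier :: (complex_vector) complex_vector
begin

definition zero_multiplier :: "'a multiplier" where
  "0 = Multiplier (\<lambda>_. 0) (\<lambda>_. 0)"

definition plus_multiplier :: "'a multiplier \<Rightarrow> 'a multiplier \<Rightarrow> 'a multiplier" where
  "m + m' = Multiplier (\<lambda>a. lmul m a + lmul m' a) (\<lambda>a. rmul m a + rmul m' a)"

definition minus_multiplier :: "'a multiplier \<Rightarrow> 'a multiplier \<Rightarrow> 'a multiplier" where
  "m - m' = Multiplier (\<lambda>a. lmul m a - lmul m' a) (\<lambda>a. rmul m a - rmul m' a)"

definition uminus_multiplier :: "'a multiplier \<Rightarrow> 'a multiplier" where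
  "- m = Multiplier (\<lambda>a. - lmul m a) (\<lambda>a. - rmul m a)"

definition scaleC_multiplier :: "complex \<Rightarrow> 'a multiplier \<Rightarrow> 'a multiplier" where
  "c *\<^sub>C m = Multiplier (\<lambda>a. c *\<^sub>C lmul m a) (\<lambda>a. c *\<^sub>C rmul m a)"

instance
  by standard
    (auto intro!: multiplier.expand simp: zero_multiplier_def plus_multiplier_def
      minus_multiplier_def uminus_multiplier_def scaleC_multiplier_def fun_eq_iff
      add.assoc add.commute scaleC_add_right scaleC_add_left scaleC_scaleC scaleC_one)

end

instantiation multiplier :: (type) times
begin

definition times_multiplier :: "'a multiplier \<Rightarrow> 'a multiplier \<Rightarrow> 'a multiplier" where
  "m * m' = Multiplier (lmul m \<circ> lmul m') (rmul m' \<circ> rmul m)"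

instance ..

end

text \<open>
  The multiplier algebra of a subalgebra \<open>A\<close>. Its elements are maps on \<open>A\<close>;
  they are extended by 0 outside \<open>A\<close>, so that equal multipliers are equal as pairs.
\<close>

definition multipliers :: "'a::complex_algebra set \<Rightarrow> 'a multiplier set" where
  "multipliers A = {m.
     lmul m \<in> A \<rightarrow> A \<and> clinear_on A (lmul m) \<and> (\<forall>x. x \<notin> A \<longrightarrow> lmul m x = 0) \<and>
     rmul m \<in> A \<rightarrow> A \<and> clinear_on A (rmul m) \<and> (\<forall>x. x \<notin> A \<longrightarrow> rmul m x = 0) \<and>
     (\<forall>a\<in>A. \<forall>b\<in>A. lmul m (a * b) = lmul m a * b \<and>
        rmul m (a * b) = a * rmul m b \<and> a * lmul m b = rmul m a * b)}"

definition unit_multiplier :: "'a::complex_algebra set \<Rightarrow> 'a multiplier" where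
  "unit_multiplier A = Multiplier (\<lambda>a. if a \<in> A then a else 0) (\<lambda>a. if a \<in> A then a else 0)"

definition emb :: "'a::complex_algebra set \<Rightarrow> 'a \<Rightarrow> 'a multiplier" where
  "emb A x = Multiplier (\<lambda>a. if a \<in> A then x * a else 0) (\<lambda>a. if a \<in> A then a * x else 0)"

definition nondegenerate :: "'a::complex_algebra set \<Rightarrow> bool" where
  "nondegenerate A \<longleftrightarrow>
     (\<forall>a\<in>A. (\<forall>b\<in>A. a * b = 0) \<longrightarrow> a = 0) \<and> (\<forall>a\<in>A. (\<forall>b\<in>A. b * a = 0) \<longrightarrow> a = 0)"

text \<open>
  The type \<^typ>\<open>'a\<close> itself is the algebra \<open>H\<close>, with multiplier algebra
  \<^term>\<open>multipliers UNIV\<close>. The multiplier algebra of its \<open>n\<close>-th tensor power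
  is \<open>mpow n\<close>; for \<open>n = 0\<close> it is the multiplier algebra of the scalars, that
  is, the scalars.
\<close>

abbreviation mpow :: "nat \<Rightarrow> 'a::complex_algebra tens multiplier set" where
  "mpow n \<equiv> multipliers (tpow n)"

abbreviation embH :: "'a::complex_algebra \<Rightarrow> 'a multiplier" where
  "embH \<equiv> emb UNIV"

abbreviation oneH :: "'a::complex_algebra multiplier" where
  "oneH \<equiv> unit_multiplier UNIV"

abbreviation emb_tens :: "nat \<Rightarrow> 'a::complex_algebra tens \<Rightarrow> 'a tens multiplier" where
  "emb_tens n \<equiv> emb (tpow n)"

definition mtensor :: "'a::complex_algebra multiplier list \<Rightarrow> 'a tens multiplier" where
  "mtensor ms = Multiplier
     (lift (length ms) (\<lambda>xs. tensor (map2 lmul ms xs)))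
     (lift (length ms) (\<lambda>xs. tensor (map2 rmul ms xs)))"

definition tens_append :: "'a::complex_vector tens \<Rightarrow> 'a tens \<Rightarrow> 'a tens" where
  "tens_append s t = tens_lift (\<lambda>xs. tens_lift (\<lambda>ys. tensor (xs @ ys)) t) s"

text \<open>Tensor product of an element of \<open>mpow p\<close> and one of \<open>mpow q\<close>\<close>

definition mtens :: "nat \<Rightarrow> nat \<Rightarrow> 'a::complex_algebra tens multiplier \<Rightarrow> 'a tens multiplier
    \<Rightarrow> 'a tens multiplier" where
  "mtens p q m m' = Multiplier
     (lift (p + q) (\<lambda>xs. tens_append (lmul m (tensor (take p xs))) (lmul m' (tensor (drop p xs)))))
     (lift (p + q) (\<lambda>xs. tens_append (rmul m (tensor (take p xs))) (rmul m' (tensor (drop p xs)))))"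

text \<open>
  \<open>z\<close> is the value at the multiplier \<open>y\<close> of the canonical extension of the
  homomorphism \<open>d\<close> from the algebra \<open>A\<close> to the multiplier algebra of
  \<open>B\<close>.
\<close>

definition hom_extends_to :: "'a::complex_algebra set \<Rightarrow> 'b::complex_algebra set
    \<Rightarrow> ('a \<Rightarrow> 'b multiplier) \<Rightarrow> 'a multiplier \<Rightarrow> 'b multiplier \<Rightarrow> bool" where
  "hom_extends_to A B d y z \<longleftrightarrow> z \<in> multipliers B \<and>
     (\<forall>x\<in>A. \<forall>w\<in>B. lmul z (lmul (d x) w) = lmul (d (lmul y x)) w \<and>
        rmul z (rmul (d x) w) = rmul (d (rmul y x)) w)"

text \<open>The same for a character of \<open>H\<close>, the multiplier algebra of the scalars being the scalars\<close>

definition char_extends_to :: "('a::complex_algebra \<Rightarrow> complex) \<Rightarrow> 'a multiplier \<Rightarrow> complex \<Rightarrow> bool" where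
  "char_extends_to \<chi> y c \<longleftrightarrow> (\<forall>a. c * \<chi> a = \<chi> (lmul y a) \<and> \<chi> a * c = \<chi> (rmul y a))"

text \<open>
  The extension to multipliers of a bijective antihomomorphism of \<open>H\<close>, determined by
  \<open>S(y) S(a) = S(a y)\<close> and \<open>S(a) S(y) = S(y a)\<close>
\<close>

definition antihom_extension :: "('a \<Rightarrow> 'a) \<Rightarrow> 'a multiplier \<Rightarrow> 'a multiplier" where
  "antihom_extension S y = Multiplier (S \<circ> rmul y \<circ> inv S) (S \<circ> lmul y \<circ> inv S)"


section \<open>Multiplier Hopf algebras\<close>

text \<open>
  \<open>W_R(a \<otimes> b) = \<Delta>(a)(1 \<otimes> b)\<close> and \<open>W_L(a \<otimes> b) = (a \<otimes> 1)\<Delta>(b)\<close>, read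
  back from the multiplier algebra of the tensor square into the tensor square
\<close>

definition W_R :: "('a::complex_algebra \<Rightarrow> 'a tens multiplier) \<Rightarrow> 'a tens \<Rightarrow> 'a tens" where
  "W_R \<Delta> = lift 2 (\<lambda>xs. inv_into (tpow 2) (emb_tens 2)
     (\<Delta> (xs ! 0) * mtensor [oneH, embH (xs ! 1)]))"

definition W_L :: "('a::complex_algebra \<Rightarrow> 'a tens multiplier) \<Rightarrow> 'a tens \<Rightarrow> 'a tens" where
  "W_L \<Delta> = lift 2 (\<lambda>xs. inv_into (tpow 2) (emb_tens 2)
     (mtensor [embH (xs ! 0), oneH] * \<Delta> (xs ! 1)))"

text \<open>
  \<open>coproduct_at \<Delta> n i\<close> applies the coproduct to the \<open>i\<close>-th factor, counted
  from 1, of an element of the \<open>n\<close>-th tensor power.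
\<close>

definition coproduct_at :: "('a::complex_algebra \<Rightarrow> 'a tens multiplier) \<Rightarrow> nat \<Rightarrow> nat
    \<Rightarrow> 'a tens \<Rightarrow> 'a tens multiplier" where
  "coproduct_at \<Delta> n i = lift n (\<lambda>xs.
     mtens (i - 1) (2 + (n - i)) (mtensor (map embH (take (i - 1) xs)))
       (mtens 2 (n - i) (\<Delta> (xs ! (i - 1))) (mtensor (map embH (drop i xs)))))"

definition coassociative :: "('a::complex_algebra \<Rightarrow> 'a tens multiplier) \<Rightarrow> bool" where
  "coassociative \<Delta> \<longleftrightarrow> (\<forall>a b c.
     mtensor [embH a, oneH, oneH] * coproduct_at \<Delta> 2 1 (W_R \<Delta> (tensor [b, c])) =
     coproduct_at \<Delta> 2 2 (W_L \<Delta> (tensor [a, b])) * mtensor [oneH, oneH, embH c])"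

definition multiplier_Hopf_algebra :: "('a::complex_algebra \<Rightarrow> 'a tens multiplier) \<Rightarrow> bool" where
  "multiplier_Hopf_algebra \<Delta> \<longleftrightarrow>
     nondegenerate (UNIV :: 'a set) \<and>
     range \<Delta> \<subseteq> mpow 2 \<and> algebra_hom \<Delta> \<and>
     (\<forall>a b. \<Delta> a * mtensor [oneH, embH b] \<in> emb_tens 2 ` tpow 2) \<and>
     (\<forall>a b. mtensor [embH a, oneH] * \<Delta> b \<in> emb_tens 2 ` tpow 2) \<and>
     bij_betw (W_R \<Delta>) (tpow 2) (tpow 2) \<and>
     bij_betw (W_L \<Delta>) (tpow 2) (tpow 2) \<and>
     coassociative \<Delta>"

definition flip :: "'a::complex_vector tens \<Rightarrow> 'a tens" where
  "flip = lift 2 (\<lambda>xs. tensor (rev xs))"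

definition flip_coproduct :: "('a::complex_algebra \<Rightarrow> 'a tens multiplier) \<Rightarrow> 'a \<Rightarrow> 'a tens multiplier" where
  "flip_coproduct \<Delta> a = Multiplier (flip \<circ> lmul (\<Delta> a) \<circ> flip) (flip \<circ> rmul (\<Delta> a) \<circ> flip)"

definition regular_multiplier_Hopf_algebra ::
    "('a::complex_algebra \<Rightarrow> 'a tens multiplier) \<Rightarrow> bool" where
  "regular_multiplier_Hopf_algebra \<Delta> \<longleftrightarrow>
     multiplier_Hopf_algebra \<Delta> \<and> multiplier_Hopf_algebra (flip_coproduct \<Delta>)"

text \<open>
  Van Daele's characterizations: every multiplier Hopf algebra has exactly one counit and one
  antipode, and the antipode of a regular one is a bijection of \<open>H\<close>.
  The counit satisfies
  \<open>(\<epsilon> \<otimes> id)(\<Delta>(a)(1 \<otimes> b)) = ab = (id \<otimes> \<epsilon>)((a \<otimes> 1)\<Delta>(b))\<close>,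
  and the antipode satisfies
  \<open>m(S \<otimes> id)(\<Delta>(a)(1 \<otimes> b)) = \<epsilon>(a)b\<close> and
  \<open>m(id \<otimes> S)((a \<otimes> 1)\<Delta>(b)) = \<epsilon>(b)a\<close>.
\<close>

definition is_counit :: "('a::complex_algebra \<Rightarrow> 'a tens multiplier) \<Rightarrow> ('a \<Rightarrow> complex) \<Rightarrow> bool" where
  "is_counit \<Delta> \<epsilon> \<longleftrightarrow> algebra_hom \<epsilon> \<and>
     (\<forall>a b. lift 2 (\<lambda>xs. \<epsilon> (xs ! 0) *\<^sub>C xs ! 1) (W_R \<Delta> (tensor [a, b])) = a * b \<and>
        lift 2 (\<lambda>xs. \<epsilon> (xs ! 1) *\<^sub>C xs ! 0) (W_L \<Delta> (tensor [a, b])) = a * b)"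

definition is_antipode :: "('a::complex_algebra \<Rightarrow> 'a tens multiplier) \<Rightarrow> ('a \<Rightarrow> complex)
    \<Rightarrow> ('a \<Rightarrow> 'a) \<Rightarrow> bool" where
  "is_antipode \<Delta> \<epsilon> S \<longleftrightarrow> clinear S \<and> bij S \<and>
     (\<forall>a b. lift 2 (\<lambda>xs. S (xs ! 0) * xs ! 1) (W_R \<Delta> (tensor [a, b])) = \<epsilon> a *\<^sub>C b \<and>
        lift 2 (\<lambda>xs. xs ! 0 * S (xs ! 1)) (W_L \<Delta> (tensor [a, b])) = \<epsilon> b *\<^sub>C a)"

definition is_character :: "('a::complex_algebra \<Rightarrow> complex) \<Rightarrow> bool" where
  "is_character \<delta> \<longleftrightarrow> algebra_hom \<delta> \<and> (\<exists>a. \<delta> a \<noteq> 0)"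

definition group_like :: "('a::complex_algebra \<Rightarrow> 'a tens multiplier) \<Rightarrow> 'a multiplier \<Rightarrow> bool" where
  "group_like \<Delta> \<sigma> \<longleftrightarrow> \<sigma> \<in> multipliers UNIV \<and>
     hom_extends_to UNIV (tpow 2) \<Delta> \<sigma> (mtensor [\<sigma>, \<sigma>])"

text \<open>
  The map \<open>T\<close> with \<open>\<delta>(a) T(h) = (\<delta> \<otimes> S) W_L(a \<otimes> h)\<close> for all \<open>a\<close> and \<open>h\<close>.
  In a modular pair this is the twisted antipode of the pair; its formula does not involve the
  group-like element.
\<close>

definition twisted_antipode :: "('a::complex_algebra \<Rightarrow> 'a tens multiplier) \<Rightarrow> ('a \<Rightarrow> 'a)
    \<Rightarrow> ('a \<Rightarrow> complex) \<Rightarrow> 'a \<Rightarrow> 'a" where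
  "twisted_antipode \<Delta> S \<delta> h = (THE s. \<forall>a.
     \<delta> a *\<^sub>C s = lift 2 (\<lambda>xs. \<delta> (xs ! 0) *\<^sub>C S (xs ! 1)) (W_L \<Delta> (tensor [a, h])))"

definition modular_pair_in_involution :: "('a::complex_algebra \<Rightarrow> 'a tens multiplier) \<Rightarrow> ('a \<Rightarrow> 'a)
    \<Rightarrow> ('a \<Rightarrow> complex) \<Rightarrow> 'a multiplier \<Rightarrow> bool" where
  "modular_pair_in_involution \<Delta> S \<delta> \<sigma> \<longleftrightarrow>
     is_character \<delta> \<and> group_like \<Delta> \<sigma> \<and> char_extends_to \<delta> \<sigma> 1 \<and>
     (\<forall>h. embH (twisted_antipode \<Delta> S \<delta> (twisted_antipode \<Delta> S \<delta> h)) =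
        \<sigma> * embH h * antihom_extension S \<sigma>)"


section \<open>The spaces of multipliers and the cosimplicial maps\<close>

definition N_alg :: "'a::complex_algebra multiplier \<Rightarrow> 'a multiplier set" where
  "N_alg \<sigma> = (\<lambda>B. complex_vector.subspace B \<and> (\<forall>x\<in>B. \<forall>y\<in>B. x * y \<in> B)) hull
     (range embH \<union> {oneH, \<sigma>})"

text \<open>
  \<open>N_slot \<sigma> n i\<close> is the span of the tensors of length \<open>n\<close> whose
  \<open>i\<close>-th factor (counted from 1) is in \<open>N_alg \<sigma>\<close> and whose other
  factors are in \<open>H\<close>.
\<close>

definition N_slot :: "'a::complex_algebra multiplier \<Rightarrow> nat \<Rightarrow> nat \<Rightarrow> 'a tens multiplier set" where
  "N_slot \<sigma> n i = complex_vector.span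
     {mtensor ((map embH as)[i - 1 := \<nu>]) |as \<nu>. length as = n \<and> \<nu> \<in> N_alg \<sigma>}"

definition M0 :: "'a::complex_algebra multiplier \<Rightarrow> nat \<Rightarrow> 'a tens multiplier set" where
  "M0 \<sigma> n = {z \<in> mpow n. \<forall>i\<in>{1..n}. \<forall>as. length as = n \<longrightarrow>
     (let w = mtensor ((map embH as)[i - 1 := oneH])
      in z * w \<in> N_slot \<sigma> n i \<and> w * z \<in> N_slot \<sigma> n i)}"

definition coface :: "('a::complex_algebra \<Rightarrow> 'a tens multiplier) \<Rightarrow> 'a multiplier
    \<Rightarrow> nat \<Rightarrow> nat \<Rightarrow> 'a tens \<Rightarrow> 'a tens multiplier" where
  "coface \<Delta> \<sigma> n i =
     (if i = 0 then lift n (\<lambda>xs. mtensor (oneH # map embH xs))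
      else if i = n + 1 then lift n (\<lambda>xs. mtensor (map embH xs @ [\<sigma>]))
      else coproduct_at \<Delta> n i)"

definition codegeneracy :: "('a::complex_algebra \<Rightarrow> complex) \<Rightarrow> nat \<Rightarrow> nat \<Rightarrow> 'a tens \<Rightarrow> 'a tens" where
  "codegeneracy \<epsilon> n i = lift n (\<lambda>xs. \<epsilon> (xs ! (i - 1)) *\<^sub>C tensor (take (i - 1) xs @ drop i xs))"

definition extends_coface :: "('a::complex_algebra \<Rightarrow> 'a tens multiplier) \<Rightarrow> 'a multiplier
    \<Rightarrow> nat \<Rightarrow> nat \<Rightarrow> ('a tens multiplier \<Rightarrow> 'a tens multiplier) \<Rightarrow> bool" where
  "extends_coface \<Delta> \<sigma> n i D \<longleftrightarrow>
     clinear_on (M0 \<sigma> n) D \<and>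
     (\<forall>x\<in>tpow n. D (emb_tens n x) = coface \<Delta> \<sigma> n i x) \<and>
     (\<forall>y\<in>M0 \<sigma> n.
        if i = 0 then D y = mtens 1 n (mtensor [oneH]) y
        else if i = n + 1 then D y = mtens n 1 y (mtensor [\<sigma>])
        else hom_extends_to (tpow n) (tpow (n + 1)) (coface \<Delta> \<sigma> n i) y (D y))"

text \<open>
  \<open>E\<close> is the canonical extension to \<open>M0 \<sigma> n\<close> of the \<open>i\<close>-th
  codegeneracy map on the \<open>n\<close>-th tensor power.
\<close>

definition extends_codegeneracy :: "('a::complex_algebra \<Rightarrow> complex) \<Rightarrow> 'a multiplier
    \<Rightarrow> nat \<Rightarrow> nat \<Rightarrow> ('a tens multiplier \<Rightarrow> 'a tens multiplier) \<Rightarrow> bool" where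
  "extends_codegeneracy \<epsilon> \<sigma> n i E \<longleftrightarrow>
     clinear_on (M0 \<sigma> n) E \<and>
     (\<forall>x\<in>tpow n. E (emb_tens n x) = emb_tens (n - 1) (codegeneracy \<epsilon> n i x)) \<and>
     (\<forall>y\<in>M0 \<sigma> n. \<forall>as. length as = n \<longrightarrow>
        (let a' = tensor (take (i - 1) as @ drop i as) in
         \<epsilon> (as ! (i - 1)) *\<^sub>C lmul (E y) a' = codegeneracy \<epsilon> n i (lmul y (tensor as)) \<and>
         \<epsilon> (as ! (i - 1)) *\<^sub>C rmul (E y) a' = codegeneracy \<epsilon> n i (rmul y (tensor as))))"

end

theory Submission
  imports Defs
begin

text \<open>
  A homomorphism \<open>d : A \<rightarrow> M(B)\<close> with \<open>d(A)B\<close> and \<open>B d(A)\<close> spanning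
  \<open>B\<close> extends to \<open>M(A)\<close>: the vector \<open>d(y)b\<close> is the only \<open>v\<close> such that
  \<open>(w d(x))v = (w d(xy))b\<close> for all \<open>x\<close> and \<open>w\<close>, and it exists for
  \<open>b = d(x')w'\<close>, where it is \<open>d(yx')w'\<close>. The inner cofaces and the codegeneracies are
  of this kind, because the tensor powers of \<open>H\<close> are non-degenerate and because
  \<open>H = H H\<close>, which follows from surjectivity of \<open>W_R\<close> and the counit.

  That the extensions respect the spaces \<open>M0\<close> comes from multiplicativity. To multiply
  \<open>\<delta>_i(y)\<close> by a tensor with 1 in one slot, write the entries of that tensor in the slots
  \<open>i, i + 1\<close> as combinations of \<open>\<Delta>(c)(1 \<otimes> d)\<close>, or as \<open>\<Delta>(1)(1 \<otimes> b)\<close> or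
  \<open>\<Delta>(1)(a \<otimes> 1)\<close> if the 1 is among them. The product is then \<open>\<delta>_i(y w)\<close> times
  elements of \<open>H\<close>, where \<open>y w\<close> is known to have its factors in \<open>H\<close> and one of them
  in \<open>N(H)\<close>. What remains is \<open>\<Delta>(N(H))(1 \<otimes> H) \<subseteq> N(H) \<otimes> H\<close> and its variants,
  which use regularity. Similarly the codegeneracies are computed after inserting an element of
  counit 1 into the removed slot.
\<close>

text \<open>Non-degeneracy of the tensor powers is not immediate: H has no unit and no local units
  are assumed, so a tensor cannot be detected by multiplying it with a well-chosen element. Linear
  functionals are used instead: contract all factors but one, use non-degeneracy of H in the
  remaining one, and induct on the number of factors. Regularity is forced by the two-sided
  definition of \<open>M0\<close>. A multiplier Hopf algebra only provides \<Delta>(a)(1 \<otimes>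
  b) and (a \<otimes> 1)\<Delta>(b) in H \<otimes> H, but the test tensors are multiplied on either
  side and may have their 1 in either of the two slots that \<Delta> fills, so \<Delta>(a)(b
  \<otimes> 1) and (1 \<otimes> a)\<Delta>(b) occur too. For the same reason a pair a \<otimes> b is
  rewritten through \<open>W_R\<close> on one side and through \<open>W_L\<close> on the other. The
  character of the modular pair shows that H is not 0; this makes the counit non-zero and yields the
  element of counit 1.\<close>

abbreviation csubspace :: "'a::complex_vector set \<Rightarrow> bool" where
  "csubspace \<equiv> complex_vector.subspace"

abbreviation cspan :: "'a::complex_vector set \<Rightarrow> 'a set" where
  "cspan \<equiv> complex_vector.span"

lemmas csubspace_cspan = complex_vector.subspace_span
  and csubspace_0 = complex_vector.subspace_0
  and csubspace_Inter = complex_vector.subspace_Inter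
  and csubspace_UNIV = complex_vector.subspace_UNIV
  and csubspace_add = complex_vector.subspace_add
  and csubspace_scale = complex_vector.subspace_scale
  and csubspace_diff = complex_vector.subspace_diff
  and cspan_base = complex_vector.span_base
  and cspan_extend_basis = complex_vector.span_extend_basis
  and cspan_induct_alt = complex_vector.span_induct_alt
  and cspan_minimal = complex_vector.span_minimal
  and cspan_mono = complex_vector.span_mono
  and cspan_superset = complex_vector.span_superset

section \<open>Maps that are linear on a subspace\<close>

lemma clinear_onI:
  assumes "\<And>x y. x \<in> A \<Longrightarrow> y \<in> A \<Longrightarrow> f (x + y) = f x + f y"
    and "\<And>c x. x \<in> A \<Longrightarrow> f (c *\<^sub>C x) = c *\<^sub>C f x"
  shows "clinear_on A f"
  using assms by (simp add: clinear_on_def)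

lemma clinear_on_add: "clinear_on A f \<Longrightarrow> x \<in> A \<Longrightarrow> y \<in> A \<Longrightarrow> f (x + y) = f x + f y"
  and clinear_on_scaleC: "clinear_on A f \<Longrightarrow> x \<in> A \<Longrightarrow> f (c *\<^sub>C x) = c *\<^sub>C f x"
  by (simp_all add: clinear_on_def)

lemmas clinear_onD = clinear_on_add clinear_on_scaleC

lemma clinear_on_zero: "clinear_on A f \<Longrightarrow> 0 \<in> A \<Longrightarrow> f 0 = 0"
  using clinear_on_scaleC[of A f 0 0] by simp

lemma clinear_imp_clinear_on: "clinear f \<Longrightarrow> clinear_on A f"
  by (simp add: clinear_on_def linear_iff Vector_Spaces.linear_iff)

lemma csubspaceI:
  assumes "0 \<in> A" "\<And>x y. x \<in> A \<Longrightarrow> y \<in> A \<Longrightarrow> x + y \<in> A" "\<And>c x. x \<in> A \<Longrightarrow> c *\<^sub>C x \<in> A"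
  shows "csubspace A"
  using assms by (simp add: complex_vector.subspace_def)

text \<open>The maps need not be linear outside \<open>A\<close>, so the span induction has to carry
  membership in \<open>A\<close> along with the equality.\<close>

lemma clinear_on_span_eq:
  assumes "clinear_on A f" "clinear_on A g" "csubspace A" "G \<subseteq> A" "A \<subseteq> cspan G"
    and "\<And>x. x \<in> G \<Longrightarrow> f x = g x" "x \<in> A"
  shows "f x = g x"
proof -
  have "x \<in> cspan G" using assms by auto
  then have "x \<in> A \<and> f x = g x"
  proof (induction rule: cspan_induct_alt)
    case base
    then show ?case using assms(1-3) by (simp add: clinear_on_zero csubspace_0)
  next
    case (step c u y)
    then have "u \<in> A" "c *\<^sub>C u \<in> A" "c *\<^sub>C u + y \<in> A"
      using assms by (auto intro: csubspace_add csubspace_scale)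
    with step assms show ?case
      by (simp add: clinear_on_add[of A] clinear_on_scaleC[of A])
  qed
  then show ?thesis by simp
qed

lemma clinear_on_span_mem:
  assumes "clinear_on A f" "csubspace A" "G \<subseteq> A" "x \<in> cspan G" "csubspace T"
    and "\<And>x. x \<in> G \<Longrightarrow> f x \<in> T"
  shows "f x \<in> T"
proof -
  have "x \<in> A \<and> f x \<in> T"
    using assms(4)
  proof (induction rule: cspan_induct_alt)
    case base
    then show ?case using assms by (simp add: clinear_on_zero csubspace_0)
  next
    case (step c u y)
    then have "u \<in> A" "c *\<^sub>C u \<in> A" "c *\<^sub>C u + y \<in> A"
      using assms by (auto intro: csubspace_add csubspace_scale)
    with step assms show ?case
      by (auto simp: clinear_on_add[of A] clinear_on_scaleC[of A]
        intro: csubspace_add csubspace_scale)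
  qed
  then show ?thesis by simp
qed

lemma clinear_on_compose:
  "clinear_on A f \<Longrightarrow> f \<in> A \<rightarrow> B \<Longrightarrow> clinear_on B g \<Longrightarrow> clinear_on A (\<lambda>x. g (f x))"
  by (auto simp: clinear_on_def Pi_iff)

lemma csubspace_image:
  assumes f: "clinear_on A f" and A: "csubspace A"
  shows "csubspace (f ` A)"
proof (rule csubspaceI)
  show "0 \<in> f ` A"
    using clinear_on_zero[OF f] csubspace_0[OF A] by force
  show "x + y \<in> f ` A" if "x \<in> f ` A" "y \<in> f ` A" for x y
    using that csubspace_add[OF A] by (auto simp flip: clinear_on_add[OF f])
  show "c *\<^sub>C x \<in> f ` A" if "x \<in> f ` A" for c x
    using that csubspace_scale[OF A] by (auto simp flip: clinear_on_scaleC[OF f])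
qed

section \<open>Multipliers of a non-degenerate algebra\<close>

text \<open>All tensor powers are subsets of one type, so being a subalgebra is a condition on the
  set; \<open>nondegenerate\<close> does not contain it.\<close>

definition nd_algebra :: "'a::complex_algebra set \<Rightarrow> bool" where
  "nd_algebra A \<longleftrightarrow> csubspace A \<and> (\<forall>a\<in>A. \<forall>b\<in>A. a * b \<in> A) \<and> nondegenerate A"

lemma nd_algebraD:
  assumes "nd_algebra A"
  shows "csubspace A" "\<And>a b. a \<in> A \<Longrightarrow> b \<in> A \<Longrightarrow> a * b \<in> A"
    "\<And>a. a \<in> A \<Longrightarrow> (\<And>b. b \<in> A \<Longrightarrow> a * b = 0) \<Longrightarrow> a = 0"
    "\<And>a. a \<in> A \<Longrightarrow> (\<And>b. b \<in> A \<Longrightarrow> b * a = 0) \<Longrightarrow> a = 0"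
  using assms unfolding nd_algebra_def nondegenerate_def by blast+

lemma clinear_on_mult_left: "clinear_on A (\<lambda>x. x * (b::'a::complex_algebra))"
  and clinear_on_mult_right: "clinear_on A (\<lambda>x. (b::'a::complex_algebra) * x)"
  by (simp_all add: clinear_on_def distrib_left distrib_right mult_scaleC_left mult_scaleC_right)

text \<open>By linearity it suffices to test on a spanning set \<open>G\<close>. It is applied with
  \<open>G\<close> the vectors d(x)w of a non-degenerate homomorphism, where an extension is known
  explicitly.\<close>

lemma nd_cancel_right:
  assumes A: "nd_algebra A" and "A \<subseteq> cspan G" "G \<subseteq> A" "u \<in> A" "v \<in> A" "\<And>g. g \<in> G \<Longrightarrow> u * g = v * g"
  shows "u = v"
proof -
  have "u * g = v * g" if "g \<in> A" for g
    by (rule clinear_on_span_eq[OF clinear_on_mult_right[of A u] clinear_on_mult_right[of A v]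
      nd_algebraD(1)[OF A] assms(3,2)])
      (use assms that in auto)
  then have "u - v = 0"
    using assms(4,5)
    by (intro nd_algebraD(3)[OF A, of "u - v"] csubspace_diff[OF nd_algebraD(1)[OF A]])
       (simp_all add: left_diff_distrib)
  then show ?thesis by simp
qed

lemma nd_cancel_left:
  assumes A: "nd_algebra A" and "A \<subseteq> cspan G" "G \<subseteq> A" "u \<in> A" "v \<in> A" "\<And>g. g \<in> G \<Longrightarrow> g * u = g * v"
  shows "u = v"
proof -
  have "g * u = g * v" if "g \<in> A" for g
    by (rule clinear_on_span_eq[OF clinear_on_mult_left[of A u] clinear_on_mult_left[of A v]
      nd_algebraD(1)[OF A] assms(3,2)])
      (use assms that in auto)
  then have "u - v = 0"
    using assms(4,5)
    by (intro nd_algebraD(4)[OF A, of "u - v"] csubspace_diff[OF nd_algebraD(1)[OF A]])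
       (simp_all add: right_diff_distrib)
  then show ?thesis by simp
qed

lemma cspan_self: "A \<subseteq> cspan A"
  by (rule cspan_superset)

text \<open>The compatibility a L(b) = R(a) b of the two maps is enough. It moves L or R across a
  product, so each linearity or module identity holds after multiplication by an arbitrary element,
  which non-degeneracy cancels.\<close>

lemma multipliersI:
  assumes A: "nd_algebra A"
    and L: "lmul m \<in> A \<rightarrow> A" and R: "rmul m \<in> A \<rightarrow> A"
    and 0: "\<And>x. x \<notin> A \<Longrightarrow> lmul m x = 0" "\<And>x. x \<notin> A \<Longrightarrow> rmul m x = 0"
    and compat: "\<And>a b. a \<in> A \<Longrightarrow> b \<in> A \<Longrightarrow> a * lmul m b = rmul m a * b"
  shows "m \<in> multipliers A"
proof -
  note [simp] = nd_algebraD(2)[OF A] funcset_mem[OF L] funcset_mem[OF R]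
    csubspace_add[OF nd_algebraD(1)[OF A]]
    csubspace_scale[OF nd_algebraD(1)[OF A]]
  have l: "lmul m x = y" if "x \<in> A" "y \<in> A" "\<And>a. a \<in> A \<Longrightarrow> rmul m a * x = a * y" for x y
    by (rule nd_cancel_left[OF A cspan_self]) (use that in \<open>simp_all add: compat\<close>)
  have r: "rmul m x = y" if "x \<in> A" "y \<in> A" "\<And>a. a \<in> A \<Longrightarrow> x * lmul m a = y * a" for x y
    by (rule nd_cancel_right[OF A cspan_self]) (use that in \<open>simp_all flip: compat\<close>)
  have "clinear_on A (lmul m)"
    by (rule clinear_onI; rule l) (simp_all add: distrib_left compat mult_scaleC_right)
  moreover have "clinear_on A (rmul m)"
    by (rule clinear_onI; rule r) (simp_all add: distrib_right compat mult_scaleC_left)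
  moreover have "lmul m (a * b) = lmul m a * b" if "a \<in> A" "b \<in> A" for a b
    by (rule l) (use that in \<open>simp_all add: compat flip: mult.assoc\<close>)
  moreover have "rmul m (a * b) = a * rmul m b" if "a \<in> A" "b \<in> A" for a b
    by (rule r) (use that in \<open>simp_all add: compat mult.assoc\<close>)
  ultimately show ?thesis
    using assms by (simp add: multipliers_def)
qed

lemma multipliersD:
  assumes "m \<in> multipliers A"
  shows "\<And>a. a \<in> A \<Longrightarrow> lmul m a \<in> A" "\<And>a. a \<in> A \<Longrightarrow> rmul m a \<in> A"
    "clinear_on A (lmul m)" "clinear_on A (rmul m)"
    "\<And>x. x \<notin> A \<Longrightarrow> lmul m x = 0" "\<And>x. x \<notin> A \<Longrightarrow> rmul m x = 0"
    "\<And>a b. a \<in> A \<Longrightarrow> b \<in> A \<Longrightarrow> lmul m (a * b) = lmul m a * b"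
    "\<And>a b. a \<in> A \<Longrightarrow> b \<in> A \<Longrightarrow> rmul m (a * b) = a * rmul m b"
    "\<And>a b. a \<in> A \<Longrightarrow> b \<in> A \<Longrightarrow> a * lmul m b = rmul m a * b"
  using assms by (auto simp: multipliers_def Pi_iff)

text \<open>The right map is determined by the left one: \<open>rmul m x * g\<close> equals
  \<open>x * lmul m g\<close>, and g can be cancelled. Hence only left actions on a spanning set are
  compared.\<close>

lemma multiplier_eqI:
  assumes A: "nd_algebra A" and m: "m \<in> multipliers A" "m' \<in> multipliers A"
    and G: "A \<subseteq> cspan G" "G \<subseteq> A" "\<And>x. x \<in> G \<Longrightarrow> lmul m x = lmul m' x"
  shows "m = m'"
proof -
  have l: "lmul m x = lmul m' x" if "x \<in> A" for x
    by (rule clinear_on_span_eq[OF multipliersD(3)[OF m(1)] multipliersD(3)[OF m(2)]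
      nd_algebraD(1)[OF A] G(2,1)])
      (use G that in auto)
  have r: "rmul m x = rmul m' x" if "x \<in> A" for x
    by (rule nd_cancel_right[OF A cspan_self])
      (use that m l in \<open>auto simp: multipliersD simp flip: multipliersD(9)\<close>)
  show ?thesis
  proof (rule multiplier.expand, intro conjI ext)
    show "lmul m x = lmul m' x" for x
      by (cases "x \<in> A") (use l multipliersD(5)[OF m(1)] multipliersD(5)[OF m(2)] in auto)
    show "rmul m x = rmul m' x" for x
      by (cases "x \<in> A") (use r multipliersD(6)[OF m(1)] multipliersD(6)[OF m(2)] in auto)
  qed
qed

lemma lmul_times [simp]: "lmul (m * m') x = lmul m (lmul m' x)"
  and rmul_times [simp]: "rmul (m * m') x = rmul m' (rmul m x)"
  and lmul_plus [simp]: "lmul (m + m') x = lmul m x + lmul m' x"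
  and rmul_plus [simp]: "rmul (m + m') x = rmul m x + rmul m' x"
    for m m' :: "'b::complex_vector multiplier"
  by (simp_all add: times_multiplier_def plus_multiplier_def)

lemma lmul_scaleC [simp]: "lmul (c *\<^sub>C m) x = c *\<^sub>C lmul m x"
  and rmul_scaleC [simp]: "rmul (c *\<^sub>C m) x = c *\<^sub>C rmul m x"
  and lmul_zero [simp]: "lmul 0 x = 0"
  and rmul_zero [simp]: "rmul 0 x = 0" for x :: "'b::complex_vector"
  by (simp_all add: scaleC_multiplier_def zero_multiplier_def)

lemma multiplier_mult_assoc: "(m * m') * m'' = m * (m' * m'')" for m :: "'a multiplier"
  by (simp add: times_multiplier_def comp_assoc)

lemma multipliers_times:
  assumes A: "nd_algebra A" and m: "m \<in> multipliers A" "m' \<in> multipliers A"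
  shows "m * m' \<in> multipliers A"
  by (rule multipliersI[OF A])
    (use m nd_algebraD(1)[OF A] in \<open>auto simp: multipliersD
      clinear_on_zero[OF multipliersD(3)[OF m(1)]]
       clinear_on_zero[OF multipliersD(4)[OF m(2)]] csubspace_0\<close>)

lemma csubspace_multipliers:
  assumes A: "nd_algebra A"
  shows "csubspace (multipliers A)"
proof (rule csubspaceI)
  note [simp] = csubspace_add[OF nd_algebraD(1)[OF A]]
    csubspace_scale[OF nd_algebraD(1)[OF A]] csubspace_0[OF nd_algebraD(1)[OF A]]
  show "0 \<in> multipliers A"
    by (rule multipliersI[OF A]) auto
  show "m + m' \<in> multipliers A" if "m \<in> multipliers A" "m' \<in> multipliers A" for m m'
    by (rule multipliersI[OF A]) (use that in \<open>auto simp: multipliersD distrib_left distrib_right\<close>)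
  show "c *\<^sub>C m \<in> multipliers A" if "m \<in> multipliers A" for c m
    by (rule multipliersI[OF A]) (use that in \<open>auto simp: multipliersD mult_scaleC_left
      mult_scaleC_right\<close>)
qed

lemma emb_in_multipliers: "nd_algebra A \<Longrightarrow> x \<in> A \<Longrightarrow> emb A x \<in> multipliers A"
  by (rule multipliersI) (auto simp: emb_def nd_algebraD mult.assoc)

lemma lmul_emb: "a \<in> A \<Longrightarrow> lmul (emb A x) a = x * a"
  and rmul_emb: "a \<in> A \<Longrightarrow> rmul (emb A x) a = a * x"
  by (simp_all add: emb_def)

lemma unit_in_multipliers: "nd_algebra A \<Longrightarrow> unit_multiplier A \<in> multipliers A"
  by (rule multipliersI) (auto simp: unit_multiplier_def)

lemma lmul_unit: "a \<in> A \<Longrightarrow> lmul (unit_multiplier A) a = a"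
  by (simp add: unit_multiplier_def)

lemma unit_times:
  assumes A: "nd_algebra A" and m: "m \<in> multipliers A"
  shows "unit_multiplier A * m = m" "m * unit_multiplier A = m"
  by (rule multiplier_eqI[OF A _ m cspan_self];
      use m A in \<open>auto simp: multipliers_times unit_in_multipliers lmul_unit multipliersD\<close>)+

lemma clinear_on_emb: "clinear_on A (emb A)"
  by (rule clinear_onI) (auto intro!: multiplier.expand
    simp: emb_def fun_eq_iff plus_multiplier_def scaleC_multiplier_def distrib_left distrib_right
      mult_scaleC_left mult_scaleC_right)

lemma inj_on_emb: "nd_algebra A \<Longrightarrow> inj_on (emb A) A"
proof (rule inj_onI)
  fix x y assume *: "nd_algebra A" "x \<in> A" "y \<in> A" "emb A x = emb A y"
  show "x = y"
  proof (rule nd_cancel_right[OF *(1) cspan_self])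
    show "x * g = y * g" if "g \<in> A" for g
      using *(4) that lmul_emb by metis
  qed (use * in auto)
qed

lemma times_emb: "nd_algebra A \<Longrightarrow> m \<in> multipliers A \<Longrightarrow> x \<in> A \<Longrightarrow> m * emb A x = emb A (lmul m x)"
  by (rule multiplier_eqI[OF _ _ _ cspan_self])
    (auto simp: multipliers_times emb_in_multipliers lmul_emb multipliersD nd_algebraD)

lemma emb_times: "nd_algebra A \<Longrightarrow> m \<in> multipliers A \<Longrightarrow> x \<in> A \<Longrightarrow> emb A x * m = emb A (rmul m x)"
  by (rule multiplier_eqI[OF _ _ _ cspan_self])
    (auto simp: multipliers_times emb_in_multipliers lmul_emb multipliersD nd_algebraD)

lemma clinear_on_times_right:
  assumes A: "nd_algebra A" and m: "m \<in> multipliers A"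
  shows "clinear_on (multipliers A) ((*) m)"
  using m by (auto intro!: clinear_onI multiplier_eqI[OF A _ _ cspan_self]
     csubspace_add csubspace_scale csubspace_multipliers A multipliers_times
     simp: clinear_onD[OF multipliersD(3)] multipliersD)

lemma clinear_on_times_left:
  assumes A: "nd_algebra A" and m: "m \<in> multipliers A"
  shows "clinear_on (multipliers A) (\<lambda>x. x * m)"
  using m by (auto intro!: clinear_onI multiplier_eqI[OF A _ _ cspan_self]
     csubspace_add csubspace_scale csubspace_multipliers A multipliers_times
     simp: clinear_onD[OF multipliersD(3)] multipliersD)

text \<open>The side is a parameter: the conditions that define \<open>M0\<close> come in pairs.\<close>

definition smul :: "bool \<Rightarrow> 'a::times \<Rightarrow> 'a \<Rightarrow> 'a" where
  "smul s m m' = (if s then m * m' else m' * m)"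

lemma smul_assoc: "smul s (smul s m m') m'' = smul s m (smul s m' m'')" for m :: "'a multiplier"
  by (simp add: smul_def multiplier_mult_assoc)

lemma smul_in_multipliers:
  "nd_algebra A \<Longrightarrow> m \<in> multipliers A \<Longrightarrow> m' \<in> multipliers A \<Longrightarrow> smul s m m' \<in> multipliers A"
  by (simp add: smul_def multipliers_times)

lemma clinear_on_smul_right:
  "nd_algebra A \<Longrightarrow> m \<in> multipliers A \<Longrightarrow> clinear_on (multipliers A) (smul s m)"
  by (cases s) (simp_all add: smul_def[abs_def] clinear_on_times_right clinear_on_times_left)

lemma clinear_on_smul_left:
  "nd_algebra A \<Longrightarrow> m \<in> multipliers A \<Longrightarrow> clinear_on (multipliers A) (\<lambda>x. smul s x m)"
  by (cases s) (simp_all add: smul_def[abs_def] clinear_on_times_right clinear_on_times_left)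

section \<open>Extension of non-degenerate homomorphisms\<close>

definition nd_hom :: "'a::complex_algebra set \<Rightarrow> 'b::complex_algebra set \<Rightarrow>
  ('a \<Rightarrow> 'b multiplier) \<Rightarrow> bool" where
  "nd_hom A B d \<longleftrightarrow> nd_algebra A \<and> nd_algebra B \<and> d \<in> A \<rightarrow> multipliers B \<and> clinear_on A d \<and>
     (\<forall>x\<in>A. \<forall>y\<in>A. d (x * y) = d x * d y) \<and>
     B \<subseteq> cspan {lmul (d x) w |x w. x \<in> A \<and> w \<in> B} \<and> B \<subseteq> cspan {rmul (d x) w |x w. x \<in> A \<and> w \<in> B}"

lemma nd_homD:
  assumes "nd_hom A B d"
  shows "nd_algebra A" "nd_algebra B" "\<And>x. x \<in> A \<Longrightarrow> d x \<in> multipliers B" "clinear_on A d"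
    "\<And>x y. x \<in> A \<Longrightarrow> y \<in> A \<Longrightarrow> d (x * y) = d x * d y"
    "B \<subseteq> cspan {lmul (d x) w |x w. x \<in> A \<and> w \<in> B}" "B \<subseteq> cspan {rmul (d x) w |x w. x \<in> A \<and> w \<in> B}"
    "{lmul (d x) w |x w. x \<in> A \<and> w \<in> B} \<subseteq> B" "{rmul (d x) w |x w. x \<in> A \<and> w \<in> B} \<subseteq> B"
  using assms by (auto simp: nd_hom_def Pi_iff multipliersD)

lemma hom_extends_unique:
  assumes d: "nd_hom A B d" and "hom_extends_to A B d y z" "hom_extends_to A B d y z'"
  shows "z = z'"
  by (rule multiplier_eqI[OF nd_homD(2)[OF d] _ _ nd_homD(6,8)[OF d]])
    (use assms in \<open>auto simp: hom_extends_to_def\<close>)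

text \<open>Both sides are w d(x y x') w', with y absorbed to the right or to the left. This
  identity makes d(x')w' \<mapsto> d(yx')w' compatible with its mirror image, and the whole
  extension rests on it.\<close>

lemma nd_hom_balance:
  assumes d: "nd_hom A B d" and y: "y \<in> multipliers A" and x: "x \<in> A" "w \<in> B" "x' \<in> A" "w' \<in> B"
  shows "rmul (d x) w * lmul (d (lmul y x')) w' = rmul (d (rmul y x)) w * lmul (d x') w'"
proof -
  note [simp] = multipliersD(1,2)[OF nd_homD(3)[OF d]] multipliersD(1,2)[OF y] nd_homD(3)[OF d]
  note dm = nd_homD(5)[OF d] and dc = multipliersD(9)[OF nd_homD(3)[OF d]]
  have "rmul (d x) w * lmul (d (lmul y x')) w' = w * lmul (d (x * lmul y x')) w'"
    using x by (simp add: dm flip: dc)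
  also have "\<dots> = w * lmul (d (rmul y x * x')) w'"
    using x by (simp add: multipliersD(9)[OF y])
  also have "\<dots> = rmul (d (rmul y x)) w * lmul (d x') w'"
    using x by (simp add: dm flip: dc)
  finally show ?thesis .
qed

text \<open>The condition on right multiplication follows from the one on the left: test against
  d(x')w', move z across the product, and apply \<open>nd_hom_balance\<close>.\<close>

lemma hom_extends_toI:
  assumes d: "nd_hom A B d" and y: "y \<in> multipliers A" and z: "z \<in> multipliers B"
    and eq: "\<And>x w. x \<in> A \<Longrightarrow> w \<in> B \<Longrightarrow> lmul z (lmul (d x) w) = lmul (d (lmul y x)) w"
  shows "hom_extends_to A B d y z"
proof -
  note [simp] = multipliersD(1,2)[OF nd_homD(3)[OF d]] multipliersD(1,2)[OF y]
    multipliersD(1,2)[OF z] nd_homD(3)[OF d]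
  have "rmul z (rmul (d x) w) = rmul (d (rmul y x)) w" if x: "x \<in> A" and w: "w \<in> B" for x w
  proof (rule nd_cancel_right[OF nd_homD(2)[OF d] nd_homD(6,8)[OF d]])
    fix g assume "g \<in> {lmul (d x) w |x w. x \<in> A \<and> w \<in> B}"
    then obtain x' w' where g: "g = lmul (d x') w'" and x': "x' \<in> A" and w': "w' \<in> B" by auto
    have "rmul z (rmul (d x) w) * g = rmul (d x) w * lmul (d (lmul y x')) w'"
      using x w x' w' by (simp add: g eq flip: multipliersD(9)[OF z])
    also have "\<dots> = rmul (d (rmul y x)) w * g"
      using nd_hom_balance[OF d y x w x' w'] by (simp add: g)
    finally show "rmul z (rmul (d x) w) * g = rmul (d (rmul y x)) w * g" .
  qed (use x w in simp_all)
  then show ?thesis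
    using z eq by (simp add: hom_extends_to_def)
qed

lemma hom_extends_exists:
  assumes d: "nd_hom A B d" and y: "y \<in> multipliers A"
  shows "\<exists>z. hom_extends_to A B d y z"
proof -
  note [simp] = multipliersD(1,2)[OF nd_homD(3)[OF d]] multipliersD(1,2)[OF y] nd_homD(3)[OF d]
  note A = nd_homD(1)[OF d] and B = nd_homD(2)[OF d]
  note key = nd_hom_balance[OF d y]
  define PL where "PL b v \<longleftrightarrow> v \<in> B \<and> (\<forall>x\<in>A. \<forall>w\<in>B. rmul (d x) w * v = rmul (d (rmul y x)) w * b)"
    for b v
  define PR where "PR b v \<longleftrightarrow> v \<in> B \<and> (\<forall>x\<in>A. \<forall>w\<in>B. v * lmul (d x) w = b * lmul (d (lmul y x)) w)"
    for b v
  have sB: "csubspace B" using B by (rule nd_algebraD)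
  note [simp] = csubspace_0[OF sB] csubspace_add[OF sB] csubspace_scale[OF sB]
  have uL: "v = v'" if "PL b v" "PL b v'" for b v v'
    by (rule nd_cancel_left[OF B nd_homD(7,9)[OF d]]) (use that in \<open>auto simp: PL_def\<close>)
  have uR: "v = v'" if "PR b v" "PR b v'" for b v v'
    by (rule nd_cancel_right[OF B nd_homD(6,8)[OF d]]) (use that in \<open>auto simp: PR_def\<close>)
  have eL: "\<exists>v. PL b v" if "b \<in> B" for b
  proof -
    have "b \<in> cspan {lmul (d x) w |x w. x \<in> A \<and> w \<in> B}" using nd_homD(6)[OF d] that by auto
    then show ?thesis
    proof (induction rule: cspan_induct_alt)
      case base
      show ?case by (rule exI[of _ 0]) (simp add: PL_def)
    next
      case (step c g b)
      then obtain x' w' v where "g = lmul (d x') w'" "x' \<in> A" "w' \<in> B" "PL b v" by auto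
      then have "PL (c *\<^sub>C g + b) (c *\<^sub>C lmul (d (lmul y x')) w' + v)"
        by (simp add: PL_def distrib_left mult_scaleC_right key)
      then show ?case ..
    qed
  qed
  have eR: "\<exists>v. PR b v" if "b \<in> B" for b
  proof -
    have "b \<in> cspan {rmul (d x) w |x w. x \<in> A \<and> w \<in> B}" using nd_homD(7)[OF d] that by auto
    then show ?thesis
    proof (induction rule: cspan_induct_alt)
      case base
      show ?case by (rule exI[of _ 0]) (simp add: PR_def)
    next
      case (step c g b)
      then obtain x' w' v where "g = rmul (d x') w'" "x' \<in> A" "w' \<in> B" "PR b v" by auto
      then have "PR (c *\<^sub>C g + b) (c *\<^sub>C rmul (d (rmul y x')) w' + v)"
        by (simp add: PR_def distrib_right mult_scaleC_left key)
      then show ?case ..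
    qed
  qed
  define L where "L b = (if b \<in> B then THE v. PL b v else 0)" for b
  define R where "R b = (if b \<in> B then THE v. PR b v else 0)" for b
  have PL: "PL b (L b)" if "b \<in> B" for b
    unfolding L_def using that eL[OF that] uL by (auto intro: theI)
  have PR: "PR b (R b)" if "b \<in> B" for b
    unfolding R_def using that eR[OF that] uR by (auto intro: theI)
  have LB: "L b \<in> B" and RB: "R b \<in> B" if "b \<in> B" for b
    using PL[OF that] PR[OF that] by (auto simp: PL_def PR_def)
  have L: "L (lmul (d x) w) = lmul (d (lmul y x)) w" if "x \<in> A" "w \<in> B" for x w
    by (rule uL[OF PL]) (use that key in \<open>auto simp: PL_def\<close>)
  have compat: "b * L c = R b * c" if "b \<in> B" "c \<in> B" for b c
  proof -
    have Lm: "\<exists>v. v \<in> B \<and> L c = v \<and> R b * c = b * v"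
    proof -
      have "c \<in> cspan {lmul (d x) w |x w. x \<in> A \<and> w \<in> B}" using nd_homD(6)[OF d] that(2) by auto
      \<comment> \<open>Linearity of \<open>L\<close> is not yet available, so the induction builds
        a witness v for c instead of computing \<open>L c\<close>; uniqueness identifies v with
        \<open>L c\<close> afterwards.\<close>
      then have "c \<in> B \<and> (\<exists>v. PL c v \<and> R b * c = b * v)"
      proof (induction rule: cspan_induct_alt)
        case base
        show ?case by (auto intro!: exI[of _ 0] simp: PL_def)
      next
        case (step k g e)
        then obtain x' w' v where "g = lmul (d x') w'" "x' \<in> A" "w' \<in> B" "PL e v" "e \<in> B"
          "R b * e = b * v" by auto
        moreover from this have "PL (k *\<^sub>C g + e) (k *\<^sub>C lmul (d (lmul y x')) w' + v)"
          by (simp add: PL_def distrib_left mult_scaleC_right key)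
        ultimately show ?case using PR[OF that(1)]
          by (auto intro!: exI[of _ "k *\<^sub>C lmul (d (lmul y x')) w' + v"]
            simp: PR_def distrib_left mult_scaleC_right)
      qed
      then obtain v where "PL c v" "R b * c = b * v" by auto
      then show ?thesis using uL PL that(2) by (metis PL_def)
    qed
    then show ?thesis by auto
  qed
  have "Multiplier L R \<in> multipliers B"
    by (rule multipliersI[OF B]) (use LB RB compat in \<open>auto simp: L_def R_def\<close>)
  then have "hom_extends_to A B d y (Multiplier L R)"
    by (rule hom_extends_toI[OF d y]) (simp add: L)
  then show ?thesis ..
qed

definition hom_extension :: "'a::complex_algebra set \<Rightarrow> 'b::complex_algebra set \<Rightarrow>
  ('a \<Rightarrow> 'b multiplier)
    \<Rightarrow> 'a multiplier \<Rightarrow> 'b multiplier" where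
  "hom_extension A B d y = (THE z. hom_extends_to A B d y z)"

lemma hom_extends_hom_extension: "nd_hom A B d \<Longrightarrow> y \<in> multipliers A \<Longrightarrow>
  hom_extends_to A B d y (hom_extension A B d y)"
  unfolding hom_extension_def using hom_extends_exists hom_extends_unique
    by (metis (no_types, lifting) theI)

lemma hom_extension_in_multipliers: "nd_hom A B d \<Longrightarrow> y \<in> multipliers A \<Longrightarrow>
  hom_extension A B d y \<in> multipliers B"
  using hom_extends_hom_extension unfolding hom_extends_to_def by blast

lemma lmul_hom_extension:
  "nd_hom A B d \<Longrightarrow> y \<in> multipliers A \<Longrightarrow> x \<in> A \<Longrightarrow> w \<in> B \<Longrightarrow>
    lmul (hom_extension A B d y) (lmul (d x) w) = lmul (d (lmul y x)) w"
  using hom_extends_hom_extension unfolding hom_extends_to_def by blast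

text \<open>Every property of the extension is obtained from this criterion: guess the value and
  check its left action on d(A)B. Units, products, sums and scalar multiples all follow in this
  way.\<close>

lemma hom_extension_eqI:
  assumes d: "nd_hom A B d" and y: "y \<in> multipliers A" and z: "z \<in> multipliers B"
    and eq: "\<And>x w. x \<in> A \<Longrightarrow> w \<in> B \<Longrightarrow> lmul z (lmul (d x) w) = lmul (d (lmul y x)) w"
  shows "hom_extension A B d y = z"
  using hom_extends_unique[OF d hom_extends_hom_extension[OF d y] hom_extends_toI[OF d y z eq]] .

lemma hom_extension_emb: "nd_hom A B d \<Longrightarrow> x \<in> A \<Longrightarrow> hom_extension A B d (emb A x) = d x"
  by (rule hom_extension_eqI) (auto simp: emb_in_multipliers nd_homD lmul_emb)

lemma hom_extension_unit: "nd_hom A B d \<Longrightarrow> hom_extension A B d (unit_multiplier A) =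
  unit_multiplier B"
  by (rule hom_extension_eqI) (auto simp: unit_in_multipliers nd_homD lmul_unit
    multipliersD(1)[OF nd_homD(3)])

lemma hom_extension_times:
  assumes d: "nd_hom A B d" and y: "y \<in> multipliers A" "y' \<in> multipliers A"
  shows "hom_extension A B d (y * y') = hom_extension A B d y * hom_extension A B d y'"
  by (rule hom_extension_eqI[OF d])
    (use y d in \<open>auto simp: multipliers_times nd_homD hom_extension_in_multipliers
      lmul_hom_extension multipliersD\<close>)

lemma hom_extension_smul:
  "nd_hom A B d \<Longrightarrow> y \<in> multipliers A \<Longrightarrow> y' \<in> multipliers A \<Longrightarrow>
    hom_extension A B d (smul s y y') = smul s (hom_extension A B d y) (hom_extension A B d y')"
  by (simp add: smul_def hom_extension_times)

lemma clinear_on_hom_extension: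
  assumes d: "nd_hom A B d"
  shows "clinear_on (multipliers A) (hom_extension A B d)"
proof (rule clinear_onI; rule hom_extension_eqI[OF d])
  note sA = csubspace_multipliers[OF nd_homD(1)[OF d]] and sB =
    csubspace_multipliers[OF nd_homD(2)[OF d]]
  fix x y c assume x: "x \<in> multipliers A"
  show "c *\<^sub>C x \<in> multipliers A" "c *\<^sub>C hom_extension A B d x \<in> multipliers B"
    using x d by (auto intro!: csubspace_scale sA sB simp: hom_extension_in_multipliers)
  show "lmul (c *\<^sub>C hom_extension A B d x) (lmul (d w) v) = lmul (d (lmul (c *\<^sub>C x) w)) v"
    if "w \<in> A" "v \<in> B" for w v
    using x that d by (simp add: lmul_hom_extension clinear_on_scaleC[OF nd_homD(4)[OF d]]
      multipliersD)
  assume y: "y \<in> multipliers A"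
  show "x + y \<in> multipliers A" "hom_extension A B d x + hom_extension A B d y \<in> multipliers B"
    using x y d by (auto intro!: csubspace_add sA sB simp: hom_extension_in_multipliers)
  show "lmul (hom_extension A B d x + hom_extension A B d y) (lmul (d w) v) =
    lmul (d (lmul (x + y) w)) v" if "w \<in> A" "v \<in> B" for w v
    using x y that d by (simp add: lmul_hom_extension clinear_on_add[OF nd_homD(4)[OF d]]
      multipliersD)
qed

section \<open>Linear maps on tensor powers\<close>

lemma csubspace_tpow: "csubspace (tpow n)"
  by (simp add: tpow_def)

lemmas tpow_add = csubspace_add[OF csubspace_tpow]
  and tpow_scaleC = csubspace_scale[OF csubspace_tpow]
  and tpow_0 = csubspace_0[OF csubspace_tpow]

lemma tpow_eqI:
  assumes "t \<in> tpow n" "clinear_on (tpow n) f" "clinear_on (tpow n) g"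
    and "\<And>xs. length xs = n \<Longrightarrow> f (tensor xs) = g (tensor xs)"
  shows "f t = g t"
  by (rule clinear_on_span_eq[OF assms(2,3) csubspace_tpow, of "{tensor xs |xs. length xs = n}"])
    (use assms in \<open>auto simp: tpow_def intro: cspan_base\<close>)

lemma tpow_memI:
  assumes "t \<in> tpow n" "clinear_on (tpow n) f" "csubspace T"
    and "\<And>xs. length xs = n \<Longrightarrow> f (tensor xs) \<in> T"
  shows "f t \<in> T"
  by (rule clinear_on_span_mem[OF assms(2) csubspace_tpow, of "{tensor xs |xs. length xs = n}"])
    (use assms in \<open>auto simp: tpow_def intro: cspan_base\<close>)

text \<open>Only lists of length n matter to \<open>lift n\<close>. On other lists the functions
  that occur, built from \<open>!\<close>, \<open>take\<close> and \<open>drop\<close>, carry no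
  meaning, so \<open>multilinear\<close> would ask too much.\<close>

definition mlin :: "nat \<Rightarrow> ('a::complex_vector list \<Rightarrow> 'b::complex_vector) \<Rightarrow> bool" where
  "mlin n f \<longleftrightarrow>
     (\<forall>us x y vs. length us + Suc (length vs) = n \<longrightarrow> f (us @ (x + y) # vs) =
       f (us @ x # vs) + f (us @ y # vs)) \<and>
     (\<forall>us c x vs. length us + Suc (length vs) = n \<longrightarrow> f (us @ (c *\<^sub>C x) # vs) =
       c *\<^sub>C f (us @ x # vs))"

lemma mlinI:
  assumes "\<And>us x y vs. length us + Suc (length vs) = n \<Longrightarrow> f (us @ (x + y) # vs) =
    f (us @ x # vs) + f (us @ y # vs)"
    and "\<And>us c x vs. length us + Suc (length vs) = n \<Longrightarrow> f (us @ (c *\<^sub>C x) # vs) =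
      c *\<^sub>C f (us @ x # vs)"
  shows "mlin n f"
  using assms unfolding mlin_def by blast

lemma mlinD:
  assumes "mlin n f" "length us + Suc (length vs) = n"
  shows "f (us @ (x + y) # vs) = f (us @ x # vs) + f (us @ y # vs)"
    "f (us @ (c *\<^sub>C x) # vs) = c *\<^sub>C f (us @ x # vs)"
  using assms unfolding mlin_def by blast+

lemma mlin_imp_multilinear: "mlin n f \<Longrightarrow> multilinear (\<lambda>xs. if length xs = n then f xs else 0)"
  unfolding multilinear_def by (simp add: mlinD)

lemma mlin_cong:
  assumes "mlin n f" "\<And>xs. length xs = n \<Longrightarrow> f xs = g xs"
  shows "mlin n g"
  by (rule mlinI) (use assms in \<open>simp_all add: mlinD flip: assms(2)\<close>)

lemma mlin_clinear_tensor: "clinear_on (tpow n) f \<Longrightarrow> mlin n (\<lambda>xs. f (tensor xs))"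
  by (rule mlinI) (auto simp: tensor_add tensor_scaleC clinear_on_add[of "tpow n"]
    clinear_on_scaleC[of "tpow n"] tensor_in_tpow)

lemma lift_tensor_mlin: "mlin n f \<Longrightarrow> length xs = n \<Longrightarrow> lift n f (tensor xs) = f xs"
  by (rule lift_tensor[OF mlin_imp_multilinear])

lemma clinear_on_lift_mlin: "mlin n f \<Longrightarrow> clinear_on (tpow n) (lift n f)"
  by (rule clinear_on_lift[OF mlin_imp_multilinear])

lemma lift_mem:
  assumes "mlin n f" "csubspace T" "\<And>xs. length xs = n \<Longrightarrow> f xs \<in> T" "t \<in> tpow n"
  shows "lift n f t \<in> T"
  by (rule tpow_memI[OF assms(4) clinear_on_lift_mlin[OF assms(1)] assms(2)])
    (simp add: lift_tensor_mlin assms)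

text \<open>An entry that varies lies in exactly one of the two blocks. The sets \<open>P\<close>
  and \<open>Q\<close> are there for pairings such as \<open>mtens\<close>, which is bilinear only
  on spaces of genuine multipliers.\<close>

lemma mlin_split:
  assumes g: "mlin p g" "\<And>us. length us = p \<Longrightarrow> g us \<in> P"
    and h: "mlin q h" "\<And>us. length us = q \<Longrightarrow> h us \<in> Q"
    and l: "\<And>t. t \<in> Q \<Longrightarrow> clinear_on P (\<lambda>s. \<beta> s t)"
    and r: "\<And>s. s \<in> P \<Longrightarrow> clinear_on Q (\<beta> s)"
  shows "mlin (p + q) (\<lambda>xs. \<beta> (g (take p xs)) (h (drop p xs)))"
proof -
  have "\<beta> (g (take p (us @ (x + y) # vs))) (h (drop p (us @ (x + y) # vs))) =
       \<beta> (g (take p (us @ x # vs))) (h (drop p (us @ x # vs))) + \<beta> (g (take p (us @ y # vs))) (h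
         (drop p (us @ y # vs))) \<and>
     \<beta> (g (take p (us @ (c *\<^sub>C x) # vs))) (h (drop p (us @ (c *\<^sub>C x) # vs))) =
       c *\<^sub>C \<beta> (g (take p (us @ x # vs))) (h (drop p (us @ x # vs)))"
    if len: "length us + Suc (length vs) = p + q" for us x y vs c
  proof (cases "length us < p")
    case True
    \<comment> \<open>The number of entries of the first block that follow the varying one.\<close>
    define k where "k = p - Suc (length us)"
    have p: "p = length us + Suc k" using True by (simp add: k_def)
    have "length (drop k vs) = q" "length (us @ z # take k vs) = p" for z
      using len p by auto
    then have lin: "clinear_on P (\<lambda>s. \<beta> s (h (drop k vs)))" and mem: "g (us @ z # take k vs) \<in> P"
      for z
      using l h(2) g(2) by blast+
    have "take p (us @ z # vs) = us @ z # take k vs" "drop p (us @ z # vs) = drop k vs" for z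
      by (simp_all add: p)
    moreover have "length us + Suc (length (take k vs)) = p" using len p by auto
    ultimately show ?thesis
      by (simp add: mlinD[OF g(1)] clinear_on_add[OF lin mem mem] clinear_on_scaleC[OF lin mem])
  next
    case False
    have u: "length (take p us) = p" "length (drop p us @ z # vs) = q" for z
      using len False by auto
    then have lin: "clinear_on Q (\<beta> (g (take p us)))" and mem: "h (drop p us @ z # vs) \<in> Q" for z
      using r h(2) g(2) by blast+
    have "take p (us @ z # vs) = take p us" "drop p (us @ z # vs) = drop p us @ z # vs" for z
      using False by simp_all
    moreover have "length (drop p us) + Suc (length vs) = q" using len False by auto
    ultimately show ?thesis
      by (simp add: mlinD[OF h(1)] clinear_on_add[OF lin mem mem] clinear_on_scaleC[OF lin mem])
  qed
  then show ?thesis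
    by (intro mlinI) blast+
qed

section \<open>Concatenation of tensors\<close>

abbreviation tens_append_infix (infixr "\<odot>" 75) where "s \<odot> t \<equiv> tens_append s t"

lemma clinear_addD: "clinear f \<Longrightarrow> f (x + y) = f x + f y"
  and clinear_scaleD: "clinear f \<Longrightarrow> f (c *\<^sub>C x) = c *\<^sub>C f x"
  by (simp_all add: Vector_Spaces.linear_iff)

lemmas clinearD = clinear_addD clinear_scaleD

lemma clinear_0D: "clinear f \<Longrightarrow> f 0 = 0"
  using clinear_scaleD[of f 0 0] by simp

lemma clinear_sum: "clinear f \<Longrightarrow> f (\<Sum>i\<in>I. g i) = (\<Sum>i\<in>I. f (g i))"
  by (induction I rule: infinite_finite_induct) (simp_all add: clinear_0D clinear_addD)

lemma clinearI:
  "(\<And>x y. f (x + y) = f x + f y) \<Longrightarrow> (\<And>c x. f (c *\<^sub>C x) = c *\<^sub>C f x) \<Longrightarrow> clinear f"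
  by (simp add: Vector_Spaces.linear_iff complex_vector.vector_space_axioms)

lemma clinear_tens_eqI:
  assumes "clinear f" "clinear g" "\<And>xs. f (tensor xs) = g (tensor xs)"
  shows "f t = g t"
  by (induction t rule: tens_induct) (simp_all add: clinear_0D clinear_addD clinear_scaleD assms)

lemma multilinear_append_right: "multilinear (\<lambda>ys. tensor (xs @ ys))"
  unfolding multilinear_def append_assoc[symmetric] by
    (simp only: tensor_add tensor_scaleC simp_thms)

text \<open>For fixed entries both sides of each law are linear in t, so it is enough to compare
  them on elementary tensors, where it is multilinearity of \<open>tensor\<close>.\<close>

lemma multilinear_append_left: "multilinear (\<lambda>xs. tens_lift (\<lambda>ys. tensor (xs @ ys)) t)"
proof -
  define I where "I xs t = tens_lift (\<lambda>ys. tensor (xs @ ys)) t" for xs and t :: "'a tens"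
  have c: "clinear (I xs)" for xs
    unfolding I_def[abs_def] by (rule clinear_tens_lift[OF multilinear_append_right])
  have v: "I xs (tensor ys) = tensor (xs @ ys)" for xs ys
    unfolding I_def by (rule tens_lift_tensor[OF multilinear_append_right])
  note cl = clinearD[OF c]
  have "I (us @ (x + y) # vs) t = I (us @ x # vs) t + I (us @ y # vs) t" for us x y vs
    by (rule clinear_tens_eqI[OF c clinearI]) (simp_all add: v tensor_add cl scaleC_add_right
      add_ac)
  moreover have "I (us @ (k *\<^sub>C x) # vs) t = k *\<^sub>C I (us @ x # vs) t" for us x k vs
    by (rule clinear_tens_eqI[OF c clinearI]) (simp_all add: v tensor_scaleC cl scaleC_add_right
      mult_ac)
  ultimately show ?thesis
    unfolding multilinear_def I_def by blast
qed

lemma append_tensor [simp]: "tensor xs \<odot> tensor ys = tensor (xs @ ys)"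
  unfolding tens_append_def tens_lift_tensor[OF multilinear_append_left]
    by (rule tens_lift_tensor[OF multilinear_append_right])

lemma clinear_append_left: "clinear (\<lambda>s. s \<odot> t)"
  unfolding tens_append_def by (rule clinear_tens_lift[OF multilinear_append_left])

lemma clinear_append_right: "clinear (\<lambda>t. s \<odot> t)"
proof (rule clinearI)
  note c = clinear_tens_lift[OF multilinear_append_right]
  show "s \<odot> (x + y) = s \<odot> x + s \<odot> y" for x y
    by (simp add: tens_append_def tens_lift_def[of _ s] formal_sum_def clinear_addD[OF c]
      scaleC_add_right sum.distrib)
  show "s \<odot> (k *\<^sub>C x) = k *\<^sub>C (s \<odot> x)" for k x
    by (simp add: tens_append_def tens_lift_def[of _ s] formal_sum_def clinear_scaleD[OF c]
       complex_vector.scale_sum_right mult.commute)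
qed

lemma append_add_left: "(s + s') \<odot> t = s \<odot> t + s' \<odot> t"
  and append_scaleC_left: "(c *\<^sub>C s) \<odot> t = c *\<^sub>C (s \<odot> t)"
  and append_0_left [simp]: "0 \<odot> t = 0"
  using clinear_append_left by (rule clinear_addD clinear_scaleD clinear_0D)+

lemma append_add_right: "s \<odot> (t + t') = s \<odot> t + s \<odot> t'"
  and append_scaleC_right: "s \<odot> (c *\<^sub>C t) = c *\<^sub>C (s \<odot> t)"
  and append_0_right [simp]: "s \<odot> 0 = 0"
  using clinear_append_right by (rule clinear_addD clinear_scaleD clinear_0D)+

lemmas append_linear = append_add_left append_scaleC_left append_add_right append_scaleC_right

lemma append_in_tpow: "s \<in> tpow p \<Longrightarrow> t \<in> tpow q \<Longrightarrow> s \<odot> t \<in> tpow (p + q)"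
  by (rule tpow_memI[where t = s], assumption, rule
    clinear_imp_clinear_on[OF clinear_append_left], rule csubspace_tpow,
      rule tpow_memI[where t = t], assumption, rule
        clinear_imp_clinear_on[OF clinear_append_right], rule csubspace_tpow)
     (simp add: tensor_in_tpow)

lemma tensor_mult_neq: "length xs \<noteq> length ys \<Longrightarrow> tensor xs * tensor ys = 0"
  and tensor_mult_eq: "length xs = length ys \<Longrightarrow> tensor xs * tensor ys = tensor (map2 (*) xs ys)"
  by (simp_all add: tensor_times_tensor tensor_mult_def)

lemma times_in_tpow:
  assumes "s \<in> tpow n" "t \<in> tpow n"
  shows "s * t \<in> tpow n"
proof (rule tpow_memI[OF assms(1) clinear_on_mult_left csubspace_tpow])
  show "tensor xs * t \<in> tpow n" if "length xs = n" for xs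
    by (rule tpow_memI[OF assms(2) clinear_on_mult_right csubspace_tpow])
      (simp add: that tensor_mult_eq tensor_in_tpow)
qed

text \<open>The left factors must come from the same power: tensors of lengths 1, 2 and 2, 1
  concatenate to equal lengths, so their product need not vanish although \<open>s * s'\<close>
  does. Given this, right factors of different lengths make both sides 0. The identity then extends
  linearly in \<open>t'\<close>, \<open>t\<close>, \<open>s\<close>, \<open>s'\<close> in
  turn.\<close>

lemma append_times:
  assumes "s \<in> tpow p" "s' \<in> tpow p"
  shows "(s \<odot> t) * (s' \<odot> t') = (s * s') \<odot> (t * t')"
proof -
  note L = append_linear distrib_left distrib_right mult_scaleC_left mult_scaleC_right
  have 0: "(tensor xs \<odot> tensor ys) * (tensor xs' \<odot> tensor ys') =
    (tensor xs * tensor xs') \<odot> (tensor ys * tensor ys')"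
    if "length xs = length xs'" for xs ys xs' ys' :: "'a list"
    by (cases "length ys = length ys'") (use that in \<open>simp_all add: tensor_mult_eq tensor_mult_neq\<close>)
  have 1: "(tensor xs \<odot> tensor ys) * (tensor xs' \<odot> t') =
    (tensor xs * tensor xs') \<odot> (tensor ys * t')"
    if "length xs = length xs'" for xs ys xs'
    by (rule clinear_tens_eqI[where t = t']) (rule clinearI 0[OF that] | simp only: L)+
  have 2: "(tensor xs \<odot> t) * (tensor xs' \<odot> t') = (tensor xs * tensor xs') \<odot> (t * t')"
    if "length xs = length xs'" for xs xs'
    by (rule clinear_tens_eqI[where t = t]) (rule clinearI 1[OF that] | simp only: L)+
  have 3: "(s \<odot> t) * (tensor xs' \<odot> t') = (s * tensor xs') \<odot> (t * t')"
    if "length xs' = p" for xs'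
    by (rule tpow_eqI[OF assms(1)]) (auto intro!: clinear_onI 2 simp: L that)
  show ?thesis
    by (rule tpow_eqI[OF assms(2)]) (auto intro!: clinear_onI 3 simp: L)
qed

lemma append_cspan:
  assumes "s \<in> cspan G" "t \<in> cspan G'"
  shows "s \<odot> t \<in> cspan {g \<odot> g' |g g'. g \<in> G \<and> g' \<in> G'}"
proof (rule clinear_on_span_mem[OF clinear_imp_clinear_on[OF clinear_append_left] csubspace_UNIV
  subset_UNIV assms(1) csubspace_cspan])
  fix x assume x: "x \<in> G"
  show "x \<odot> t \<in> cspan {g \<odot> g' |g g'. g \<in> G \<and> g' \<in> G'}"
    by (rule clinear_on_span_mem[OF clinear_imp_clinear_on[OF clinear_append_right] csubspace_UNIV
      subset_UNIV assms(2) csubspace_cspan])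
      (use x in \<open>auto intro: cspan_base\<close>)
qed

lemma tpow_split: "tpow (p + q) \<subseteq> cspan {s \<odot> t |s t. s \<in> tpow p \<and> t \<in> tpow q}"
  unfolding tpow_def[of "p + q"]
proof (rule cspan_mono, clarify)
  fix xs :: "'a list" assume "length xs = p + q"
  then show "\<exists>s t. tensor xs = s \<odot> t \<and> s \<in> tpow p \<and> t \<in> tpow q"
    by (intro exI[of _ "tensor (take p xs)"] exI[of _ "tensor (drop p xs)"])
      (auto intro: tensor_in_tpow)
qed

lemma tpow_split_subset: "{s \<odot> t |s t. s \<in> tpow p \<and> t \<in> tpow q} \<subseteq> tpow (p + q)"
  by (auto intro: append_in_tpow)

lemma tpow_append_span:
  assumes "tpow p \<subseteq> cspan G" "tpow q \<subseteq> cspan G'"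
  shows "tpow (p + q) \<subseteq> cspan {s \<odot> t |s t. s \<in> G \<and> t \<in> G'}"
proof -
  have "{s \<odot> t |s t. s \<in> tpow p \<and> t \<in> tpow q} \<subseteq> cspan {s \<odot> t |s t. s \<in> G \<and> t \<in> G'}"
    using append_cspan assms by blast
  then have "cspan {s \<odot> t |s t. s \<in> tpow p \<and> t \<in> tpow q} \<subseteq> cspan {s \<odot> t |s t. s \<in> G \<and> t \<in> G'}"
    by (rule cspan_minimal) (rule csubspace_cspan)
  with tpow_split show ?thesis by blast
qed

lemma tpow_append_eqI:
  assumes "t \<in> tpow (p + q)" "clinear_on (tpow (p + q)) f" "clinear_on (tpow (p + q)) g"
    and "\<And>s u. s \<in> tpow p \<Longrightarrow> u \<in> tpow q \<Longrightarrow> f (s \<odot> u) = g (s \<odot> u)"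
  shows "f t = g t"
  by (rule clinear_on_span_eq[OF assms(2,3) csubspace_tpow tpow_split_subset tpow_split])
    (use assms in auto)

lemma tpow_append_memI:
  assumes "t \<in> tpow (p + q)" "clinear_on (tpow (p + q)) f" "csubspace T"
    and "\<And>s u. s \<in> tpow p \<Longrightarrow> u \<in> tpow q \<Longrightarrow> f (s \<odot> u) \<in> T"
  shows "f t \<in> T"
  by (rule clinear_on_span_mem[OF assms(2) csubspace_tpow tpow_split_subset _ assms(3)])
    (use assms subsetD[OF tpow_split] in auto)

section \<open>Tensor powers of a non-degenerate algebra\<close>

text \<open>A non-zero v extends to a basis, and its coordinate functional takes the value 1 at
  v.\<close>

lemma functionals_separate:
  fixes v :: "'a::complex_vector"
  assumes "\<And>\<phi> :: 'a \<Rightarrow> complex. clinear \<phi> \<Longrightarrow> \<phi> v = 0"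
  shows "v = 0"
proof (rule ccontr)
  assume "v \<noteq> 0"
  then have i: "complex_vector.independent {v}" by simp
  define B where "B = complex_vector.extend_basis {v}"
  have B: "complex_vector.independent B" "cspan B = UNIV" "v \<in> B"
    using complex_vector.independent_extend_basis[OF i] cspan_extend_basis[OF i]
      complex_vector.extend_basis_superset[OF i] by (auto simp: B_def)
  have "clinear (\<lambda>x. complex_vector.representation B x v)"
    by (rule clinearI) (simp_all add: complex_vector.representation_add
      complex_vector.representation_scale B scaleC_complex_def)
  then have "complex_vector.representation B v v = 0" by (rule assms)
  then show False using B by (simp add: complex_vector.representation_basis)
qed

text \<open>The slice map \<phi> \<otimes> id, which contracts the first factor; a tensor without a
  first factor goes to 0.\<close>

definition slice :: "('a::complex_vector \<Rightarrow> complex) \<Rightarrow> 'a tens \<Rightarrow> 'a tens" where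
  "slice \<phi> = tens_lift (\<lambda>xs. case xs of [] \<Rightarrow> 0 | x # xs' \<Rightarrow> \<phi> x *\<^sub>C tensor xs')"

text \<open>The complementary contraction id \<otimes> \<psi>, which leaves only the first
  factor.\<close>

definition coslice :: "('a::complex_vector tens \<Rightarrow> complex) \<Rightarrow> 'a tens \<Rightarrow> 'a" where
  "coslice \<psi> = tens_lift (\<lambda>xs. case xs of [] \<Rightarrow> 0 | x # xs' \<Rightarrow> \<psi> (tensor xs') *\<^sub>C x)"

lemma multilinear_case_list:
  assumes "\<And>xs. clinear (\<lambda>x. g x xs)" "\<And>x. multilinear (g x)"
  shows "multilinear (\<lambda>xs. case xs of [] \<Rightarrow> 0 | x # xs' \<Rightarrow> g x xs')"
  unfolding multilinear_def
proof (intro conjI allI)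
  note m = assms(2)[unfolded multilinear_def, THEN conjunct1, rule_format]
    assms(2)[unfolded multilinear_def, THEN conjunct2, rule_format]
  fix us vs x y c
  show "(case us @ (x + y) # vs of [] \<Rightarrow> 0 | x # xs' \<Rightarrow> g x xs') =
      (case us @ x # vs of [] \<Rightarrow> 0 | x # xs' \<Rightarrow> g x xs') + (case us @ y # vs of [] \<Rightarrow> 0 | x # xs' \<Rightarrow> g
        x xs')"
    by (cases us) (simp_all add: m clinear_addD[OF assms(1)])
  show "(case us @ (c *\<^sub>C x) # vs of [] \<Rightarrow> 0 | x # xs' \<Rightarrow> g x xs') =
      c *\<^sub>C (case us @ x # vs of [] \<Rightarrow> 0 | x # xs' \<Rightarrow> g x xs')"
    by (cases us) (simp_all add: m clinear_scaleD[OF assms(1)])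
qed

lemma multilinear_slice:
  assumes \<phi>: "clinear \<phi>"
  shows "multilinear (\<lambda>xs. case xs of [] \<Rightarrow> 0 | x # xs' \<Rightarrow> \<phi> x *\<^sub>C tensor xs')"
  by (rule multilinear_case_list)
    (auto intro!: clinearI simp: multilinear_def clinearD[OF \<phi>] scaleC_add_left
      scaleC_add_right scaleC_scaleC scaleC_complex_def tensor_add tensor_scaleC mult.commute)

lemma multilinear_coslice:
  assumes \<psi>: "clinear \<psi>"
  shows "multilinear (\<lambda>xs. case xs of [] \<Rightarrow> 0 | x # xs' \<Rightarrow> \<psi> (tensor xs') *\<^sub>C x)"
  by (rule multilinear_case_list)
    (auto intro!: clinearI simp: multilinear_def clinearD[OF \<psi>] scaleC_add_left
      scaleC_add_right scaleC_scaleC scaleC_complex_def tensor_add tensor_scaleC mult.commute)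

lemma slice_tensor: "clinear \<phi> \<Longrightarrow> slice \<phi> (tensor xs) =
  (case xs of [] \<Rightarrow> 0 | x # xs' \<Rightarrow> \<phi> x *\<^sub>C tensor xs')"
  and coslice_tensor: "clinear \<psi> \<Longrightarrow> coslice \<psi> (tensor xs) =
    (case xs of [] \<Rightarrow> 0 | x # xs' \<Rightarrow> \<psi> (tensor xs') *\<^sub>C x)"
  by (simp_all add: slice_def coslice_def tens_lift_tensor multilinear_slice multilinear_coslice)

lemma clinear_slice: "clinear \<phi> \<Longrightarrow> clinear (slice \<phi>)"
  and clinear_coslice: "clinear \<psi> \<Longrightarrow> clinear (coslice \<psi>)"
  by (simp_all add: slice_def coslice_def clinear_tens_lift multilinear_slice multilinear_coslice)

lemma slice_in_tpow: "clinear \<phi> \<Longrightarrow> t \<in> tpow (Suc n) \<Longrightarrow> slice \<phi> t \<in> tpow n"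
  by (rule tpow_memI[OF _ clinear_imp_clinear_on[OF clinear_slice] csubspace_tpow])
    (auto simp: slice_tensor length_Suc_conv intro!: tpow_scaleC tensor_in_tpow)

lemma clinear_comp: "clinear f \<Longrightarrow> clinear g \<Longrightarrow> clinear (\<lambda>x. g (f x))"
  by (rule clinearI) (simp_all add: clinear_addD clinear_scaleD)

text \<open>Either order of contraction gives \<phi> \<otimes> \<psi>.\<close>

lemma slice_coslice:
  assumes \<phi>: "clinear \<phi>" and \<psi>: "clinear \<psi>"
  shows "\<psi> (slice \<phi> t) = \<phi> (coslice \<psi> t)"
proof (rule clinear_tens_eqI[OF clinear_comp[OF clinear_slice[OF \<phi>] \<psi>] clinear_comp[OF
  clinear_coslice[OF \<psi>] \<phi>]])
  show "\<psi> (slice \<phi> (tensor xs)) = \<phi> (coslice \<psi> (tensor xs))" for xs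
    unfolding slice_tensor[OF \<phi>] coslice_tensor[OF \<psi>]
    by (cases xs) (simp_all add: clinear_0D[OF \<phi>] clinear_0D[OF \<psi>] clinear_scaleD[OF \<phi>]
      clinear_scaleD[OF \<psi>] scaleC_complex_def)
qed

text \<open>With respect to a basis of the first factor, t is the sum of b \<otimes> t_b, where t_b
  is the slice of t by the coordinate functional of b. If all slices vanish, so does t.\<close>

lemma slices_separate:
  fixes t :: "'a::complex_vector tens"
  assumes t: "t \<in> tpow (Suc n)" and 0: "\<And>\<phi>. clinear \<phi> \<Longrightarrow> slice \<phi> t = 0"
  shows "t = 0"
proof -
  define B :: "'a set" where "B = complex_vector.extend_basis {}"
  have B: "complex_vector.independent B" "cspan B = UNIV"
    using complex_vector.independent_extend_basis[OF complex_vector.independent_empty]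
      cspan_extend_basis[OF complex_vector.independent_empty] by (auto simp: B_def)
  define r where "r b x = complex_vector.representation B x b" for b x
  have r: "clinear (r b)" for b
    unfolding r_def
    by (rule clinearI) (simp_all add: complex_vector.representation_add
      complex_vector.representation_scale B scaleC_complex_def)
  have fin: "finite {b. r b x \<noteq> 0}" for x
    unfolding r_def by (rule complex_vector.finite_representation)
  have rx: "(\<Sum>b\<in>F. r b x *\<^sub>C b) = x" if "finite F" "{b. r b x \<noteq> 0} \<subseteq> F" for F x
  proof -
    have "(\<Sum>b\<in>F. r b x *\<^sub>C b) = (\<Sum>b | r b x \<noteq> 0. r b x *\<^sub>C b)"
      by (rule sum.mono_neutral_right) (use that in auto)
    also have "\<dots> = x"
      unfolding r_def by (rule complex_vector.sum_nonzero_representation_eq) (use B in auto)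
    finally show ?thesis .
  qed
  have single: "clinear (\<lambda>x. tensor [x :: 'a])"
    by (rule clinearI) (use tensor_add[of "[]" _ _ "[]"] tensor_scaleC[of "[]" _ _ "[]"] in
      simp_all)
  \<comment> \<open>The expansion is demanded for all finite sets beyond some \<open>F\<close>, not
    for one set: then two tensors can be added over the union of their sets.\<close>
  define P where "P u \<longleftrightarrow> (\<exists>F. finite F \<and> (\<forall>F'. finite F' \<longrightarrow> F \<subseteq> F' \<longrightarrow> (\<Sum>b\<in>F'. tensor [b] \<odot> slice
    (r b) u) = u))" for u
  have tens: "P (tensor xs)" if xs: "length xs = Suc n" for xs
  proof -
    obtain x xs' where xs: "xs = x # xs'" using xs by (cases xs) auto
    have "(\<Sum>b\<in>F'. tensor [b] \<odot> slice (r b) (tensor xs)) = tensor xs"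
      if "finite F'" "{b. r b x \<noteq> 0} \<subseteq> F'" for F'
    proof -
      have lin: "clinear (\<lambda>x. tensor [x] \<odot> tensor xs')"
        by (rule clinear_comp[OF single clinear_append_left])
      have "(\<Sum>b\<in>F'. tensor [b] \<odot> slice (r b) (tensor xs)) =
        (\<Sum>b\<in>F'. tensor [r b x *\<^sub>C b] \<odot> tensor xs')"
        by (simp add: xs slice_tensor r append_linear clinear_scaleD[OF single] del: append_tensor)
      also have "\<dots> = tensor [\<Sum>b\<in>F'. r b x *\<^sub>C b] \<odot> tensor xs'"
        using clinear_sum[OF lin, of "\<lambda>b. r b x *\<^sub>C b" F'] by simp
      finally show ?thesis by (simp add: rx that xs)
    qed
    then show ?thesis unfolding P_def using fin by blast
  qed
  have "P t"
  proof (rule tpow_memI[OF t, of "\<lambda>x. x" "Collect P", simplified])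
    show "clinear_on (tpow (Suc n)) (\<lambda>x. x :: 'a tens)" by (simp add: clinear_on_def)
    show "csubspace (Collect P)"
    proof (rule csubspaceI; simp)
      show "P 0" unfolding P_def by (rule exI[of _ "{}"])
        (simp add: clinear_0D[OF clinear_slice[OF r]])
      show "P (x + y)" if xy: "P x" "P y" for x y
      proof -
        obtain F G where "finite F" "\<And>F'. finite F' \<Longrightarrow> F \<subseteq> F' \<Longrightarrow>
          (\<Sum>b\<in>F'. tensor [b] \<odot> slice (r b) x) = x"
          "finite G" "\<And>F'. finite F' \<Longrightarrow> G \<subseteq> F' \<Longrightarrow> (\<Sum>b\<in>F'. tensor [b] \<odot> slice (r b) y) = y"
          using xy unfolding P_def by blast
        then show ?thesis unfolding P_def
          by (intro exI[of _ "F \<union> G"]) (simp add: clinear_addD[OF clinear_slice[OF r]]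
            append_linear sum.distrib)
      qed
      show "P (c *\<^sub>C x)" if x: "P x" for c x
      proof -
        obtain F where "finite F" "\<And>F'. finite F' \<Longrightarrow> F \<subseteq> F' \<Longrightarrow> (\<Sum>b\<in>F'. tensor [b] \<odot> slice (r b) x) =
          x"
          using x unfolding P_def by blast
        then show ?thesis unfolding P_def
          by (intro exI[of _ F]) (simp add: clinear_scaleD[OF clinear_slice[OF r]] append_linear
            flip: complex_vector.scale_sum_right)
      qed
    qed
  qed (rule tens)
  then show ?thesis unfolding P_def using 0[OF r] by auto
qed

lemma smul_linear:
  fixes x y z :: "'a::complex_algebra"
  shows "smul s (x + y) z = smul s x z + smul s y z" "smul s z (x + y) = smul s z x + smul s z y"
    "smul s (c *\<^sub>C x) z = c *\<^sub>C smul s x z" "smul s z (c *\<^sub>C x) = c *\<^sub>C smul s z x"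
  by (simp_all add: smul_def distrib_left distrib_right mult_scaleC_left mult_scaleC_right)

text \<open>Multiplication by a \<otimes> v acts separately on the first factor and on the rest: a
  can be pulled out of the contraction, and v is absorbed into the functional.\<close>

lemma coslice_smul:
  fixes a :: "'a::complex_algebra"
  assumes \<psi>: "clinear \<psi>"
  shows "coslice \<psi> (smul s t (tensor [a] \<odot> v)) = smul s (coslice (\<lambda>u. \<psi> (smul s u v)) t) a"
proof -
  have 1: "clinear (\<lambda>u. \<psi> (smul s u v))"
    by (rule clinearI) (simp_all add: smul_linear clinearD[OF \<psi>])
  note l = smul_linear append_linear clinearD[OF clinear_coslice[OF \<psi>]]
    clinearD[OF clinear_coslice[OF 1]]
  have tens: "coslice \<psi> (smul s (tensor xs) (tensor [a] \<odot> v)) =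
    smul s (coslice (\<lambda>u. \<psi> (smul s u v)) (tensor xs)) a" for xs
  proof (cases xs)
    case Nil
    \<comment> \<open>Every tensor that begins with a has positive length, and different lengths
      annihilate each other.\<close>
    have "smul s (tensor []) (tensor [a] \<odot> v) = 0"
      by (rule clinear_tens_eqI[where t = v])
        (auto intro!: clinearI simp: append_linear smul_linear, simp add: smul_def tensor_mult_neq)
    then show ?thesis
      by (simp add: Nil coslice_tensor[OF 1] clinear_0D[OF clinear_coslice[OF \<psi>]])
        (simp add: smul_def)
  next
    case (Cons x xs')
    have *: "smul s (tensor xs) (tensor [a] \<odot> v) = tensor [smul s x a] \<odot> smul s (tensor xs') v"
      using append_times[of "tensor [x]" 1 "tensor [a]" "tensor xs'" v]
        append_times[of "tensor [a]" 1 "tensor [x]" v "tensor xs'"]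
      by (simp add: Cons tensor_in_tpow tensor_mult_eq smul_def)
    have "coslice \<psi> (tensor [y] \<odot> w) = \<psi> w *\<^sub>C y" for y w
      by (rule clinear_tens_eqI[where t = w])
        (auto intro!: clinearI simp: l coslice_tensor[OF \<psi>] clinearD[OF \<psi>]
          scaleC_add_left scaleC_scaleC scaleC_complex_def)
    then show ?thesis unfolding * unfolding Cons by (simp add: coslice_tensor[OF 1] smul_linear)
  qed
  show ?thesis
    by (rule clinear_tens_eqI[where t = t]) (auto intro!: clinearI simp: tens l)
qed

lemma tpow_0_cases:
  assumes "t \<in> tpow 0"
  obtains c where "t = c *\<^sub>C tensor []"
proof -
  have "csubspace (range (\<lambda>c. c *\<^sub>C tensor []) :: 'a tens set)"
    by (rule csubspaceI) (auto simp: scaleC_scaleC simp flip: scaleC_add_left intro: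
      rev_image_eqI[of 0])
  moreover have "tensor [] \<in> range (\<lambda>c. c *\<^sub>C tensor [])"
    using scaleC_one[of "tensor []"] by (metis rangeI)
  ultimately have "t \<in> range (\<lambda>c. c *\<^sub>C tensor [])"
    by (intro tpow_memI[OF assms, of "\<lambda>x. x"]) (auto simp: clinear_on_def)
  then show ?thesis using that by auto
qed

context
  assumes nd: "nd_algebra (UNIV :: 'a::complex_algebra set)"
begin

text \<open>Induction on n by contracting t with a functional \<phi> in the first factor. To see
  that this slice kills every v, test with \<psi>: the result is \<phi> of the element (id \<otimes>
  \<psi>(- v))(t) of H. Multiplied by any a, this element becomes (id \<otimes> \<psi>)(t (a
  \<otimes> v)) = 0, so it is 0 because H is non-degenerate. The same holds with the sides
  exchanged.\<close>

lemma tpow_cancel: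
  fixes t :: "'a tens"
  assumes "t \<in> tpow n" "\<And>u. u \<in> tpow n \<Longrightarrow> smul s t u = 0"
  shows "t = 0"
  using assms
proof (induction n arbitrary: t)
  case 0
  then obtain c where c: "t = c *\<^sub>C tensor []" by (rule_tac tpow_0_cases)
  have "smul s t (tensor []) = 0" using 0 by (simp add: tensor_in_tpow)
  then show ?case by (simp add: c smul_linear) (simp add: smul_def tensor_mult_eq)
next
  case (Suc n)
  show ?case
  proof (rule slices_separate[OF Suc.prems(1)])
    fix \<phi> :: "'a \<Rightarrow> complex" assume \<phi>: "clinear \<phi>"
    show "slice \<phi> t = 0"
    proof (rule Suc.IH)
      show "slice \<phi> t \<in> tpow n" using \<phi> Suc.prems(1) by (rule slice_in_tpow)
      fix v :: "'a tens" assume v: "v \<in> tpow n"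
      show "smul s (slice \<phi> t) v = 0"
      proof (rule functionals_separate)
        fix \<psi> :: "'a tens \<Rightarrow> complex" assume \<psi>: "clinear \<psi>"
        have l: "clinear (\<lambda>u. \<psi> (smul s u v))"
          by (rule clinearI) (simp_all add: smul_linear clinearD[OF \<psi>])
        have "smul s (coslice (\<lambda>u. \<psi> (smul s u v)) t) a = 0" for a
          using Suc.prems(2)[of "tensor [a] \<odot> v"] append_in_tpow[OF tensor_in_tpow v, of "[a]" 1]
          by (simp add: clinear_0D[OF clinear_coslice[OF \<psi>]] flip: coslice_smul[OF \<psi>])
        then have "coslice (\<lambda>u. \<psi> (smul s u v)) t = 0"
          using nd_algebraD(3,4)[OF nd UNIV_I] unfolding smul_def by metis
        then show "\<psi> (smul s (slice \<phi> t) v) = 0"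
          using slice_coslice[OF \<phi> l, of t] by (simp add: clinear_0D[OF \<phi>])
      qed
    qed
  qed
qed

lemma nd_algebra_tpow: "nd_algebra (tpow n :: 'a tens set)"
  unfolding nd_algebra_def nondegenerate_def
  using csubspace_tpow times_in_tpow tpow_cancel[of _ n True, unfolded smul_def if_True]
    tpow_cancel[of _ n False, unfolded smul_def if_False]
  by blast

end

section \<open>Tensor products of multipliers\<close>

lemma multiplier_cases_eq: "lmul m = lmul m' \<Longrightarrow> rmul m = rmul m' \<Longrightarrow> m = m'"
  by (rule multiplier.expand) simp

lemma mlin_tensor_pair:
  assumes "clinear_on (tpow p) f" "\<And>x. x \<in> tpow p \<Longrightarrow> f x \<in> tpow p"
    and "clinear_on (tpow q) g" "\<And>x. x \<in> tpow q \<Longrightarrow> g x \<in> tpow q"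
  shows "mlin (p + q) (\<lambda>xs. f (tensor (take p xs)) \<odot> g (tensor (drop p xs)))"
  by (rule mlin_split[OF mlin_clinear_tensor[OF assms(1)] _ mlin_clinear_tensor[OF assms(3)],
        where \<beta> = tens_append and P = "tpow p" and Q = "tpow q"])
     (simp_all add: assms tensor_in_tpow clinear_imp_clinear_on clinear_append_left
       clinear_append_right)

lemma lift_pair:
  assumes f: "clinear_on (tpow p) f" "\<And>x. x \<in> tpow p \<Longrightarrow> f x \<in> tpow p"
    and g: "clinear_on (tpow q) g" "\<And>x. x \<in> tpow q \<Longrightarrow> g x \<in> tpow q"
    and s: "s \<in> tpow p" and t: "t \<in> tpow q"
  shows "lift (p + q) (\<lambda>xs. f (tensor (take p xs)) \<odot> g (tensor (drop p xs))) (s \<odot> t) = f s \<odot> g t"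
    (is "?L (s \<odot> t) = _")
proof -
  note m = mlin_tensor_pair[OF f g]
  note L = clinear_on_lift_mlin[OF m]
  have 1: "?L (tensor xs \<odot> tensor ys) = f (tensor xs) \<odot> g (tensor ys)" if "length xs = p"
    "length ys = q" for xs ys
    using that by (simp add: lift_tensor_mlin[OF m])
  have 2: "?L (tensor xs \<odot> t) = f (tensor xs) \<odot> g t" if "length xs = p" for xs
    by (rule tpow_eqI[OF t]; (rule 1[OF that])?)
      (auto intro!: clinear_onI
        simp: append_in_tpow tensor_in_tpow that append_linear clinear_onD[OF L]
          clinear_onD[OF g(1)])
  show ?thesis
    by (rule tpow_eqI[OF s]; (rule 2)?)
      (auto intro!: clinear_onI
        simp: append_in_tpow t append_linear clinear_onD[OF L] clinear_onD[OF f(1)])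
qed

lemma mlin_mtens:
  assumes "m \<in> mpow p" "m' \<in> mpow q"
  shows "mlin (p + q) (\<lambda>xs. lmul m (tensor (take p xs)) \<odot> lmul m' (tensor (drop p xs)))"
    "mlin (p + q) (\<lambda>xs. rmul m (tensor (take p xs)) \<odot> rmul m' (tensor (drop p xs)))"
  by (rule mlin_tensor_pair; use assms in \<open>simp add: multipliersD\<close>)+

lemma lmul_mtens:
  assumes "m \<in> mpow p" "m' \<in> mpow q" "s \<in> tpow p" "t \<in> tpow q"
  shows "lmul (mtens p q m m') (s \<odot> t) = lmul m s \<odot> lmul m' t"
  unfolding mtens_def multiplier.sel by (rule lift_pair) (use assms in \<open>simp_all add: multipliersD\<close>)

lemma rmul_mtens:
  assumes "m \<in> mpow p" "m' \<in> mpow q" "s \<in> tpow p" "t \<in> tpow q"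
  shows "rmul (mtens p q m m') (s \<odot> t) = rmul m s \<odot> rmul m' t"
  unfolding mtens_def multiplier.sel by (rule lift_pair) (use assms in \<open>simp_all add: multipliersD\<close>)

text \<open>Stated for arbitrary linear maps in order to serve both components, \<open>lmul\<close>
  and \<open>rmul\<close>, of a list of multipliers.\<close>

lemma mlin_map2:
  assumes "\<And>f. f \<in> set fs \<Longrightarrow> clinear f"
  shows "mlin (length fs) (\<lambda>xs. tensor (map2 (\<lambda>f x. f x) fs xs))"
  using assms
proof (induction fs)
  case Nil
  show ?case by (rule mlinI) simp_all
next
  case (Cons f fs)
  have f: "clinear f" using Cons.prems by simp
  have "mlin (Suc 0 + length fs) (\<lambda>xs. (\<lambda>ys. tensor [f (ys ! 0)]) (take (Suc 0) xs) \<odot> tensor (map2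
    (\<lambda>f x. f x) fs (drop (Suc 0) xs)))"
  proof (rule mlin_split[where P = UNIV and Q = UNIV])
    show "mlin (Suc 0) (\<lambda>ys. tensor [f (ys ! 0)])"
      by (rule mlinI) (use tensor_add[of "[]" _ _ "[]"] tensor_scaleC[of "[]" _ _ "[]"] in
        \<open>simp_all add: clinearD[OF f]\<close>)
    show "mlin (length fs) (\<lambda>xs. tensor (map2 (\<lambda>f x. f x) fs xs))"
      by (rule Cons.IH) (use Cons.prems in simp)
  qed (simp_all add: clinear_imp_clinear_on clinear_append_left clinear_append_right)
  from mlin_cong[OF this, of "\<lambda>xs. tensor (map2 (\<lambda>f x. f x) (f # fs) xs)"] show ?case
    by (fastforce simp: length_Suc_conv)
qed

locale nondegenerate_alg =
  fixes algebra_type :: "'a::complex_algebra itself"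
  assumes nd: "nd_algebra (UNIV :: 'a set)"
begin

lemmas nd_tpow = nd_algebra_tpow[OF nd]
lemmas csubspace_mpow = csubspace_multipliers[OF nd_tpow]

abbreviation MH :: "'a multiplier set" where "MH \<equiv> multipliers UNIV"

lemma MH_clinear:
  assumes "m \<in> MH"
  shows "clinear (lmul m)" "clinear (rmul m)"
  using multipliersD(3,4)[OF assms] by (auto simp: clinear_on_def intro!: clinearI)

lemma lmul_mtensor:
  assumes "set ms \<subseteq> MH" "length xs = length ms"
  shows "lmul (mtensor ms) (tensor xs) = tensor (map2 lmul ms xs)"
proof -
  have "mlin (length ms) (\<lambda>xs. tensor (map2 lmul ms xs))"
    using mlin_map2[of "map lmul ms"] MH_clinear assms
      by (fastforce simp: zip_map1 comp_def case_prod_beta')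
  then show ?thesis using assms by (simp add: mtensor_def lift_tensor_mlin)
qed

lemma rmul_mtensor:
  assumes "set ms \<subseteq> MH" "length xs = length ms"
  shows "rmul (mtensor ms) (tensor xs) = tensor (map2 rmul ms xs)"
proof -
  have "mlin (length ms) (\<lambda>xs. tensor (map2 rmul ms xs))"
    using mlin_map2[of "map rmul ms"] MH_clinear assms
      by (fastforce simp: zip_map1 comp_def case_prod_beta')
  then show ?thesis using assms by (simp add: mtensor_def lift_tensor_mlin)
qed

text \<open>The compatibility of the two maps holds entry by entry on elementary tensors and extends
  linearly in both arguments.\<close>

lemma mtensor_in_mpow:
  assumes ms: "set ms \<subseteq> MH" and n: "length ms = n"
  shows "mtensor ms \<in> mpow n"
proof (rule multipliersI[OF nd_tpow])
  have m: "mlin (length ms) (\<lambda>xs. tensor (map2 lmul ms xs))"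
    "mlin (length ms) (\<lambda>xs. tensor (map2 rmul ms xs))"
    using mlin_map2[of "map lmul ms"] mlin_map2[of "map rmul ms"] MH_clinear assms
    by (fastforce simp: zip_map1 comp_def case_prod_beta')+
  show in_t: "lmul (mtensor ms) \<in> tpow n \<rightarrow> tpow n" "rmul (mtensor ms) \<in> tpow n \<rightarrow> tpow n"
    using n by (auto simp: mtensor_def intro!: lift_mem m csubspace_tpow tensor_in_tpow)
  have cl: "clinear_on (tpow n) (lmul (mtensor ms))" "clinear_on (tpow n) (rmul (mtensor ms))"
    using n by (auto simp: mtensor_def intro!: clinear_on_lift_mlin m)
  show "lmul (mtensor ms) x = 0" "rmul (mtensor ms) x = 0" if "x \<notin> tpow n" for x
    using that n by (simp_all add: mtensor_def lift_def)
  have 0: "tensor xs * lmul (mtensor ms) (tensor ys) = rmul (mtensor ms) (tensor xs) * tensor ys"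
    if "length xs = n" "length ys = n" for xs ys
  proof -
    have "map2 (*) xs (map2 lmul ms ys) = map2 (*) (map2 rmul ms xs) ys"
      by (rule nth_equalityI) (use that n ms in \<open>auto simp: multipliersD(9)[of _ UNIV] subset_iff\<close>)
    then show ?thesis
      using that n ms by (simp add: lmul_mtensor rmul_mtensor tensor_mult_eq)
  qed
  have 1: "tensor xs * lmul (mtensor ms) b = rmul (mtensor ms) (tensor xs) * b"
    if "length xs = n" "b \<in> tpow n" for xs b
    by (rule tpow_eqI[OF that(2)])
      (auto intro!: clinear_onI 0 that simp: distrib_left mult_scaleC_right clinear_onD[OF cl(1)])
  show "a * lmul (mtensor ms) b = rmul (mtensor ms) a * b" if "a \<in> tpow n" "b \<in> tpow n" for a b
    by (rule tpow_eqI[OF that(1)])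
      (auto intro!: clinear_onI 1 that simp: distrib_right mult_scaleC_left clinear_onD[OF cl(2)])
qed

lemma mtens_in_mpow:
  assumes m: "m \<in> mpow p" "m' \<in> (mpow q :: 'a tens multiplier set)"
  shows "mtens p q m m' \<in> mpow (p + q)"
proof (rule multipliersI[OF nd_tpow])
  note md = mlin_mtens[OF m]
  show in_t: "lmul (mtens p q m m') \<in> tpow (p + q) \<rightarrow> tpow (p + q)"
    "rmul (mtens p q m m') \<in> tpow (p + q) \<rightarrow> tpow (p + q)"
    using m by (auto simp: mtens_def intro!: lift_mem md csubspace_tpow append_in_tpow
      tensor_in_tpow multipliersD(1,2))
  have cl: "clinear_on (tpow (p + q)) (lmul (mtens p q m m'))"
    "clinear_on (tpow (p + q)) (rmul (mtens p q m m'))"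
    by (auto simp: mtens_def intro!: clinear_on_lift_mlin md)
  show "lmul (mtens p q m m') x = 0" "rmul (mtens p q m m') x = 0" if "x \<notin> tpow (p + q)" for x
    using that by (simp_all add: mtens_def lift_def)
  have 0: "(s \<odot> t) * lmul (mtens p q m m') (s' \<odot> t') = rmul (mtens p q m m') (s \<odot> t) * (s' \<odot> t')"
    if st: "s \<in> tpow p" "t \<in> tpow q" "s' \<in> tpow p" "t' \<in> tpow q" for s t s' t'
    using m st multipliersD(1,2)[OF m(1)] by (simp add: lmul_mtens rmul_mtens append_times[of _ p]
      multipliersD(9))
  have 1: "(s \<odot> t) * lmul (mtens p q m m') b = rmul (mtens p q m m') (s \<odot> t) * b"
    if "s \<in> tpow p" "t \<in> tpow q" "b \<in> tpow (p + q)" for s t b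
    by (rule tpow_append_eqI[OF that(3)])
      (auto intro!: clinear_onI 0 that simp: distrib_left mult_scaleC_right clinear_onD[OF cl(1)])
  show "a * lmul (mtens p q m m') b = rmul (mtens p q m m') a * b" if "a \<in> tpow (p + q)"
    "b \<in> tpow (p + q)" for a b
    by (rule tpow_append_eqI[OF that(1)])
      (auto intro!: clinear_onI 1 that simp: distrib_right mult_scaleC_left clinear_onD[OF cl(2)])
qed

lemma mpow_append_eqI:
  assumes "z \<in> mpow (p + q)" "z' \<in> (mpow (p + q) :: 'a tens multiplier set)"
    and "\<And>s t. s \<in> tpow p \<Longrightarrow> t \<in> tpow q \<Longrightarrow> lmul z (s \<odot> t) = lmul z' (s \<odot> t)"
  shows "z = z'"
  by (rule multiplier_eqI[OF nd_tpow assms(1,2) tpow_split tpow_split_subset])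
    (use assms(3) in auto)

lemma mpow_eqI:
  assumes "z \<in> mpow n" "z' \<in> (mpow n :: 'a tens multiplier set)"
    and "\<And>xs. length xs = n \<Longrightarrow> lmul z (tensor xs) = lmul z' (tensor xs)"
  shows "z = z'"
  by (rule multiplier_eqI[OF nd_tpow assms(1,2), of "{tensor xs |xs. length xs = n}"])
    (use assms(3) in \<open>auto simp: tpow_def intro: cspan_base\<close>)

lemmas mpow_add = csubspace_add[OF csubspace_mpow]
  and mpow_scaleC = csubspace_scale[OF csubspace_mpow]
  and mpow_times = multipliers_times[OF nd_tpow]

lemma clinear_on_mtens_left:
  assumes "m' \<in> (mpow q :: 'a tens multiplier set)"
  shows "clinear_on (mpow p) (\<lambda>m. mtens p q m m')"
  by (rule clinear_onI; rule mpow_append_eqI)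
    (use assms in \<open>auto intro!: mtens_in_mpow mpow_add mpow_scaleC simp: lmul_mtens append_linear
      mpow_add mpow_scaleC\<close>)

lemma clinear_on_mtens_right:
  assumes "m \<in> (mpow p :: 'a tens multiplier set)"
  shows "clinear_on (mpow q) (mtens p q m)"
  by (rule clinear_onI; rule mpow_append_eqI)
    (use assms in \<open>auto intro!: mtens_in_mpow mpow_add mpow_scaleC simp: lmul_mtens append_linear
      mpow_add mpow_scaleC\<close>)

lemma mtens_times:
  assumes "a \<in> (mpow p :: 'a tens multiplier set)" "b \<in> mpow q" "c \<in> mpow p" "d \<in> mpow q"
  shows "mtens p q a b * mtens p q c d = mtens p q (a * c) (b * d)"
  by (rule mpow_append_eqI)
    (use assms in \<open>auto intro!: mtens_in_mpow mpow_times simp: lmul_mtens mpow_times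
      multipliersD(1)\<close>)

lemma smul_mtens:
  assumes "a \<in> (mpow p :: 'a tens multiplier set)" "b \<in> mpow q" "c \<in> mpow p" "d \<in> mpow q"
  shows "smul s (mtens p q a b) (mtens p q c d) = mtens p q (smul s a c) (smul s b d)"
  using assms by (simp add: smul_def mtens_times)

lemma mtensor_append:
  assumes "set ms \<subseteq> MH" "set ns \<subseteq> MH" "length ms = p" "length ns = q"
  shows "mtensor (ms @ ns) = mtens p q (mtensor ms) (mtensor ns)"
proof (rule mpow_eqI)
  show "mtensor (ms @ ns) \<in> mpow (p + q)"
    using assms by (auto intro!: mtensor_in_mpow)
  show "mtens p q (mtensor ms) (mtensor ns) \<in> mpow (p + q)"
    using assms by (auto intro!: mtensor_in_mpow mtens_in_mpow)
  fix xs :: "'a list" assume "length xs = p + q"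
  then obtain ys zs where xs: "xs = ys @ zs" "length ys = p" "length zs = q"
    by (metis append_take_drop_id length_take length_drop add_diff_cancel_left' le_add1 min.absorb2)
  have "lmul (mtens p q (mtensor ms) (mtensor ns)) (tensor ys \<odot> tensor zs) =
    lmul (mtensor (ms @ ns)) (tensor (ys @ zs))"
    using assms xs by (subst lmul_mtens) (auto intro!: mtensor_in_mpow tensor_in_tpow simp:
      lmul_mtensor)
  then show "lmul (mtensor (ms @ ns)) (tensor xs) =
    lmul (mtens p q (mtensor ms) (mtensor ns)) (tensor xs)"
    by (simp add: xs)
qed

lemma embH_in [simp]: "embH (x::'a) \<in> MH" and oneH_in [simp]: "oneH \<in> MH"
  by (simp_all add: emb_in_multipliers unit_in_multipliers nd)

lemma mtensor_embH: "mtensor (map embH xs) = emb_tens (length xs) (tensor (xs :: 'a list))"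
proof (rule mpow_eqI)
  show "mtensor (map embH xs) \<in> mpow (length xs)"
    by (rule mtensor_in_mpow) auto
  show "lmul (mtensor (map embH xs)) (tensor ys) =
    lmul (emb_tens (length xs) (tensor xs)) (tensor ys)"
    if "length ys = length xs" for ys
  proof -
    have "map2 lmul (map embH xs) ys = map2 (*) xs ys"
      by (rule nth_equalityI) (use that in \<open>auto simp: lmul_emb\<close>)
    then show ?thesis
      using that by (subst lmul_mtensor) (auto simp: lmul_emb tensor_in_tpow tensor_mult_eq)
  qed
qed (simp add: emb_in_multipliers nd_tpow tensor_in_tpow)

lemma mtensor_single:
  "clinear_on MH (\<lambda>m. mtensor [m])"
  "m \<in> MH \<Longrightarrow> m' \<in> MH \<Longrightarrow> mtensor [m] * mtensor [m'] = mtensor [m * m']"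
proof -
  have s: "tensor [x + y] = tensor [x] + tensor [y]" "tensor [c *\<^sub>C x] = c *\<^sub>C tensor [x]"
    for x y :: 'a and c
    using tensor_add[of "[]" x y "[]"] tensor_scaleC[of "[]" c x "[]"] by simp_all
  have *: "mtensor [m] \<in> mpow (Suc 0)" "lmul (mtensor [m]) (tensor [x]) = tensor [lmul m x]"
    if "m \<in> MH" for m x
    using that by (simp_all add: mtensor_in_mpow lmul_mtensor)
  have MH: "m + m' \<in> MH" "c *\<^sub>C m \<in> MH" "m * m' \<in> MH" if "m \<in> MH" "m' \<in> MH" for m m' c
    using that by (auto intro: multipliers_times nd csubspace_add[OF csubspace_multipliers[OF nd]]
      csubspace_scale[OF csubspace_multipliers[OF nd]])
  show "clinear_on MH (\<lambda>m. mtensor [m])"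
    by (rule clinear_onI; rule mpow_eqI[of _ "Suc 0"])
      (auto simp: * MH s length_Suc_conv intro!: mpow_add mpow_scaleC)
  show "m \<in> MH \<Longrightarrow> m' \<in> MH \<Longrightarrow> mtensor [m] * mtensor [m'] = mtensor [m * m']"
    by (rule mpow_eqI[of _ "Suc 0"]) (auto simp: * MH length_Suc_conv intro!: multipliers_times
      nd_tpow)
qed

lemma smul_mtensor_single:
  "m \<in> MH \<Longrightarrow> m' \<in> MH \<Longrightarrow> smul s (mtensor [m]) (mtensor [m']) = mtensor [smul s m m']"
  by (simp add: smul_def mtensor_single)

text \<open>A common form for the subspaces of multipliers that occur. With every entry
  \<open>EH\<close> it contains the embedded tensor power of H, and with one entry N(H) it is
  \<open>N_slot\<close>; the slots that change under a coface can then be read off the list.\<close>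

definition MSpan :: "'a multiplier set list \<Rightarrow> 'a tens multiplier set" where
  "MSpan Vs = cspan {mtensor ms |ms. list_all2 (\<in>) ms Vs}"

lemma csubspace_MSpan: "csubspace (MSpan Vs)"
  by (simp add: MSpan_def)

lemma mtensor_in_MSpan: "list_all2 (\<in>) ms Vs \<Longrightarrow> mtensor ms \<in> MSpan Vs"
  by (auto simp: MSpan_def intro: cspan_base)

lemma list_all2_MH: "list_all2 (\<in>) ms Vs \<Longrightarrow> set Vs \<subseteq> Pow MH \<Longrightarrow> set ms \<subseteq> MH"
  by (induction rule: list_all2_induct) auto

lemma MSpan_subset: "set Vs \<subseteq> Pow MH \<Longrightarrow> length Vs = n \<Longrightarrow> MSpan Vs \<subseteq> mpow n"
  unfolding MSpan_def
  by (rule cspan_minimal[OF _ csubspace_mpow])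
    (auto intro!: mtensor_in_mpow dest: list_all2_MH list_all2_lengthD)

lemma MSpan_linear_memI:
  assumes "set Vs \<subseteq> Pow MH" "length Vs = n" "clinear_on (mpow n) f" "csubspace T"
    and "\<And>ms. list_all2 (\<in>) ms Vs \<Longrightarrow> f (mtensor ms) \<in> T" "z \<in> MSpan Vs"
  shows "f z \<in> T"
  by (rule clinear_on_span_mem[OF assms(3) csubspace_mpow _ assms(6)[unfolded MSpan_def] assms(4)])
    (use assms in \<open>auto intro!: mtensor_in_mpow dest: list_all2_MH list_all2_lengthD\<close>)

lemma mtens_MSpan:
  assumes Vs: "set Vs \<subseteq> Pow MH" "length Vs = p" and Us: "set Us \<subseteq> Pow MH" "length Us = q"
    and z: "z \<in> MSpan Vs" "z' \<in> MSpan Us"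
  shows "mtens p q z z' \<in> MSpan (Vs @ Us)"
proof (rule MSpan_linear_memI[OF Vs clinear_on_mtens_left csubspace_MSpan _ z(1)])
  show "z' \<in> mpow q" using MSpan_subset[OF Us] z by auto
  fix ms assume ms: "list_all2 (\<in>) ms Vs"
  note msl = list_all2_MH[OF ms Vs(1)] list_all2_lengthD[OF ms]
  show "mtens p q (mtensor ms) z' \<in> MSpan (Vs @ Us)"
  proof (rule MSpan_linear_memI[OF Us clinear_on_mtens_right csubspace_MSpan _ z(2)])
    show "mtensor ms \<in> mpow p" using msl Vs by (simp add: mtensor_in_mpow)
    fix ns assume ns: "list_all2 (\<in>) ns Us"
    show "mtens p q (mtensor ms) (mtensor ns) \<in> MSpan (Vs @ Us)"
      using mtensor_in_MSpan[OF list_all2_appendI[OF ms ns]]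
        mtensor_append[OF msl(1) list_all2_MH[OF ns Us(1)], of p q] msl(2)
          list_all2_lengthD[OF ns] Vs Us by simp
  qed
qed

abbreviation EH :: "'a multiplier set" where "EH \<equiv> range embH"

lemma EH_MH: "EH \<subseteq> MH" by auto

lemma emb_in_MSpan: "t \<in> tpow n \<Longrightarrow> emb_tens n t \<in> MSpan (replicate n EH)"
  by (rule tpow_memI[OF _ clinear_on_emb csubspace_MSpan], assumption)
    (auto simp: list_all2_conv_all_nth simp flip: mtensor_embH intro!: mtensor_in_MSpan)

lemma list_all2_replicate_EH: "list_all2 (\<in>) ms (replicate n EH) \<longleftrightarrow> (\<exists>xs. length xs = n \<and> ms =
  map embH xs)"
proof
  assume l: "list_all2 (\<in>) ms (replicate n EH)"
  then have "\<forall>i<n. \<exists>x. ms ! i = embH x" and [simp]: "length ms = n"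
    by (auto simp: list_all2_conv_all_nth image_iff)
  then obtain f where "\<And>i. i < n \<Longrightarrow> ms ! i = embH (f i)" by metis
  then have "ms = map embH (map f [0..<n])"
    by (intro nth_equalityI) auto
  then show "\<exists>xs. length xs = n \<and> ms = map embH xs"
    by (metis length_map length_upt diff_zero)
qed (auto simp: list_all2_conv_all_nth)

end

lemma split_at_nth:
  assumes "length xs = p + Suc r"
  obtains as a bs where "xs = as @ a # bs" "length as = p" "length bs = r"
proof -
  have "xs = take p xs @ xs ! p # drop (Suc p) xs" using assms by (simp add: id_take_nth_drop)
  then show ?thesis using that[of "take p xs" "xs ! p" "drop (Suc p) xs"] assms by auto
qed

section \<open>Threefold tensor products\<close>

text \<open>As a set this is just a tensor power. The notation records the division into p factors,
  a middle block on which the coproduct or the counit acts, and r further factors.\<close>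

definition tpow3 :: "nat \<Rightarrow> nat \<Rightarrow> nat \<Rightarrow> 'a::complex_vector tens set" where
  "tpow3 p m r = tpow (p + (m + r))"

definition mtens3 :: "nat \<Rightarrow> nat \<Rightarrow> nat \<Rightarrow> 'a::complex_algebra tens multiplier \<Rightarrow> 'a tens multiplier
    \<Rightarrow> 'a tens multiplier \<Rightarrow> 'a tens multiplier" where
  "mtens3 p m r a b c = mtens p (m + r) a (mtens m r b c)"

abbreviation mpow3 :: "nat \<Rightarrow> nat \<Rightarrow> nat \<Rightarrow> 'a::complex_algebra tens multiplier set" where
  "mpow3 p m r \<equiv> multipliers (tpow3 p m r)"

lemma append3_in_tpow3: "s \<in> tpow p \<Longrightarrow> u \<in> tpow m \<Longrightarrow> t \<in> tpow r \<Longrightarrow> s \<odot> u \<odot> t \<in> tpow3 p m r"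
  unfolding tpow3_def by (intro append_in_tpow)

lemma tpow3_eqI:
  assumes "x \<in> tpow3 p m r" "clinear_on (tpow3 p m r) f" "clinear_on (tpow3 p m r) g"
    and "\<And>s u t. s \<in> tpow p \<Longrightarrow> u \<in> tpow m \<Longrightarrow> t \<in> tpow r \<Longrightarrow> f (s \<odot> u \<odot> t) = g (s \<odot> u \<odot> t)"
  shows "f x = g x"
proof (rule tpow_eqI[OF assms(1-3)[unfolded tpow3_def]])
  fix xs :: "'a list" assume xs: "length xs = p + (m + r)"
  have "f (tensor (take p xs) \<odot> tensor (take m (drop p xs)) \<odot> tensor (drop m (drop p xs))) =
      g (tensor (take p xs) \<odot> tensor (take m (drop p xs)) \<odot> tensor (drop m (drop p xs)))"
    by (rule assms(4)) (use xs in \<open>auto intro!: tensor_in_tpow\<close>)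
  then show "f (tensor xs) = g (tensor xs)"
    by (simp del: drop_drop)
qed

lemma csubspace_tpow3: "csubspace (tpow3 p m r)"
  by (simp add: tpow3_def csubspace_tpow)

lemma tpow3_append_span:
  assumes "tpow p \<subseteq> cspan F" "tpow m \<subseteq> cspan G" "tpow r \<subseteq> cspan G'"
    and "\<And>s u t. s \<in> F \<Longrightarrow> u \<in> G \<Longrightarrow> t \<in> G' \<Longrightarrow> s \<odot> u \<odot> t \<in> T"
  shows "tpow3 p m r \<subseteq> cspan T"
proof -
  have "tpow3 p m r \<subseteq> cspan {s \<odot> v |s v. s \<in> F \<and> v \<in> {u \<odot> t |u t. u \<in> G \<and> t \<in> G'}}"
    unfolding tpow3_def by (rule tpow_append_span[OF assms(1) tpow_append_span[OF assms(2,3)]])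
  also have "\<dots> \<subseteq> cspan T"
    by (rule cspan_mono) (use assms(4) in auto)
  finally show ?thesis .
qed

context nondegenerate_alg
begin

lemma nd_tpow3: "nd_algebra (tpow3 p m r :: 'a tens set)"
  by (simp add: tpow3_def nd_tpow)

lemma mtens3_in:
  "a \<in> mpow p \<Longrightarrow> b \<in> mpow m \<Longrightarrow> c \<in> mpow r \<Longrightarrow> mtens3 p m r a b (c :: 'a tens multiplier) \<in> mpow3 p m r"
  unfolding tpow3_def mtens3_def by (intro mtens_in_mpow)

lemma lmul_mtens3:
  assumes "a \<in> mpow p" "b \<in> mpow m" "c \<in> mpow r" "s \<in> tpow p" "u \<in> tpow m" "t \<in> tpow r"
  shows "lmul (mtens3 p m r a b (c :: 'a tens multiplier)) (s \<odot> u \<odot> t) =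
    lmul a s \<odot> lmul b u \<odot> lmul c t"
  unfolding mtens3_def using assms by (simp add: lmul_mtens append_in_tpow mtens_in_mpow)

lemma rmul_mtens3:
  assumes "a \<in> mpow p" "b \<in> mpow m" "c \<in> mpow r" "s \<in> tpow p" "u \<in> tpow m" "t \<in> tpow r"
  shows "rmul (mtens3 p m r a b (c :: 'a tens multiplier)) (s \<odot> u \<odot> t) =
    rmul a s \<odot> rmul b u \<odot> rmul c t"
  unfolding mtens3_def using assms by (simp add: rmul_mtens append_in_tpow mtens_in_mpow)

lemma mtens3_times:
  assumes "a \<in> mpow p" "b \<in> mpow m" "c \<in> mpow r" "a' \<in> mpow p" "b' \<in> mpow m" "c' \<in> mpow r"
  shows "mtens3 p m r a b (c :: 'a tens multiplier) * mtens3 p m r a' b' c' =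
    mtens3 p m r (a * a') (b * b') (c * c')"
  unfolding mtens3_def using assms by (simp add: mtens_times mtens_in_mpow)

lemma smul_mtens3:
  assumes "a \<in> mpow p" "b \<in> mpow m" "c \<in> mpow r" "a' \<in> mpow p" "b' \<in> mpow m" "c' \<in> mpow r"
  shows "smul s (mtens3 p m r a b (c :: 'a tens multiplier)) (mtens3 p m r a' b' c') =
    mtens3 p m r (smul s a a') (smul s b b') (smul s c c')"
  using assms by (simp add: smul_def mtens3_times)

lemma clinear_on_mtens3_middle:
  assumes "a \<in> mpow p" "c \<in> (mpow r :: 'a tens multiplier set)"
  shows "clinear_on (mpow m) (\<lambda>b. mtens3 p m r a b c)"
  unfolding mtens3_def
  by (rule clinear_on_compose[OF clinear_on_mtens_left[OF assms(2)] _ clinear_on_mtens_right[OF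
    assms(1)]])
    (use assms in \<open>auto intro: mtens_in_mpow\<close>)

lemma mtens3_mtensor:
  assumes "set as \<subseteq> MH" "set bs \<subseteq> MH" "set cs \<subseteq> MH" "length as = p" "length bs = m" "length cs = r"
  shows "mtens3 p m r (mtensor as) (mtensor bs) (mtensor cs) = mtensor (as @ bs @ cs)"
  unfolding mtens3_def using assms
  by (subst mtensor_append[of as _ p "m + r"]) (auto simp: mtensor_append[of bs _ m r])

lemma mtens3_MSpan:
  assumes "set As \<subseteq> Pow MH" "length As = p" "set Bs \<subseteq> Pow MH" "length Bs = m" "set Cs \<subseteq> Pow MH"
    "length Cs = r"
    and "a \<in> MSpan As" "b \<in> MSpan Bs" "c \<in> MSpan Cs"
  shows "mtens3 p m r a b c \<in> MSpan (As @ Bs @ Cs)"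
  unfolding mtens3_def using assms by (intro mtens_MSpan) auto

lemma smul_mtensor2:
  assumes "a \<in> MH" "b \<in> MH" "c \<in> MH" "d \<in> MH"
  shows "smul s (mtensor [a, b]) (mtensor [c, d]) = mtensor [smul s a c, smul s b d]"
proof -
  have *: "mtensor [x, y] = mtens (Suc 0) (Suc 0) (mtensor [x]) (mtensor [y])" if "x \<in> MH"
    "y \<in> MH" for x y
    using mtensor_append[of "[x]" "[y]" "Suc 0" "Suc 0"] that by simp
  show ?thesis
    using assms by (simp add: * smul_mtens mtensor_in_mpow smul_mtensor_single smul_in_multipliers
      nd)
qed

lemma mpow_distrib:
  fixes a b c :: "'a tens multiplier"
  assumes "a \<in> mpow n" "b \<in> mpow n" "c \<in> mpow n"
  shows "(a + b) * c = a * c + b * c" "c * (a + b) = c * a + c * b"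
  using assms clinear_on_times_left[OF nd_tpow assms(3)] clinear_on_times_right[OF nd_tpow assms(3)]
  by (simp_all add: clinear_on_def)

lemma mpow_scale_times:
  fixes a c :: "'a tens multiplier"
  assumes "a \<in> mpow n" "c \<in> mpow n"
  shows "(k *\<^sub>C a) * c = k *\<^sub>C (a * c)" "c * (k *\<^sub>C a) = k *\<^sub>C (c * a)"
  using assms clinear_on_times_left[OF nd_tpow assms(2)] clinear_on_times_right[OF nd_tpow assms(2)]
  by (simp_all add: clinear_on_def)

lemma smul_unit:
  assumes "nd_algebra (A :: 'b::complex_algebra set)" "m \<in> multipliers A"
  shows "smul s (unit_multiplier A) m = m" "smul s m (unit_multiplier A) = m"
  using assms by (simp_all add: smul_def unit_times)

lemma smul_emb:
  assumes "nd_algebra (A :: 'b::complex_algebra set)" "m \<in> multipliers A" "x \<in> A"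
  shows "smul s m (emb A x) = emb A (if s then lmul m x else rmul m x)"
  using assms by (simp add: smul_def times_emb emb_times)

lemma tensor_single_clinear: "clinear (\<lambda>x. tensor [x :: 'a])"
  by (rule clinearI) (use tensor_add[of "[]" _ _ "[]"] tensor_scaleC[of "[]" _ _ "[]"] in simp_all)

lemma mtensor_single_emb: "mtensor [embH x] = emb_tens (Suc 0) (tensor [x :: 'a])"
  using mtensor_embH[of "[x]"] by simp

lemma tpow_1:
  assumes "u \<in> tpow (Suc 0)"
  obtains x :: 'a where "u = tensor [x]"
proof -
  have "u \<in> range (\<lambda>x :: 'a. tensor [x])"
  proof (rule tpow_memI[OF assms, of "\<lambda>x. x"])
    show "csubspace (range (\<lambda>x :: 'a. tensor [x]))"
      by (rule csubspaceI) (auto simp: clinear_0D[OF tensor_single_clinear, symmetric]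
        simp flip: clinearD[OF tensor_single_clinear])
  qed (auto simp: clinear_on_def length_Suc_conv)
  then show ?thesis using that by auto
qed

lemma clinear_on_mtens3_left:
  assumes "b \<in> mpow m" "c \<in> (mpow r :: 'a tens multiplier set)"
  shows "clinear_on (mpow p) (\<lambda>a. mtens3 p m r a b c)"
  unfolding mtens3_def by (rule clinear_on_mtens_left) (use assms in \<open>auto intro: mtens_in_mpow\<close>)

lemma clinear_on_mtens3_right:
  assumes "a \<in> mpow p" "b \<in> (mpow m :: 'a tens multiplier set)"
  shows "clinear_on (mpow r) (\<lambda>c. mtens3 p m r a b c)"
  unfolding mtens3_def
  by (rule clinear_on_compose[OF clinear_on_mtens_right[OF assms(2)] _ clinear_on_mtens_right[OF
    assms(1)]])
    (use assms in \<open>auto intro: mtens_in_mpow\<close>)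

lemma emb_tens_in: "x \<in> tpow n \<Longrightarrow> emb_tens n (x :: 'a tens) \<in> mpow n"
  by (simp add: emb_in_multipliers nd_tpow)

lemma mlin_emb: "mlin n (\<lambda>us :: 'a list. mtensor (map embH us))"
  by (rule mlin_cong[OF mlin_clinear_tensor[OF clinear_on_emb[of "tpow n"]]])
    (auto simp: mtensor_embH)

lemma mtensor_map_embH_in: "length us = n \<Longrightarrow> mtensor (map embH (us :: 'a list)) \<in> mpow n"
  by (rule mtensor_in_mpow) auto

end

section \<open>Regular multiplier Hopf algebras\<close>

text \<open>The assumption \<open>nontrivial\<close> comes from the character of the modular pair;
  it is what makes the counit non-zero.\<close>

locale cosimplicial = nondegenerate_alg algebra_type
  for algebra_type :: "'a::complex_algebra itself" +
  fixes \<Delta> :: "'a \<Rightarrow> 'a tens multiplier" and \<epsilon> :: "'a \<Rightarrow> complex" and \<sigma> :: "'a multiplier"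
  assumes regular: "regular_multiplier_Hopf_algebra \<Delta>"
    and counit: "is_counit \<Delta> \<epsilon>"
    and group_like: "group_like \<Delta> \<sigma>"
    and nontrivial: "\<exists>a :: 'a. a \<noteq> 0"
begin

abbreviation q1 where "q1 d \<equiv> mtensor [oneH, embH (d :: 'a)]"
abbreviation q0 where "q0 d \<equiv> mtensor [embH (d :: 'a), oneH]"

lemma q_in [simp]: "q1 d \<in> mpow 2" "q0 d \<in> mpow 2"
  by (rule mtensor_in_mpow; simp)+

lemma mha: "multiplier_Hopf_algebra \<Delta>" "multiplier_Hopf_algebra (flip_coproduct \<Delta>)"
  using regular by (simp_all add: regular_multiplier_Hopf_algebra_def)

lemma Delta_in [simp]: "\<Delta> a \<in> mpow 2"
  and Delta_times: "\<Delta> (a * b) = \<Delta> a * \<Delta> b"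
  and clinear_Delta: "clinear \<Delta>"
  using mha(1) by (auto simp: multiplier_Hopf_algebra_def algebra_hom_def)

lemma Delta_q: "\<Delta> a * q1 b \<in> emb_tens 2 ` tpow 2" "q0 a * \<Delta> b \<in> emb_tens 2 ` tpow 2"
  using mha(1) by (auto simp: multiplier_Hopf_algebra_def)

lemma W_bij: "bij_betw (W_R \<Delta>) (tpow 2) (tpow 2)" "bij_betw (W_L \<Delta>) (tpow 2) (tpow 2)"
  using mha(1) by (auto simp: multiplier_Hopf_algebra_def)

section \<open>The flip on the multipliers of the tensor square, and regularity\<close>

definition flip_mult :: "'a tens multiplier \<Rightarrow> 'a tens multiplier" where
  "flip_mult m = Multiplier (flip \<circ> lmul m \<circ> flip) (flip \<circ> rmul m \<circ> flip)"

lemma length_2: "length xs = 2 \<longleftrightarrow> (\<exists>x y. xs = [x, y])"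
  by (auto simp: numeral_2_eq_2 length_Suc_conv)

lemma mlin_2I:
  assumes "\<And>b. clinear (\<lambda>a. f [a, b])" "\<And>a. clinear (\<lambda>b. f [a, b])"
  shows "mlin 2 f"
proof (rule mlinI)
  fix us vs :: "'b list" and x y c assume l: "length us + Suc (length vs) = 2"
  then consider b where "us = []" "vs = [b]" | a where "us = [a]" "vs = []"
    by (cases us; cases vs) auto
  note cs = this
  show "f (us @ (x + y) # vs) = f (us @ x # vs) + f (us @ y # vs)"
    using cs by cases (simp_all add: clinear_addD[OF assms(1)] clinear_addD[OF assms(2)])
  show "f (us @ (c *\<^sub>C x) # vs) = c *\<^sub>C f (us @ x # vs)"
    using cs by cases (simp_all add: clinear_scaleD[OF assms(1)] clinear_scaleD[OF assms(2)])
qed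

lemma clinear_tensor2: "clinear (\<lambda>a. tensor [a, b])" "clinear (\<lambda>b. tensor [a, b])"
  using tensor_add[of "[]" _ _ "[b]"] tensor_scaleC[of "[]" _ _ "[b]"]
    tensor_add[of "[a]" _ _ "[]"] tensor_scaleC[of "[a]" _ _ "[]"]
  by (auto intro!: clinearI)

lemma mlin_flip: "mlin 2 (\<lambda>xs :: 'a list. tensor (rev xs))"
  by (rule mlin_2I) (simp_all add: clinear_tensor2)

lemma flip_tensor: "flip (tensor [a, b]) = tensor [b, a :: 'a]"
  by (simp add: flip_def lift_tensor_mlin[OF mlin_flip])

lemma clinear_on_flip: "clinear_on (tpow 2) (flip :: 'a tens \<Rightarrow> 'a tens)"
  unfolding flip_def by (rule clinear_on_lift_mlin[OF mlin_flip])

lemma flip_in: "flip (x :: 'a tens) \<in> tpow 2"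
proof (cases "x \<in> tpow 2")
  case True
  then show ?thesis unfolding flip_def
    by (rule lift_mem[OF mlin_flip csubspace_tpow tensor_in_tpow, rotated]) simp
qed (simp add: flip_def lift_def tpow_0)

lemma flip_flip: "x \<in> tpow 2 \<Longrightarrow> flip (flip x) = (x :: 'a tens)"
proof (rule tpow_eqI, assumption)
  show "clinear_on (tpow 2) (\<lambda>x :: 'a tens. flip (flip x))"
    by (rule clinear_on_compose[OF clinear_on_flip _ clinear_on_flip]) (simp add: flip_in)
qed (auto simp: length_2 flip_tensor clinear_on_def)

lemma flip_times:
  assumes "x \<in> tpow 2" "y \<in> tpow 2"
  shows "flip (x * y) = flip x * flip (y :: 'a tens)"
proof -
  note l = clinear_onD[OF clinear_on_flip]
  have 1: "flip (tensor xs * y) = flip (tensor xs) * flip y" if xs: "length xs = 2" for xs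
    by (rule tpow_eqI[OF assms(2)])
      (use xs in \<open>auto simp: l distrib_left mult_scaleC_right times_in_tpow tensor_in_tpow
        length_2 flip_tensor tensor_mult_eq intro!: clinear_onI\<close>)
  show ?thesis
    by (rule tpow_eqI[OF assms(1)])
      (use assms 1 in \<open>auto simp: l distrib_right mult_scaleC_left times_in_tpow intro!:
        clinear_onI\<close>)
qed

lemma flip_mult_in:
  assumes m: "m \<in> mpow 2"
  shows "flip_mult m \<in> mpow 2"
proof (rule multipliersI[OF nd_tpow])
  note f0 = clinear_on_zero[OF clinear_on_flip tpow_0]
  have "flip x = 0" if "x \<notin> tpow 2" for x :: "'a tens"
    using that by (simp add: flip_def lift_def)
  then show "lmul (flip_mult m) x = 0" "rmul (flip_mult m) x = 0" if "x \<notin> tpow 2" for x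
    using that clinear_on_zero[OF multipliersD(3)[OF m] tpow_0]
      clinear_on_zero[OF multipliersD(4)[OF m] tpow_0] f0
    by (simp_all add: flip_mult_def)
  show "lmul (flip_mult m) \<in> tpow 2 \<rightarrow> tpow 2" "rmul (flip_mult m) \<in> tpow 2 \<rightarrow> tpow 2"
    by (auto simp: flip_mult_def flip_in)
  fix a b :: "'a tens" assume ab: "a \<in> tpow 2" "b \<in> tpow 2"
  have "a * flip (lmul m (flip b)) = flip (flip a * lmul m (flip b))"
    using ab by (simp add: flip_times flip_in flip_flip multipliersD(1)[OF m])
  also have "\<dots> = flip (rmul m (flip a)) * b"
    using ab by (simp add: multipliersD(9)[OF m] flip_times flip_in flip_flip multipliersD(2)[OF m])
  finally show "a * lmul (flip_mult m) b = rmul (flip_mult m) a * b"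
    by (simp add: flip_mult_def)
qed

lemma flip_mult_times:
  assumes "m \<in> mpow 2" "m' \<in> mpow 2"
  shows "flip_mult (m * m') = flip_mult m * flip_mult m'"
  by (rule multiplier_cases_eq) (auto simp: fun_eq_iff flip_mult_def flip_flip flip_in
    multipliersD(1,2)[OF assms(1)] multipliersD(1,2)[OF assms(2)])

lemma flip_mult_flip_mult: "m \<in> mpow 2 \<Longrightarrow> flip_mult (flip_mult m) = m"
  by (rule mpow_eqI[of _ 2]) (auto simp: flip_mult_in, simp add: flip_mult_def flip_flip flip_in
    tensor_in_tpow multipliersD(1))

lemma flip_mult_mtensor: "a \<in> MH \<Longrightarrow> b \<in> MH \<Longrightarrow> flip_mult (mtensor [a, b]) = mtensor [b, a]"
  by (rule mpow_eqI[OF flip_mult_in mtensor_in_mpow])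
    (auto intro!: mtensor_in_mpow simp: length_2 flip_mult_def lmul_mtensor flip_tensor)

lemma flip_mult_emb: "t \<in> tpow 2 \<Longrightarrow> flip_mult (emb_tens 2 t) = emb_tens 2 (flip t)"
  by (rule multiplier_eqI[OF nd_tpow flip_mult_in _ cspan_self])
    (auto intro!: emb_in_multipliers nd_tpow flip_in simp: flip_mult_def lmul_emb flip_times
      flip_in flip_flip)

lemma flip_coproduct_eq: "flip_coproduct \<Delta> a = flip_mult (\<Delta> a)"
  by (simp add: flip_coproduct_def flip_mult_def)

text \<open>This is where regularity enters. Conjugation by the flip is multiplicative, exchanges 1
  \<otimes> b with b \<otimes> 1 and preserves H \<otimes> H, so it carries the two conditions on
  the flipped coproduct to the missing ones on \<Delta>.\<close>

lemma Delta_q_flip: "\<Delta> a * q0 b \<in> emb_tens 2 ` tpow 2" "q1 a * \<Delta> b \<in> emb_tens 2 ` tpow 2"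
proof -
  have "flip_mult (\<Delta> a) * q1 b \<in> emb_tens 2 ` tpow 2" "q0 a * flip_mult (\<Delta> b) \<in> emb_tens 2 ` tpow 2"
    using mha(2) by (auto simp: multiplier_Hopf_algebra_def flip_coproduct_eq)
  then have "flip_mult (\<Delta> a * q0 b) \<in> emb_tens 2 ` tpow 2"
    "flip_mult (q1 a * \<Delta> b) \<in> emb_tens 2 ` tpow 2"
    by (simp_all add: flip_mult_times flip_mult_mtensor)
  then have "flip_mult (flip_mult (\<Delta> a * q0 b)) \<in> flip_mult ` emb_tens 2 ` tpow 2"
    "flip_mult (flip_mult (q1 a * \<Delta> b)) \<in> flip_mult ` emb_tens 2 ` tpow 2"
    by blast+
  moreover have "flip_mult ` emb_tens 2 ` tpow 2 \<subseteq> emb_tens 2 ` tpow 2"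
    by (auto simp: flip_mult_emb flip_in)
  ultimately show "\<Delta> a * q0 b \<in> emb_tens 2 ` tpow 2" "q1 a * \<Delta> b \<in> emb_tens 2 ` tpow 2"
    by (auto simp: flip_mult_flip_mult multipliers_times nd_tpow)
qed

lemma smul_Delta_q: "smul s (\<Delta> a) (q1 b) \<in> emb_tens 2 ` tpow 2"
  "smul s (\<Delta> a) (q0 b) \<in> emb_tens 2 ` tpow 2"
  by (simp_all add: smul_def Delta_q Delta_q_flip)

section \<open>The canonical maps \<open>W_R\<close> and \<open>W_L\<close>\<close>

lemma clinear_on_inv_emb: "clinear_on (emb_tens 2 ` tpow 2) (inv_into (tpow 2)
  (emb_tens 2 :: 'a tens \<Rightarrow> _))"
  by (rule clinear_onI)
    (auto simp: inv_into_f_f[OF inj_on_emb[OF nd_tpow]] tpow_add tpow_scaleC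
      simp flip: clinear_onD[OF clinear_on_emb, of _ "tpow 2"])

lemma clinear_q: "clinear q1" "clinear q0"
proof -
  have *: "q1 d = mtens (Suc 0) (Suc 0) (mtensor [oneH]) (emb_tens (Suc 0) (tensor [d]))"
    "q0 d = mtens (Suc 0) (Suc 0) (emb_tens (Suc 0) (tensor [d])) (mtensor [oneH])" for d
    using mtensor_append[of "[oneH]" "[embH d]" "Suc 0" "Suc 0"] mtensor_append[of "[embH d]"
      "[oneH]" "Suc 0" "Suc 0"]
    by (simp_all add: mtensor_single_emb)
  have t: "clinear_on UNIV (\<lambda>d. emb_tens (Suc 0) (tensor [d :: 'a]))"
    by (rule clinear_on_compose[OF clinear_imp_clinear_on[OF tensor_single_clinear] _
      clinear_on_emb, of _ "tpow (Suc 0)"])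
      (simp add: tensor_in_tpow)
  have i: "(\<lambda>d. emb_tens (Suc 0) (tensor [d :: 'a])) \<in> UNIV \<rightarrow> mpow (Suc 0)"
    "mtensor [oneH :: 'a multiplier] \<in> mpow (Suc 0)"
    by (auto intro!: emb_in_multipliers nd_tpow tensor_in_tpow mtensor_in_mpow)
  show "clinear q1" "clinear q0"
    using clinear_on_compose[OF t i(1) clinear_on_mtens_right[OF i(2), where q = "Suc 0"]]
      clinear_on_compose[OF t i(1) clinear_on_mtens_left[OF i(2), where p = "Suc 0"]]
    by (simp_all add: * clinear_on_def clinearI)
qed

text \<open>Reading back from multipliers to tensors is linear only on the image of the embedding,
  so the membership \<open>Delta_q\<close> is needed before linearity can be used.\<close>

lemma W_R_mlin: "mlin 2 (\<lambda>xs. inv_into (tpow 2) (emb_tens 2) (\<Delta> (xs ! 0) * mtensor [oneH, embH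
  (xs ! 1)]))"
proof (rule mlin_2I)
  note b = mpow_distrib[where n = 2] mpow_scale_times[where n = 2]
    clinearD[OF clinear_Delta] clinearD[OF clinear_q(1)]
    clinear_onD[OF clinear_on_inv_emb]
  show "clinear (\<lambda>a. inv_into (tpow 2) (emb_tens 2) (\<Delta> ([a, b] ! 0) * mtensor [oneH, embH
    ([a, b] ! 1)]))" for b
    by (rule clinearI) (simp_all add: b Delta_q)
  show "clinear (\<lambda>b. inv_into (tpow 2) (emb_tens 2) (\<Delta> ([a, b] ! 0) * mtensor [oneH, embH
    ([a, b] ! 1)]))" for a
    by (rule clinearI) (simp_all add: b Delta_q)
qed

lemma W_L_mlin: "mlin 2 (\<lambda>xs. inv_into (tpow 2) (emb_tens 2) (mtensor [embH (xs ! 0), oneH] * \<Delta>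
  (xs ! 1)))"
proof (rule mlin_2I)
  note b = mpow_distrib[where n = 2] mpow_scale_times[where n = 2]
    clinearD[OF clinear_Delta] clinearD[OF clinear_q(2)]
    clinear_onD[OF clinear_on_inv_emb]
  show "clinear (\<lambda>a. inv_into (tpow 2) (emb_tens 2) (mtensor [embH ([a, b] ! 0), oneH] * \<Delta>
    ([a, b] ! 1)))" for b
    by (rule clinearI) (simp_all add: b Delta_q)
  show "clinear (\<lambda>b. inv_into (tpow 2) (emb_tens 2) (mtensor [embH ([a, b] ! 0), oneH] * \<Delta>
    ([a, b] ! 1)))" for a
    by (rule clinearI) (simp_all add: b Delta_q)
qed

lemma W_R_tensor: "emb_tens 2 (W_R \<Delta> (tensor [a, b])) = \<Delta> a * q1 b"
  and W_L_tensor: "emb_tens 2 (W_L \<Delta> (tensor [a, b])) = q0 a * \<Delta> b"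
  unfolding W_R_def W_L_def
  by (simp_all add: lift_tensor_mlin[OF W_R_mlin[unfolded One_nat_def]]
    lift_tensor_mlin[OF W_L_mlin[unfolded One_nat_def]] f_inv_into_f Delta_q)

lemma W_linear: "clinear_on (tpow 2) (W_R \<Delta>)" "clinear_on (tpow 2) (W_L \<Delta>)"
  unfolding W_R_def W_L_def by (intro clinear_on_lift_mlin W_R_mlin W_L_mlin)+

lemma W_in: "W_R \<Delta> \<in> tpow 2 \<rightarrow> tpow 2" "W_L \<Delta> \<in> tpow 2 \<rightarrow> tpow 2"
  using W_bij by (auto simp: bij_betw_def)

text \<open>The side decides the slot: bijectivity is available for \<Delta>(c)(1 \<otimes> d), with
  \<Delta>(c) on the left, and for (d \<otimes> 1)\<Delta>(c), with \<Delta>(c) on the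
  right.\<close>

abbreviation q where "q s \<equiv> (if s then q1 else q0)"

text \<open>Surjectivity of \<open>W_R\<close> or \<open>W_L\<close>, according to the side. It is
  used both for non-degeneracy of \<Delta> and for rewriting two adjacent entries of a test
  tensor.\<close>

lemma emb_in_span_Delta:
  assumes "t \<in> tpow 2"
  shows "emb_tens 2 t \<in> cspan {smul s (\<Delta> c) (q s d) |c d. True}"
proof -
  define W where "W = (if s then W_R \<Delta> else W_L \<Delta>)"
  have W: "bij_betw W (tpow 2) (tpow 2)" "clinear_on (tpow 2) W" "W \<in> tpow 2 \<rightarrow> tpow 2"
    by (simp_all add: W_def W_bij W_linear W_in)
  obtain u where u: "u \<in> tpow 2" "t = W u" using W(1) assms by (auto simp: bij_betw_def)
  have "emb_tens 2 (W u) \<in> cspan {smul s (\<Delta> c) (q s d) |c d. True}"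
  proof (rule tpow_memI[OF u(1) clinear_on_compose[OF W(2,3) clinear_on_emb] csubspace_cspan])
    fix xs :: "'a list" assume "length xs = 2"
    then obtain a b where xs: "xs = [a, b]" by (auto simp: length_2)
    have "emb_tens 2 (W (tensor xs)) = (if s then smul s (\<Delta> a) (q s b) else smul s (\<Delta> b) (q s a))"
      by (simp add: W_def xs W_R_tensor W_L_tensor smul_def)
    then show "emb_tens 2 (W (tensor xs)) \<in> cspan {smul s (\<Delta> c) (q s d) |c d. True}"
      by (auto intro!: cspan_base)
  qed
  then show ?thesis using u by simp
qed

section \<open>The counit, and idempotence of H and of its tensor powers\<close>

lemma eps_hom: "clinear \<epsilon>" "\<epsilon> (a * b) = \<epsilon> a * \<epsilon> b"
  using counit by (auto simp: is_counit_def algebra_hom_def)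

lemma eps_linear: "\<epsilon> (a + b) = \<epsilon> a + \<epsilon> b" "\<epsilon> (c *\<^sub>C a) = c * \<epsilon> a"
  using clinearD[OF eps_hom(1)] by (simp_all add: scaleC_complex_def)

lemma counit_W_R: "lift 2 (\<lambda>xs. \<epsilon> (xs ! 0) *\<^sub>C xs ! 1) (W_R \<Delta> (tensor [a, b])) = a * b"
  using counit by (auto simp: is_counit_def)

lemma mlin_counit: "mlin 2 (\<lambda>xs. \<epsilon> (xs ! 0) *\<^sub>C xs ! 1)"
  by (rule mlin_2I; rule clinearI) (simp_all add: eps_linear scaleC_add_left scaleC_add_right
    scaleC_scaleC mult.commute)

text \<open>If \<epsilon> were 0, the counit identity would give ab = 0 for all a and b, so H would
  be 0 by non-degeneracy. A value other than 0 is then rescaled to 1.\<close>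

lemma counit_nonzero: obtains u where "\<epsilon> u = 1"
proof -
  have "\<exists>v. \<epsilon> v \<noteq> 0"
  proof (rule ccontr)
    assume "\<not> (\<exists>v. \<epsilon> v \<noteq> 0)"
    then have 0: "lift 2 (\<lambda>xs. \<epsilon> (xs ! 0) *\<^sub>C xs ! 1) t = 0" for t
      by (simp add: lift_def tens_lift_def formal_sum_def cong: if_cong)
    have "a * b = 0" for a b :: 'a
      by (subst counit_W_R[symmetric]) (rule 0)
    then show False using nontrivial nd_algebraD(3)[OF nd UNIV_I] by metis
  qed
  then obtain v where "\<epsilon> v \<noteq> 0" ..
  then have "\<epsilon> ((1 / \<epsilon> v) *\<^sub>C v) = 1" by (simp add: eps_linear)
  then show ?thesis by (rule that)
qed

text \<open>With \<epsilon>(u) = 1, write u \<otimes> c = W_R(s) and apply \<epsilon> \<otimes> id.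
  The left side becomes c, and by the counit identity the right side is a combination of
  products.\<close>

lemma idempotent_H: "(c :: 'a) \<in> cspan {a * b |a b. True}"
proof -
  obtain u where u: "\<epsilon> u = 1" by (rule counit_nonzero)
  have "tensor [u, c] \<in> tpow 2" by (simp add: tensor_in_tpow)
  then obtain s where s: "s \<in> tpow 2" "W_R \<Delta> s = tensor [u, c]"
    using W_bij(1) by (metis bij_betw_def imageE)
  have "lift 2 (\<lambda>xs. \<epsilon> (xs ! 0) *\<^sub>C xs ! 1) (W_R \<Delta> s) \<in> cspan {a * b |a b. True}"
    by (rule tpow_memI[OF s(1) clinear_on_compose[OF W_linear(1) W_in(1) clinear_on_lift_mlin[OF
      mlin_counit]] csubspace_cspan])
      (auto simp: length_2 counit_W_R[unfolded One_nat_def] intro!: cspan_base, blast)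
  then show ?thesis
    by (simp add: s lift_tensor_mlin[OF mlin_counit[unfolded One_nat_def]] u scaleC_one)
qed

definition tpow_products :: "nat \<Rightarrow> 'a tens set" where
  "tpow_products n = {s * t |s t. s \<in> tpow n \<and> t \<in> tpow n}"

text \<open>A concatenation of two products is again a product, so the property passes from H to the
  powers one factor at a time. In the 0-th power the empty tensor is its own square.\<close>

lemma idempotent_tpow: "tpow n \<subseteq> cspan (tpow_products n)"
proof (induction n)
  case 0
  have "tensor [] = tensor [] * (tensor [] :: 'a tens)" by (simp add: tensor_mult_eq)
  then have "tensor [] \<in> tpow_products 0"
    unfolding tpow_products_def using tensor_in_tpow[of "[]" 0] by blast
  then show ?case unfolding tpow_def by (intro cspan_mono) auto
next
  case (Suc n)
  have 1: "tpow (Suc 0) \<subseteq> cspan (tpow_products (Suc 0))"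
  proof
    fix t :: "'a tens" assume t: "t \<in> tpow (Suc 0)"
    show "t \<in> cspan (tpow_products (Suc 0))"
    proof (rule tpow_memI[OF t, of "\<lambda>x. x"])
      fix xs :: "'a list" assume "length xs = Suc 0"
      then obtain c where xs: "xs = [c]" by (auto simp: length_Suc_conv)
      have "tensor [c] \<in> cspan (tpow_products (Suc 0))"
      proof (rule clinear_on_span_mem[OF clinear_imp_clinear_on[OF tensor_single_clinear]
        csubspace_UNIV subset_UNIV idempotent_H csubspace_cspan])
        fix x assume "x \<in> {a * b |a b :: 'a. True}"
        then obtain a b where "x = a * b" by auto
        then have "tensor [x] = tensor [a] * tensor [b]" by (simp add: tensor_mult_eq)
        then have "tensor [x] \<in> tpow_products (Suc 0)"
          unfolding tpow_products_def using tensor_in_tpow[of "[_]" "Suc 0"] by fastforce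
        then show "tensor [x] \<in> cspan (tpow_products (Suc 0))" by (rule cspan_base)
      qed
      then show "tensor xs \<in> cspan (tpow_products (Suc 0))" by (simp add: xs)
    qed (auto simp: clinear_on_def)
  qed
  have "tpow (Suc 0 + n) \<subseteq> cspan {s \<odot> t |s t. s \<in> tpow_products (Suc 0) \<and> t \<in> tpow_products n}"
    by (rule tpow_append_span[OF 1 Suc.IH])
  also have "{s \<odot> t |s t. s \<in> tpow_products (Suc 0) \<and> t \<in> tpow_products n} \<subseteq> tpow_products
    (Suc 0 + n)"
  proof clarify
    fix s t assume "s \<in> tpow_products (Suc 0)" "t \<in> tpow_products n"
    then obtain a b c d where "s = a * b" "t = c * d" "a \<in> tpow (Suc 0)" "b \<in> tpow (Suc 0)"
      "c \<in> tpow n" "d \<in> tpow n"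
      by (auto simp: tpow_products_def)
    then show "s \<odot> t \<in> tpow_products (Suc 0 + n)"
      unfolding tpow_products_def
      by (intro CollectI exI[of _ "a \<odot> c"] exI[of _ "b \<odot> d"])
        (simp add: append_times append_in_tpow del: add_Suc)
  qed
  finally show ?case by (simp add: cspan_mono)
qed

lemma clinear_lmul_at: "clinear (\<lambda>m. lmul m t)" "clinear (\<lambda>m. rmul m t)"
  for t :: "'b::complex_vector"
  by (rule clinearI; simp)+

text \<open>Products st span the tensor square. Writing s through \<Delta>(c)(1 \<otimes> d) gives
  st as a combination of \<Delta>(c)((1 \<otimes> d)t); on the other side t is written through (d
  \<otimes> 1)\<Delta>(c).\<close>

lemma Delta_span: "tpow 2 \<subseteq> cspan {lmul (\<Delta> x) w |x w. x \<in> UNIV \<and> w \<in> tpow 2}"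
  "tpow 2 \<subseteq> cspan {rmul (\<Delta> x) w |x w. x \<in> UNIV \<and> w \<in> tpow 2}"
proof -
  have "lmul (emb_tens 2 s) t \<in> cspan {lmul (\<Delta> x) w |x w. x \<in> UNIV \<and> w \<in> tpow 2}"
    if "s \<in> tpow 2" "t \<in> tpow 2" for s t
    by (rule clinear_on_span_mem[OF clinear_imp_clinear_on[OF clinear_lmul_at(1)] csubspace_UNIV
      subset_UNIV emb_in_span_Delta[OF that(1), of True] csubspace_cspan])
     (use multipliersD(1)[OF q_in(1) that(2)] in \<open>auto simp: smul_def intro!: cspan_base\<close>, blast)
  then have "tpow_products 2 \<subseteq> cspan {lmul (\<Delta> x) w |x w. x \<in> UNIV \<and> w \<in> tpow 2}"
    by (auto simp: tpow_products_def lmul_emb)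
  from cspan_minimal[OF this csubspace_cspan]
  show "tpow 2 \<subseteq> cspan {lmul (\<Delta> x) w |x w. x \<in> UNIV \<and> w \<in> tpow 2}"
    using idempotent_tpow by blast
  have "rmul (emb_tens 2 t) s \<in> cspan {rmul (\<Delta> x) w |x w. x \<in> UNIV \<and> w \<in> tpow 2}"
    if "s \<in> tpow 2" "t \<in> tpow 2" for s t
    by (rule clinear_on_span_mem[OF clinear_imp_clinear_on[OF clinear_lmul_at(2)] csubspace_UNIV
      subset_UNIV emb_in_span_Delta[OF that(2), of False] csubspace_cspan])
     (use multipliersD(2)[OF q_in(2) that(1)] in \<open>auto simp: smul_def intro!: cspan_base\<close>, blast)
  then have "tpow_products 2 \<subseteq> cspan {rmul (\<Delta> x) w |x w. x \<in> UNIV \<and> w \<in> tpow 2}"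
    by (auto simp: tpow_products_def rmul_emb)
  from cspan_minimal[OF this csubspace_cspan]
  show "tpow 2 \<subseteq> cspan {rmul (\<Delta> x) w |x w. x \<in> UNIV \<and> w \<in> tpow 2}"
    using idempotent_tpow by blast
qed

lemma nd_hom_Delta: "nd_hom UNIV (tpow 2) \<Delta>"
  unfolding nd_hom_def using Delta_span
  by (simp add: nd nd_tpow clinear_imp_clinear_on clinear_Delta Delta_times)

section \<open>The coproduct on the algebra generated by H and the group-like element\<close>

definition Delta_ext :: "'a multiplier \<Rightarrow> 'a tens multiplier" where
  "Delta_ext = hom_extension UNIV (tpow 2) \<Delta>"

lemma Delta_ext_in [simp]: "\<nu> \<in> MH \<Longrightarrow> Delta_ext \<nu> \<in> mpow 2"
  unfolding Delta_ext_def by (rule hom_extension_in_multipliers[OF nd_hom_Delta])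

lemma Delta_ext_emb: "Delta_ext (embH a) = \<Delta> a"
  unfolding Delta_ext_def by (rule hom_extension_emb[OF nd_hom_Delta UNIV_I])

lemma Delta_ext_one: "Delta_ext oneH = unit_multiplier (tpow 2)"
  unfolding Delta_ext_def by (rule hom_extension_unit[OF nd_hom_Delta])

lemma sigma_in [simp]: "\<sigma> \<in> MH"
  using group_like by (simp add: group_like_def)

text \<open>Group-likeness says that \<sigma> \<otimes> \<sigma> is a value of the canonical
  extension at \<sigma>, and that value is unique.\<close>

lemma Delta_ext_sigma: "Delta_ext \<sigma> = mtensor [\<sigma>, \<sigma>]"
  unfolding Delta_ext_def
  using hom_extends_unique[OF nd_hom_Delta hom_extends_hom_extension[OF nd_hom_Delta sigma_in]]
    group_like
  by (simp add: group_like_def)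

abbreviation NH where "NH \<equiv> N_alg \<sigma>"

lemma NH_minimal:
  assumes "csubspace B" "\<And>x y. x \<in> B \<Longrightarrow> y \<in> B \<Longrightarrow> x * y \<in> B" "\<And>a. embH a \<in> B" "oneH \<in> B" "\<sigma> \<in> B"
  shows "NH \<subseteq> B"
  unfolding N_alg_def by (rule hull_minimal) (use assms in auto)

lemma NH_subalgebra: "csubspace NH" "x \<in> NH \<Longrightarrow> y \<in> NH \<Longrightarrow> x * y \<in> NH"
proof -
  let ?P = "\<lambda>B. csubspace B \<and> (\<forall>x\<in>B. \<forall>y\<in>B. x * y \<in> B)"
  have "?P NH" unfolding N_alg_def
  proof (rule hull_in)
    fix T assume T: "\<forall>B\<in>T. ?P B"
    have "csubspace (\<Inter>T)" by (rule csubspace_Inter) (use T in blast)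
    then show "?P (\<Inter>T)" using T by blast
  qed
  then show "csubspace NH" "x \<in> NH \<Longrightarrow> y \<in> NH \<Longrightarrow> x * y \<in> NH" by auto
qed

lemma NH_generators: "embH a \<in> NH" "oneH \<in> NH" "\<sigma> \<in> NH"
  unfolding N_alg_def by (rule subsetD[OF hull_subset], simp)+

lemma NH_MH: "NH \<subseteq> MH"
  by (rule NH_minimal) (auto intro: csubspace_multipliers nd multipliers_times)

lemma EH_NH: "EH \<subseteq> NH"
  using NH_generators by auto

lemma MSpan_mono:
  assumes "list_all2 (\<subseteq>) Vs Us"
  shows "MSpan Vs \<subseteq> MSpan Us"
  unfolding MSpan_def
proof (rule cspan_mono, clarify)
  fix ms assume "list_all2 (\<in>) ms Vs"
  with assms have "list_all2 (\<in>) ms Us"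
    unfolding list_all2_conv_all_nth by fastforce
  then show "\<exists>ns. mtensor ms = mtensor ns \<and> list_all2 (\<in>) ns Us" by blast
qed

lemma smul_NH: "x \<in> NH \<Longrightarrow> y \<in> NH \<Longrightarrow> smul s x y \<in> NH"
  by (simp add: smul_def NH_subalgebra)

lemma smul_MSpan_right:
  assumes "set Vs \<subseteq> Pow MH" "length Vs = n" "m \<in> mpow n" "csubspace T" "z \<in> MSpan Vs"
    and "\<And>ms. list_all2 (\<in>) ms Vs \<Longrightarrow> smul s m (mtensor ms) \<in> T"
  shows "smul s m z \<in> T"
  by (rule MSpan_linear_memI[OF assms(1,2) clinear_on_smul_right[OF nd_tpow assms(3)] assms(4,6,5)])

lemma smul_MSpan_left:
  assumes "set Vs \<subseteq> Pow MH" "length Vs = n" "m \<in> mpow n" "csubspace T" "z \<in> MSpan Vs"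
    and "\<And>ms. list_all2 (\<in>) ms Vs \<Longrightarrow> smul s (mtensor ms) m \<in> T"
  shows "smul s z m \<in> T"
  by (rule MSpan_linear_memI[OF assms(1,2) clinear_on_smul_left[OF nd_tpow assms(3)] assms(4,6,5)])

lemma list_all2_2: "list_all2 (\<in>) ms [V, U] \<longleftrightarrow> (\<exists>a b. ms = [a, b] \<and> a \<in> V \<and> b \<in> U)"
  by (auto simp: list_all2_Cons2)

lemma MSpan2I: "a \<in> V \<Longrightarrow> b \<in> U \<Longrightarrow> mtensor [a, b] \<in> MSpan [V, U]"
  by (rule mtensor_in_MSpan) simp

lemma smul_embH: "m \<in> MH \<Longrightarrow> smul s m (embH x) \<in> EH"
  by (simp add: smul_emb nd)

lemma smul_oneH: "m \<in> MH \<Longrightarrow> smul s m oneH = m" "m \<in> MH \<Longrightarrow> smul s oneH m = m"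
  by (simp_all add: smul_unit nd)

lemma emb2_MSpan: "emb_tens 2 ` tpow 2 \<subseteq> MSpan [EH, EH]"
  using emb_in_MSpan[of _ 2] by (auto simp: numeral_2_eq_2)

text \<open>
  The set of all \<open>\<kappa>\<close> with the two properties below is an algebra: the tensors \<open>\<nu> \<otimes> b\<close> factor as
  \<open>(1 \<otimes> b)(\<nu> \<otimes> 1)\<close>, so a second factor \<open>\<Delta>(\<kappa>)\<close> meets \<open>1 \<otimes> b\<close> again.
\<close>

lemma Delta_ext_NH:
  assumes "\<kappa> \<in> NH"
  shows "smul s (Delta_ext \<kappa>) (q1 d) \<in> MSpan [NH, EH]"
    "smul s (Delta_ext \<kappa>) (q0 d) \<in> MSpan [EH, NH]"
proof -
  define B where "B = {\<kappa> \<in> MH. \<forall>s d. smul s (Delta_ext \<kappa>) (q1 d) \<in> MSpan [NH, EH] \<and> smul s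
    (Delta_ext \<kappa>) (q0 d) \<in> MSpan [EH, NH]}"
  have sets: "set [NH, EH] \<subseteq> Pow MH" "set [EH, NH] \<subseteq> Pow MH" using NH_MH by auto
  have [simp]: "x \<in> NH \<Longrightarrow> x \<in> MH" for x using NH_MH by auto
  have "NH \<subseteq> B"
  proof (rule NH_minimal)
    note lin = clinear_on_hom_extension[OF nd_hom_Delta, folded Delta_ext_def]
    note sm = clinear_on_add[OF clinear_on_smul_left[OF nd_tpow q_in(1)] Delta_ext_in Delta_ext_in]
      clinear_on_add[OF clinear_on_smul_left[OF nd_tpow q_in(2)] Delta_ext_in Delta_ext_in]
      clinear_on_scaleC[OF clinear_on_smul_left[OF nd_tpow q_in(1)] Delta_ext_in]
      clinear_on_scaleC[OF clinear_on_smul_left[OF nd_tpow q_in(2)] Delta_ext_in]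
    note MHs = csubspace_multipliers[OF nd]
    show "csubspace B"
    proof (rule csubspaceI)
      have 0: "Delta_ext 0 = 0" "0 \<in> MH"
        using clinear_on_zero[OF lin] csubspace_0[OF MHs] by auto
      have "smul s 0 m = 0" if "m \<in> mpow 2" for s and m :: "'a tens multiplier"
        using clinear_on_zero[OF clinear_on_smul_left[OF nd_tpow that]]
          csubspace_0[OF csubspace_mpow] by blast
      then show "0 \<in> B"
        by (simp add: B_def 0 csubspace_0[OF csubspace_MSpan])
      show "x + y \<in> B" if "x \<in> B" "y \<in> B" for x y
        using that by (auto simp: B_def clinear_on_add[OF lin] sm csubspace_add[OF MHs]
          csubspace_add[OF csubspace_MSpan])
      show "c *\<^sub>C x \<in> B" if "x \<in> B" for c x
        using that by (auto simp: B_def clinear_on_scaleC[OF lin] sm csubspace_scale[OF MHs]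
          csubspace_scale[OF csubspace_MSpan])
    qed
    show "x * y \<in> B" if "x \<in> B" "y \<in> B" for x y
    proof -
      have MHx: "x \<in> MH" "y \<in> MH" "x * y \<in> MH" using that multipliers_times[OF nd] by
        (auto simp: B_def)
      have B1: "smul s (Delta_ext v) (q1 d) \<in> MSpan [NH, EH]"
        "smul s (Delta_ext v) (q0 d) \<in> MSpan [EH, NH]" if "v \<in> B" for v s d
        using that unfolding B_def by blast+
      \<comment> \<open>Treats both slots at once: \<open>Q b\<close> is 1 \<otimes> b or b
        \<otimes> 1, and \<open>R\<close> has the element of N(H) in the other slot and 1 in the
        slot of b.\<close>
      have step: "smul s (Delta_ext v) z \<in> MSpan Vs"
        if Vs: "set Vs \<subseteq> Pow MH" "length Vs = 2" and v: "v \<in> B" and z: "z \<in> MSpan Vs"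
          and Vq: "\<And>d. smul s (Delta_ext v) (Q d) \<in> MSpan Vs"
          and fac: "\<And>ms. list_all2 (\<in>) ms Vs \<Longrightarrow> \<exists>b R. mtensor ms =
            smul s (Q b) (mtensor R) \<and> set R \<subseteq> MH \<and> length R = 2 \<and>
            (\<forall>ks. list_all2 (\<in>) ks Vs \<longrightarrow> smul s (mtensor ks) (mtensor R) \<in> MSpan Vs)" for s v z Vs
              and Q :: "'a \<Rightarrow> _"
      proof (rule smul_MSpan_right[OF Vs _ csubspace_MSpan z])
        show "Delta_ext v \<in> mpow 2" using v by (simp add: B_def)
        fix ms assume "list_all2 (\<in>) ms Vs"
        from fac[OF this] obtain b R where ms: "mtensor ms = smul s (Q b) (mtensor R)"
          and R: "mtensor R \<in> mpow 2"
          and ks: "\<And>ks. list_all2 (\<in>) ks Vs \<Longrightarrow> smul s (mtensor ks) (mtensor R) \<in> MSpan Vs"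
          using mtensor_in_mpow by blast
        have "smul s (smul s (Delta_ext v) (Q b)) (mtensor R) \<in> MSpan Vs"
          by (rule smul_MSpan_left[OF Vs R csubspace_MSpan Vq ks])
        then show "smul s (Delta_ext v) (mtensor ms) \<in> MSpan Vs" by (simp add: ms smul_assoc)
      qed
      have step1: "smul s (Delta_ext v) z \<in> MSpan [NH, EH]" if v: "v \<in> B"
        and z: "z \<in> MSpan [NH, EH]" for s v z
      proof (rule step[OF sets(1) _ v z B1(1)[OF v]])
        fix ms assume "list_all2 (\<in>) ms [NH, EH]"
        then obtain \<nu> b where ms: "ms = [\<nu>, embH b]" "\<nu> \<in> NH" by (auto simp: list_all2_2)
        show "\<exists>b R. mtensor ms = smul s (q1 b) (mtensor R) \<and> set R \<subseteq> MH \<and> length R = 2 \<and>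
            (\<forall>ks. list_all2 (\<in>) ks [NH, EH] \<longrightarrow> smul s (mtensor ks) (mtensor R) \<in> MSpan [NH, EH])"
          by (rule exI[of _ b], rule exI[of _ "[\<nu>, oneH]"])
            (use ms in \<open>auto simp: list_all2_2 smul_mtensor2 smul_oneH intro!: MSpan2I smul_NH\<close>)
      qed simp
      have step0: "smul s (Delta_ext v) z \<in> MSpan [EH, NH]" if v: "v \<in> B"
        and z: "z \<in> MSpan [EH, NH]" for s v z
      proof (rule step[OF sets(2) _ v z B1(2)[OF v]])
        fix ms assume "list_all2 (\<in>) ms [EH, NH]"
        then obtain \<nu> b where ms: "ms = [embH b, \<nu>]" "\<nu> \<in> NH" by (auto simp: list_all2_2)
        show "\<exists>b R. mtensor ms = smul s (q0 b) (mtensor R) \<and> set R \<subseteq> MH \<and> length R = 2 \<and>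
            (\<forall>ks. list_all2 (\<in>) ks [EH, NH] \<longrightarrow> smul s (mtensor ks) (mtensor R) \<in> MSpan [EH, NH])"
          by (rule exI[of _ b], rule exI[of _ "[oneH, \<nu>]"])
            (use ms in \<open>auto simp: list_all2_2 smul_mtensor2 smul_oneH intro!: MSpan2I smul_NH\<close>)
      qed simp
      have "Delta_ext (x * y) = Delta_ext x * Delta_ext y"
        unfolding Delta_ext_def by (rule hom_extension_times[OF nd_hom_Delta MHx(1,2)])
      \<comment> \<open>In a product from the right it is \<Delta>(x) that meets m first, hence the
        exchange of x and y with the side.\<close>
      then have mult: "smul s (Delta_ext (x * y)) m =
          smul s (Delta_ext (if s then x else y)) (smul s (Delta_ext (if s then y else x)) m)"
            for s m
        by (simp add: smul_def multiplier_mult_assoc)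
      have xy: "(if s then x else y) \<in> B" "(if s then y else x) \<in> B" for s
        using that by simp_all
      have "smul s (Delta_ext (x * y)) (q1 d) \<in> MSpan [NH, EH]"
        "smul s (Delta_ext (x * y)) (q0 d) \<in> MSpan [EH, NH]" for s d
        unfolding mult by (intro step1 step0 B1 xy)+
      then show ?thesis using MHx(3) unfolding B_def by blast
    qed
    show "embH a \<in> B" for a
    proof -
      \<comment> \<open>Of these four products, two lie in H \<otimes> H by the definition of a
        multiplier Hopf algebra and two by regularity.\<close>
      have "smul s (\<Delta> a) (q1 d) \<in> MSpan [EH, EH]" "smul s (\<Delta> a) (q0 d) \<in> MSpan [EH, EH]" for s d
        by (rule subsetD[OF emb2_MSpan smul_Delta_q(1)], rule
          subsetD[OF emb2_MSpan smul_Delta_q(2)])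
      moreover have "MSpan [EH, EH] \<subseteq> MSpan [NH, EH]" "MSpan [EH, EH] \<subseteq> MSpan [EH, NH]"
        by (rule MSpan_mono; use EH_NH in simp)+
      ultimately show ?thesis unfolding B_def Delta_ext_emb by
        (auto simp only: Delta_ext_emb mem_Collect_eq intro: embH_in)
    qed
    show "oneH \<in> B"
      by (auto simp: B_def Delta_ext_one smul_unit nd_tpow NH_generators intro!: MSpan2I)
    \<comment> \<open>For example (\<sigma> \<otimes> \<sigma>)(1 \<otimes> d) = \<sigma> \<otimes>
      \<sigma>d, and \<sigma>d lies in H since \<sigma> is a multiplier.\<close>
    show "\<sigma> \<in> B"
      by (auto simp: B_def Delta_ext_sigma smul_mtensor2 smul_oneH smul_embH NH_generators intro!:
        MSpan2I)
  qed
  then show "smul s (Delta_ext \<kappa>) (q1 d) \<in> MSpan [NH, EH]"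
    "smul s (Delta_ext \<kappa>) (q0 d) \<in> MSpan [EH, NH]"
    using assms by (auto simp: B_def)
qed

lemma Delta_ext_EH:
  assumes "\<kappa> \<in> EH"
  shows "smul s (Delta_ext \<kappa>) (q t d) \<in> MSpan [EH, EH]"
proof -
  obtain a where "\<kappa> = embH a" using assms by auto
  then show ?thesis using subsetD[OF emb2_MSpan smul_Delta_q(1)]
    subsetD[OF emb2_MSpan smul_Delta_q(2)]
    by (simp add: Delta_ext_emb)
qed

section \<open>Inner cofaces and codegeneracies\<close>

definition Delta_at :: "nat \<Rightarrow> nat \<Rightarrow> 'a tens \<Rightarrow> 'a tens multiplier" where
  "Delta_at p r = coproduct_at \<Delta> (p + (Suc 0 + r)) (Suc p)"

lemma Delta_at_lift: "Delta_at p r = lift (p + (Suc 0 + r)) (\<lambda>xs. mtens p (2 + r) (mtensor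
  (map embH (take p xs)))
    (mtens 2 r (\<Delta> (xs ! p)) (mtensor (map embH (drop (Suc p) xs)))))"
  unfolding Delta_at_def coproduct_at_def by simp

lemma mlin_Delta_at: "mlin (p + (Suc 0 + r)) (\<lambda>xs. mtens p (2 + r) (mtensor (map embH (take p xs)))
    (mtens 2 r (\<Delta> (xs ! p)) (mtensor (map embH (drop (Suc p) xs)))))"
proof -
  have D: "mlin (Suc 0) (\<lambda>us. \<Delta> (us ! 0))"
    by (rule mlinI) (simp_all add: clinearD[OF clinear_Delta])
  have 1: "mlin (Suc 0 + r) (\<lambda>us. mtens 2 r (\<Delta> (take (Suc 0) us ! 0)) (mtensor (map embH (drop
    (Suc 0) us))))"
    by (rule mlin_split[where P = "mpow 2" and Q = "mpow r" and \<beta> = "mtens 2 r" and h =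
      "\<lambda>us. mtensor (map embH us)", OF D _ mlin_emb])
      (simp_all add: mtensor_map_embH_in clinear_on_mtens_left clinear_on_mtens_right)
  have "mlin (p + (Suc 0 + r)) (\<lambda>xs. mtens p (2 + r) (mtensor (map embH (take p xs)))
      (mtens 2 r (\<Delta> (take (Suc 0) (drop p xs) ! 0)) (mtensor (map embH (drop (Suc 0)
        (drop p xs))))))"
    by (rule mlin_split[where P = "mpow p" and Q = "mpow (2 + r)" and \<beta> = "mtens p (2 + r)"
      and g = "\<lambda>us. mtensor (map embH us)", OF mlin_emb _ 1])
      (auto simp: mtensor_map_embH_in clinear_on_mtens_left clinear_on_mtens_right simp del:
        add_2_eq_Suc intro!: mtens_in_mpow)
  then show ?thesis
    by (rule mlin_cong) simp
qed

lemma clinear_on_Delta_at: "clinear_on (tpow3 p (Suc 0) r) (Delta_at p r)"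
  unfolding Delta_at_lift tpow3_def by (rule clinear_on_lift_mlin[OF mlin_Delta_at])

lemma Delta_at_tensor:
  assumes "length us = p" "length vs = r"
  shows "Delta_at p r (tensor (us @ x # vs)) =
    mtens3 p 2 r (emb_tens p (tensor us)) (\<Delta> x) (emb_tens r (tensor vs))"
proof -
  have "Delta_at p r (tensor (us @ x # vs)) = mtens p (2 + r) (mtensor (map embH (take p
    (us @ x # vs))))
    (mtens 2 r (\<Delta> ((us @ x # vs) ! p)) (mtensor (map embH (drop (Suc p) (us @ x # vs)))))"
    unfolding Delta_at_lift by (rule lift_tensor_mlin[OF mlin_Delta_at]) (use assms in simp)
  then show ?thesis
    using assms mtensor_embH[of us] mtensor_embH[of vs]
    by (simp add: mtens3_def nth_append)
qed

lemma Delta_at_append: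
  assumes "s \<in> tpow p" "t \<in> tpow r"
  shows "Delta_at p r (s \<odot> tensor [x] \<odot> t) = mtens3 p 2 r (emb_tens p s) (\<Delta> x) (emb_tens r t)"
proof -
  have x: "tensor [x] \<in> tpow (Suc 0)" by (simp add: tensor_in_tpow)
  note c = clinear_on_add[OF clinear_on_Delta_at append3_in_tpow3 append3_in_tpow3]
    clinear_on_scaleC[OF clinear_on_Delta_at append3_in_tpow3]
  have 1: "Delta_at p r (tensor us \<odot> tensor [x] \<odot> t) =
    mtens3 p 2 r (emb_tens p (tensor us)) (\<Delta> x) (emb_tens r t)"
    if us: "length us = p" for us
  proof (rule tpow_eqI[OF assms(2)])
    have us': "tensor us \<in> tpow p" using us by (simp add: tensor_in_tpow)
    show "clinear_on (tpow r) (\<lambda>t. Delta_at p r (tensor us \<odot> tensor [x] \<odot> t))"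
      by (rule clinear_onI) (simp_all add: append_linear c us' x tpow_add tpow_scaleC del:
        append_tensor)
    show "clinear_on (tpow r) (\<lambda>t. mtens3 p 2 r (emb_tens p (tensor us)) (\<Delta> x) (emb_tens r t))"
      by (rule clinear_on_compose[OF clinear_on_emb _ clinear_on_mtens3_right])
        (auto simp: emb_tens_in us')
  qed (use us in \<open>simp add: Delta_at_tensor\<close>)
  show ?thesis
  proof (rule tpow_eqI[OF assms(1)])
    show "clinear_on (tpow p) (\<lambda>s. Delta_at p r (s \<odot> tensor [x] \<odot> t))"
      by (rule clinear_onI) (simp_all add: append_linear c assms x)
    show "clinear_on (tpow p) (\<lambda>s. mtens3 p 2 r (emb_tens p s) (\<Delta> x) (emb_tens r t))"
      by (rule clinear_on_compose[OF clinear_on_emb _ clinear_on_mtens3_left])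
        (auto simp: emb_tens_in assms)
  qed (rule 1)
qed

lemma Delta_at_in:
  assumes "x \<in> tpow3 p (Suc 0) r"
  shows "Delta_at p r x \<in> mpow3 p 2 r"
  unfolding Delta_at_lift tpow3_def
  by (rule lift_mem[OF mlin_Delta_at csubspace_mpow _ assms[unfolded tpow3_def]])
    (auto intro!: mtens_in_mpow mtensor_map_embH_in simp del: add_2_eq_Suc)

lemma tpow3_1_eqI:
  fixes f g :: "'a tens \<Rightarrow> 'b::complex_vector"
  assumes "x \<in> tpow3 p (Suc 0) r" "clinear_on (tpow3 p (Suc 0) r) f"
    "clinear_on (tpow3 p (Suc 0) r) g"
    and "\<And>s h t. s \<in> tpow p \<Longrightarrow> t \<in> tpow r \<Longrightarrow> f (s \<odot> tensor [h] \<odot> t) = g (s \<odot> tensor [h] \<odot> t)"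
  shows "f x = g x"
  by (rule tpow3_eqI[OF assms(1-3)]) (auto elim!: tpow_1 intro: assms(4))

lemma append3_times:
  fixes s s' u u' t t' :: "'a tens"
  assumes "s \<in> tpow p" "s' \<in> tpow p" "u \<in> tpow m" "u' \<in> tpow m"
  shows "(s \<odot> u \<odot> t) * (s' \<odot> u' \<odot> t') = (s * s') \<odot> (u * u') \<odot> (t * t')"
  using assms by (simp add: append_times[of s p] append_times[of u m])

lemma tensor1_in: "tensor [h] \<in> tpow (Suc 0)" by (simp add: tensor_in_tpow)

lemma tensor1_times: "tensor [a] * tensor [b] = tensor [a * b :: 'a]" by (simp add: tensor_mult_eq)

lemma emb_tens_times: "s \<in> tpow n \<Longrightarrow> t \<in> tpow n \<Longrightarrow> emb_tens n s * emb_tens n t =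
  emb_tens n (s * t :: 'a tens)"
  by (simp add: times_emb nd_tpow emb_tens_in lmul_emb)

lemma tpow3_times: "x \<in> tpow3 p m r \<Longrightarrow> y \<in> tpow3 p m r \<Longrightarrow> x * y \<in> (tpow3 p m r :: 'a tens set)"
  by (rule nd_algebraD(2)[OF nd_tpow3])

lemma mpow3_distrib:
  fixes a b c :: "'a tens multiplier"
  assumes "a \<in> mpow3 p m r" "b \<in> mpow3 p m r" "c \<in> mpow3 p m r"
  shows "(a + b) * c = a * c + b * c" "c * (a + b) = c * a + c * b"
  using mpow_distrib[OF assms[unfolded tpow3_def]] by simp_all

lemma mpow3_scale_times:
  fixes a c :: "'a tens multiplier"
  assumes "a \<in> mpow3 p m r" "c \<in> mpow3 p m r"
  shows "(k *\<^sub>C a) * c = k *\<^sub>C (a * c)" "c * (k *\<^sub>C a) = k *\<^sub>C (c * a)"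
  using mpow_scale_times[OF assms[unfolded tpow3_def]] by simp_all

lemma Delta_at_times:
  assumes "x \<in> tpow3 p (Suc 0) r" "y \<in> tpow3 p (Suc 0) r"
  shows "Delta_at p r (x * y) = Delta_at p r x * Delta_at p r y"
proof -
  note L = clinear_onD[OF clinear_on_Delta_at] distrib_left distrib_right
    mult_scaleC_left mult_scaleC_right mpow3_distrib[OF Delta_at_in Delta_at_in Delta_at_in]
      mpow3_scale_times[OF Delta_at_in Delta_at_in]
  have 1: "Delta_at p r ((s \<odot> tensor [h] \<odot> t) * y) =
    Delta_at p r (s \<odot> tensor [h] \<odot> t) * Delta_at p r y"
    if st: "s \<in> tpow p" "t \<in> tpow r" for s t :: "'a tens" and h
  proof (rule tpow3_1_eqI[OF assms(2)])
    have i: "s \<odot> tensor [h] \<odot> t \<in> tpow3 p (Suc 0) r" by (intro append3_in_tpow3 st tensor1_in)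
    show "clinear_on (tpow3 p (Suc 0) r) (\<lambda>y. Delta_at p r ((s \<odot> tensor [h] \<odot> t) * y))"
      by (rule clinear_onI) (simp_all add: L tpow3_times i)
    show "clinear_on (tpow3 p (Suc 0) r) (\<lambda>y. Delta_at p r (s \<odot> tensor [h] \<odot> t) * Delta_at p r y)"
      by (rule clinear_onI) (simp_all add: L tpow3_times i)
    fix s' t' :: "'a tens" and h' assume "s' \<in> tpow p" "t' \<in> tpow r"
    then show "Delta_at p r ((s \<odot> tensor [h] \<odot> t) * (s' \<odot> tensor [h'] \<odot> t')) =
      Delta_at p r (s \<odot> tensor [h] \<odot> t) * Delta_at p r (s' \<odot> tensor [h'] \<odot> t')"
      using st by (simp add: append3_times[of _ p _ _ "Suc 0"] tensor1_in tensor1_times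
        Delta_at_append mtens3_times emb_tens_in
         times_in_tpow emb_tens_times Delta_times)
  qed
  show ?thesis
  proof (rule tpow3_1_eqI[OF assms(1)])
    show "clinear_on (tpow3 p (Suc 0) r) (\<lambda>x. Delta_at p r (x * y))"
      by (rule clinear_onI) (simp_all add: L tpow3_times assms)
    show "clinear_on (tpow3 p (Suc 0) r) (\<lambda>x. Delta_at p r x * Delta_at p r y)"
      by (rule clinear_onI) (simp_all add: L tpow3_times assms)
  qed (rule 1)
qed

text \<open>The spanning conditions hold blockwise: \<Delta> is non-degenerate in the middle, and in
  the outer blocks, where the map is the inclusion, they are idempotence of the tensor
  powers.\<close>

lemma nd_hom_Delta_at: "nd_hom (tpow3 p (Suc 0) r) (tpow3 p 2 r) (Delta_at p r)"
proof -
  have "tpow3 p 2 r \<subseteq> cspan {lmul (Delta_at p r x) w |x w. x \<in> tpow3 p (Suc 0) r \<and> w \<in> tpow3 p 2 r}"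
  proof (rule tpow3_append_span[OF idempotent_tpow Delta_span(1) idempotent_tpow])
    fix s u t :: "'a tens" assume "s \<in> tpow_products p"
      "u \<in> {lmul (\<Delta> x) w |x w. x \<in> UNIV \<and> w \<in> tpow 2}" "t \<in> tpow_products r"
    then obtain s1 s2 x w t1 t2 where *: "s = s1 * s2" "u = lmul (\<Delta> x) w" "t = t1 * t2"
      "s1 \<in> tpow p" "s2 \<in> tpow p" "w \<in> tpow 2" "t1 \<in> tpow r" "t2 \<in> tpow r" by
        (auto simp: tpow_products_def)
    then have "s \<odot> u \<odot> t = lmul (Delta_at p r (s1 \<odot> tensor [x] \<odot> t1)) (s2 \<odot> w \<odot> t2)"
      by (simp add: Delta_at_append lmul_mtens3 emb_tens_in lmul_emb)
    moreover have "s1 \<odot> tensor [x] \<odot> t1 \<in> tpow3 p (Suc 0) r" "s2 \<odot> w \<odot> t2 \<in> tpow3 p 2 r"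
      by (intro append3_in_tpow3 * tensor1_in)+
    ultimately show "s \<odot> u \<odot> t \<in> {lmul (Delta_at p r x) w |x w. x \<in> tpow3 p (Suc 0) r \<and> w \<in>
      tpow3 p 2 r}" by blast
  qed
  moreover have "tpow3 p 2 r \<subseteq> cspan {rmul (Delta_at p r x) w |x w. x \<in> tpow3 p (Suc 0) r \<and> w \<in>
    tpow3 p 2 r}"
  proof (rule tpow3_append_span[OF idempotent_tpow Delta_span(2) idempotent_tpow])
    fix s u t :: "'a tens" assume "s \<in> tpow_products p"
      "u \<in> {rmul (\<Delta> x) w |x w. x \<in> UNIV \<and> w \<in> tpow 2}" "t \<in> tpow_products r"
    then obtain s1 s2 x w t1 t2 where *: "s = s1 * s2" "u = rmul (\<Delta> x) w" "t = t1 * t2"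
      "s1 \<in> tpow p" "s2 \<in> tpow p" "w \<in> tpow 2" "t1 \<in> tpow r" "t2 \<in> tpow r" by
        (auto simp: tpow_products_def)
    \<comment> \<open>Multiplication from the right takes the second factors \<open>s2\<close> and
      \<open>t2\<close> of the outer products into the argument of the map.\<close>
    then have "s \<odot> u \<odot> t = rmul (Delta_at p r (s2 \<odot> tensor [x] \<odot> t2)) (s1 \<odot> w \<odot> t1)"
      by (simp add: Delta_at_append rmul_mtens3 emb_tens_in rmul_emb)
    moreover have "s2 \<odot> tensor [x] \<odot> t2 \<in> tpow3 p (Suc 0) r" "s1 \<odot> w \<odot> t1 \<in> tpow3 p 2 r"
      by (intro append3_in_tpow3 * tensor1_in)+
    ultimately show "s \<odot> u \<odot> t \<in> {rmul (Delta_at p r x) w |x w. x \<in> tpow3 p (Suc 0) r \<and> w \<in>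
      tpow3 p 2 r}" by blast
  qed
  ultimately show ?thesis
    unfolding nd_hom_def by (auto simp: nd_tpow3 Delta_at_in clinear_on_Delta_at Delta_at_times)
qed

definition coface_ext :: "nat \<Rightarrow> nat \<Rightarrow> 'a tens multiplier \<Rightarrow> 'a tens multiplier" where
  "coface_ext p r = hom_extension (tpow3 p (Suc 0) r) (tpow3 p 2 r) (Delta_at p r)"

lemma lmul_linear:
  assumes "m \<in> multipliers A"
  shows "x \<in> A \<Longrightarrow> y \<in> A \<Longrightarrow> lmul m (x + y) = lmul m x + lmul m y" "x \<in> A \<Longrightarrow> lmul m (c *\<^sub>C x) =
    c *\<^sub>C lmul m x"
  using multipliersD(3)[OF assms] by (simp_all add: clinear_on_def)

lemma mtensor1_in: "c \<in> MH \<Longrightarrow> mtensor [c] \<in> mpow (Suc 0)"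
  by (rule mtensor_in_mpow) auto

lemma lmul_mtensor1: "c \<in> MH \<Longrightarrow> lmul (mtensor [c]) (tensor [x]) = tensor [lmul c x]"
  by (simp add: lmul_mtensor)

text \<open>The working formula for the extended coface. It covers c = 1 and c in N(H), and lets
  test tensors and the results of multiplying by them be treated alike. The proof checks the
  candidate on the vectors d(x)w for elementary x and w.\<close>

lemma coface_ext_mtens3:
  assumes X: "X \<in> mpow p" and c: "c \<in> MH" and Z: "Z \<in> mpow r"
  shows "coface_ext p r (mtens3 p (Suc 0) r X (mtensor [c]) Z) = mtens3 p 2 r X (Delta_ext c) Z"
  unfolding coface_ext_def
proof (rule hom_extension_eqI[OF nd_hom_Delta_at])
  let ?y = "mtens3 p (Suc 0) r X (mtensor [c]) Z" and ?z = "mtens3 p 2 r X (Delta_ext c) Z"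
  show y: "?y \<in> mpow3 p (Suc 0) r" by (intro mtens3_in X Z mtensor1_in c)
  show z: "?z \<in> mpow3 p 2 r" by (intro mtens3_in X Z Delta_ext_in c)
  note L = clinear_onD[OF clinear_on_Delta_at] lmul_linear[OF z] lmul_linear[OF y]
    lmul_linear[OF Delta_at_in] multipliersD(1)[OF Delta_at_in] multipliersD(1)[OF y]
      multipliersD(1)[OF z]
  have 1: "lmul ?z (lmul (Delta_at p r (s \<odot> tensor [h] \<odot> t)) w) =
    lmul (Delta_at p r (lmul ?y (s \<odot> tensor [h] \<odot> t))) w"
    if st: "s \<in> tpow p" "t \<in> tpow r" and w: "w \<in> tpow3 p 2 r" for s t w :: "'a tens" and h
  proof (rule tpow3_eqI[OF w])
    have i: "s \<odot> tensor [h] \<odot> t \<in> tpow3 p (Suc 0) r" by (intro append3_in_tpow3 st tensor1_in)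
    show "clinear_on (tpow3 p 2 r) (\<lambda>w. lmul ?z (lmul (Delta_at p r (s \<odot> tensor [h] \<odot> t)) w))"
      "clinear_on (tpow3 p 2 r) (\<lambda>w. lmul (Delta_at p r (lmul ?y (s \<odot> tensor [h] \<odot> t))) w)"
      by (rule clinear_onI; simp add: L i)+
    fix w1 w2 w3 :: "'a tens" assume w: "w1 \<in> tpow p" "w2 \<in> tpow 2" "w3 \<in> tpow r"
    have "lmul (Delta_ext c) (lmul (\<Delta> h) w2) = lmul (\<Delta> (lmul c h)) w2"
      unfolding Delta_ext_def by (rule lmul_hom_extension[OF nd_hom_Delta c UNIV_I w(2)])
    then show "lmul ?z (lmul (Delta_at p r (s \<odot> tensor [h] \<odot> t)) (w1 \<odot> w2 \<odot> w3)) =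
        lmul (Delta_at p r (lmul ?y (s \<odot> tensor [h] \<odot> t))) (w1 \<odot> w2 \<odot> w3)"
      using st w X Z c
      by (simp add: Delta_at_append lmul_mtens3 emb_tens_in lmul_emb times_in_tpow
        multipliersD(1)[OF Delta_in] multipliersD(1)[OF X]
          multipliersD(1)[OF Z] mtensor1_in tensor1_in lmul_mtensor1 multipliersD(7)[OF X]
            multipliersD(7)[OF Z])
  qed
  fix x w :: "'a tens" assume x: "x \<in> tpow3 p (Suc 0) r" and w: "w \<in> tpow3 p 2 r"
  show "lmul ?z (lmul (Delta_at p r x) w) = lmul (Delta_at p r (lmul ?y x)) w"
  proof (rule tpow3_1_eqI[OF x])
    show "clinear_on (tpow3 p (Suc 0) r) (\<lambda>x. lmul ?z (lmul (Delta_at p r x) w))"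
      "clinear_on (tpow3 p (Suc 0) r) (\<lambda>x. lmul (Delta_at p r (lmul ?y x)) w)"
      by (rule clinear_onI; simp add: L w)+
  qed (rule 1[OF _ _ w])
qed

section \<open>The counit applied to one factor\<close>

definition eps_at :: "nat \<Rightarrow> nat \<Rightarrow> 'a tens \<Rightarrow> 'a tens" where
  "eps_at p r = codegeneracy \<epsilon> (p + (Suc 0 + r)) (Suc p)"

lemma eps_at_lift: "eps_at p r = lift (p + (Suc 0 + r)) (\<lambda>xs. \<epsilon> (xs ! p) *\<^sub>C tensor
  (take p xs @ drop (Suc p) xs))"
  unfolding eps_at_def codegeneracy_def by simp

lemma mlin_eps_at: "mlin (p + (Suc 0 + r)) (\<lambda>xs. \<epsilon> (xs ! p) *\<^sub>C tensor (take p xs @ drop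
  (Suc p) xs))"
proof -
  have tens: "mlin n (tensor :: 'a list \<Rightarrow> _)" for n
    by (rule mlinI) (simp_all add: tensor_add tensor_scaleC)
  have D: "mlin (Suc 0) (\<lambda>us. \<epsilon> (us ! 0))"
    by (rule mlinI) (simp_all add: eps_linear scaleC_complex_def)
  have 1: "mlin (Suc 0 + r) (\<lambda>us. \<epsilon> (take (Suc 0) us ! 0) *\<^sub>C tensor (drop (Suc 0) us))"
    by (rule mlin_split[where P = UNIV and Q = UNIV and \<beta> = scaleC and h = tensor, OF D _ tens])
      (auto simp: clinear_on_def scaleC_add_left scaleC_add_right scaleC_scaleC scaleC_complex_def
        mult.commute)
  have "mlin (p + (Suc 0 + r)) (\<lambda>xs. tensor (take p xs) \<odot> (\<epsilon> (take (Suc 0)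
    (drop p xs) ! 0) *\<^sub>C tensor (drop (Suc 0) (drop p xs))))"
    by (rule mlin_split[where P = UNIV and Q = UNIV and \<beta> = tens_append and g =
      tensor, OF tens _ 1])
      (auto simp: clinear_imp_clinear_on clinear_append_left clinear_append_right)
  then show ?thesis
    by (rule mlin_cong) (simp add: append_linear)
qed

lemma clinear_on_eps_at: "clinear_on (tpow3 p (Suc 0) r) (eps_at p r)"
  unfolding eps_at_lift tpow3_def by (rule clinear_on_lift_mlin[OF mlin_eps_at])

lemma eps_at_tensor:
  assumes "length us = p" "length vs = r"
  shows "eps_at p r (tensor (us @ x # vs)) = \<epsilon> x *\<^sub>C tensor (us @ vs)"
proof -
  have "eps_at p r (tensor (us @ x # vs)) = \<epsilon> ((us @ x # vs) ! p) *\<^sub>C tensor (take p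
    (us @ x # vs) @ drop (Suc p) (us @ x # vs))"
    unfolding eps_at_lift by (rule lift_tensor_mlin[OF mlin_eps_at]) (use assms in simp)
  then show ?thesis using assms by (simp add: nth_append)
qed

lemma eps_at_append:
  assumes "s \<in> tpow p" "t \<in> tpow r"
  shows "eps_at p r (s \<odot> tensor [x] \<odot> t) = \<epsilon> x *\<^sub>C (s \<odot> t)"
proof -
  note c = clinear_on_add[OF clinear_on_eps_at append3_in_tpow3 append3_in_tpow3]
    clinear_on_scaleC[OF clinear_on_eps_at append3_in_tpow3]
  have 1: "eps_at p r (tensor us \<odot> tensor [x] \<odot> t) = \<epsilon> x *\<^sub>C (tensor us \<odot> t)" if us: "length us =
    p" for us
  proof (rule tpow_eqI[OF assms(2)])
    have us': "tensor us \<in> tpow p" using us by (simp add: tensor_in_tpow)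
    show "clinear_on (tpow r) (\<lambda>t. eps_at p r (tensor us \<odot> tensor [x] \<odot> t))"
      by (rule clinear_onI) (simp_all add: append_linear c us' tensor1_in tpow_add tpow_scaleC
        del: append_tensor)
    show "clinear_on (tpow r) (\<lambda>t. \<epsilon> x *\<^sub>C (tensor us \<odot> t))"
      by (rule clinear_onI) (simp_all add: append_linear scaleC_add_right scaleC_scaleC
        mult.commute)
  qed (use us in \<open>simp add: eps_at_tensor\<close>)
  show ?thesis
  proof (rule tpow_eqI[OF assms(1)])
    show "clinear_on (tpow p) (\<lambda>s. eps_at p r (s \<odot> tensor [x] \<odot> t))"
      by (rule clinear_onI) (simp_all add: append_linear c assms tensor1_in)
    show "clinear_on (tpow p) (\<lambda>s. \<epsilon> x *\<^sub>C (s \<odot> t))"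
      by (rule clinear_onI) (simp_all add: append_linear scaleC_add_right scaleC_scaleC
        mult.commute)
  qed (rule 1)
qed

lemma eps_at_in:
  assumes "x \<in> tpow3 p (Suc 0) r"
  shows "eps_at p r x \<in> tpow (p + r)"
  unfolding eps_at_lift
  by (rule lift_mem[OF mlin_eps_at csubspace_tpow _ assms[unfolded tpow3_def]])
    (auto intro!: tpow_scaleC tensor_in_tpow)

lemma eps_at_times:
  assumes "x \<in> tpow3 p (Suc 0) r" "y \<in> tpow3 p (Suc 0) r"
  shows "eps_at p r (x * y) = eps_at p r x * eps_at p r y"
proof -
  note L = clinear_onD[OF clinear_on_eps_at] distrib_left distrib_right
    mult_scaleC_left mult_scaleC_right
  have 1: "eps_at p r ((s \<odot> tensor [h] \<odot> t) * y) = eps_at p r (s \<odot> tensor [h] \<odot> t) * eps_at p r y"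
    if st: "s \<in> tpow p" "t \<in> tpow r" for s t :: "'a tens" and h
  proof (rule tpow3_1_eqI[OF assms(2)])
    have i: "s \<odot> tensor [h] \<odot> t \<in> tpow3 p (Suc 0) r" by (intro append3_in_tpow3 st tensor1_in)
    show "clinear_on (tpow3 p (Suc 0) r) (\<lambda>y. eps_at p r ((s \<odot> tensor [h] \<odot> t) * y))"
      "clinear_on (tpow3 p (Suc 0) r) (\<lambda>y. eps_at p r (s \<odot> tensor [h] \<odot> t) * eps_at p r y)"
      by (rule clinear_onI; simp add: L tpow3_times i)+
    fix s' t' :: "'a tens" and h' assume "s' \<in> tpow p" "t' \<in> tpow r"
    then show "eps_at p r ((s \<odot> tensor [h] \<odot> t) * (s' \<odot> tensor [h'] \<odot> t')) =
      eps_at p r (s \<odot> tensor [h] \<odot> t) * eps_at p r (s' \<odot> tensor [h'] \<odot> t')"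
      using st by (simp add: append3_times[of _ p _ _ "Suc 0"] tensor1_in tensor1_times
        eps_at_append
         times_in_tpow eps_hom(2) mult_scaleC_left mult_scaleC_right scaleC_scaleC mult.commute)
        (simp add: append_times[of s p])
  qed
  show ?thesis
  proof (rule tpow3_1_eqI[OF assms(1)])
    show "clinear_on (tpow3 p (Suc 0) r) (\<lambda>x. eps_at p r (x * y))"
      "clinear_on (tpow3 p (Suc 0) r) (\<lambda>x. eps_at p r x * eps_at p r y)"
      by (rule clinear_onI; simp add: L tpow3_times assms)+
  qed (rule 1)
qed

text \<open>Inserting an element of counit 1 between s and t gives a preimage of their
  concatenation.\<close>

lemma eps_at_surj: "tpow (p + r) \<subseteq> eps_at p r ` tpow3 p (Suc 0) r"
proof
  fix t :: "'a tens" assume t: "t \<in> tpow (p + r)"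
  obtain u where u: "\<epsilon> u = 1" by (rule counit_nonzero)
  show "t \<in> eps_at p r ` tpow3 p (Suc 0) r"
  proof (rule tpow_append_memI[OF t, of "\<lambda>x. x"])
    show "csubspace (eps_at p r ` tpow3 p (Suc 0) r)"
      by (rule csubspace_image[OF clinear_on_eps_at csubspace_tpow3])
    show "s \<odot> t \<in> eps_at p r ` tpow3 p (Suc 0) r" if "s \<in> tpow p" "t \<in> tpow r" for s t :: "'a tens"
      by (rule rev_image_eqI[of "s \<odot> tensor [u] \<odot> t"])
        (use that in \<open>auto simp: eps_at_append u scaleC_one intro!: append3_in_tpow3 tensor1_in\<close>)
  qed (simp_all add: clinear_on_def)
qed

text \<open>The counit map has values in tensors; they are embedded so that the general extension of
  multiplier-valued homomorphisms applies.\<close>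

definition eps_at_mult :: "nat \<Rightarrow> nat \<Rightarrow> 'a tens \<Rightarrow> 'a tens multiplier" where
  "eps_at_mult p r x = emb_tens (p + r) (eps_at p r x)"

text \<open>By surjectivity every product ab in the target has one factor in the image, and products
  span by idempotence.\<close>

lemma nd_hom_eps_at: "nd_hom (tpow3 p (Suc 0) r) (tpow (p + r)) (eps_at_mult p r)"
proof -
  have l: "tpow_products (p + r) \<subseteq> {lmul (eps_at_mult p r x) w |x w. x \<in> tpow3 p (Suc 0) r \<and> w \<in>
    tpow (p + r)}"
  proof clarify
    fix z :: "'a tens" assume "z \<in> tpow_products (p + r)"
    then obtain a b where z: "z = a * b" "a \<in> tpow (p + r)" "b \<in> tpow (p + r)" by
      (auto simp: tpow_products_def)
    then obtain x where "x \<in> tpow3 p (Suc 0) r" "a = eps_at p r x" using eps_at_surj by blast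
    with z show "\<exists>x w. z = lmul (eps_at_mult p r x) w \<and> x \<in> tpow3 p (Suc 0) r \<and> w \<in> tpow (p + r)"
      by (intro exI[of _ x] exI[of _ b]) (simp add: eps_at_mult_def lmul_emb)
  qed
  have r: "tpow_products (p + r) \<subseteq> {rmul (eps_at_mult p r x) w |x w. x \<in> tpow3 p (Suc 0) r \<and> w \<in>
    tpow (p + r)}"
  proof clarify
    fix z :: "'a tens" assume "z \<in> tpow_products (p + r)"
    then obtain a b where z: "z = b * a" "a \<in> tpow (p + r)" "b \<in> tpow (p + r)" by
      (auto simp: tpow_products_def)
    then obtain x where "x \<in> tpow3 p (Suc 0) r" "a = eps_at p r x" using eps_at_surj by blast
    with z show "\<exists>x w. z = rmul (eps_at_mult p r x) w \<and> x \<in> tpow3 p (Suc 0) r \<and> w \<in> tpow (p + r)"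
      by (intro exI[of _ x] exI[of _ b]) (simp add: eps_at_mult_def rmul_emb)
  qed
  have "tpow (p + r) \<subseteq> cspan {lmul (eps_at_mult p r x) w |x w. x \<in> tpow3 p (Suc 0) r \<and> w \<in> tpow
    (p + r)}"
    "tpow (p + r) \<subseteq> cspan {rmul (eps_at_mult p r x) w |x w. x \<in> tpow3 p (Suc 0) r \<and> w \<in> tpow
      (p + r)}"
    by (rule order_trans[OF idempotent_tpow cspan_mono[OF l]]
      order_trans[OF idempotent_tpow cspan_mono[OF r]])+
  moreover have "clinear_on (tpow3 p (Suc 0) r) (eps_at_mult p r)"
    unfolding eps_at_mult_def[abs_def] by (rule
      clinear_on_compose[OF clinear_on_eps_at _ clinear_on_emb]) (auto simp: eps_at_in)
  ultimately show ?thesis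
    unfolding nd_hom_def by (auto simp: nd_tpow3 nd_tpow eps_at_mult_def emb_tens_in eps_at_in
      eps_at_times emb_tens_times)
qed

definition codeg_ext :: "nat \<Rightarrow> nat \<Rightarrow> 'a tens multiplier \<Rightarrow> 'a tens multiplier" where
  "codeg_ext p r = hom_extension (tpow3 p (Suc 0) r) (tpow (p + r)) (eps_at_mult p r)"

lemma codeg_ext_in: "y \<in> mpow3 p (Suc 0) r \<Longrightarrow> codeg_ext p r y \<in> mpow (p + r)"
  unfolding codeg_ext_def by (rule hom_extension_in_multipliers[OF nd_hom_eps_at])

text \<open>The general extension gives these identities only after multiplication by an arbitrary
  w, because its homomorphism is multiplier-valued. Cancelling w yields the form that
  \<open>extends_codegeneracy\<close> demands.\<close>

lemma codeg_ext_eps_at: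
  assumes y: "y \<in> mpow3 p (Suc 0) r" and x: "x \<in> tpow3 p (Suc 0) r"
  shows "lmul (codeg_ext p r y) (eps_at p r x) = eps_at p r (lmul y x)"
    "rmul (codeg_ext p r y) (eps_at p r x) = eps_at p r (rmul y x)"
proof -
  have h: "hom_extends_to (tpow3 p (Suc 0) r) (tpow (p + r)) (eps_at_mult p r) y (codeg_ext p r y)"
    unfolding codeg_ext_def by (rule hom_extends_hom_extension[OF nd_hom_eps_at y])
  note i = eps_at_in[OF x] eps_at_in[OF multipliersD(1)[OF y x]]
    eps_at_in[OF multipliersD(2)[OF y x]] codeg_ext_in[OF y]
  show "lmul (codeg_ext p r y) (eps_at p r x) = eps_at p r (lmul y x)"
  proof (rule nd_cancel_right[OF nd_tpow cspan_self])
    fix w :: "'a tens" assume w: "w \<in> tpow (p + r)"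
    then have "lmul (codeg_ext p r y) (eps_at p r x * w) = eps_at p r (lmul y x) * w"
      using h x by (simp add: hom_extends_to_def eps_at_mult_def lmul_emb)
    then show "lmul (codeg_ext p r y) (eps_at p r x) * w = eps_at p r (lmul y x) * w"
      using i w by (simp add: multipliersD(7))
  qed (use i in \<open>auto simp: multipliersD(1)\<close>)
  show "rmul (codeg_ext p r y) (eps_at p r x) = eps_at p r (rmul y x)"
  proof (rule nd_cancel_left[OF nd_tpow cspan_self])
    fix w :: "'a tens" assume w: "w \<in> tpow (p + r)"
    then have "rmul (codeg_ext p r y) (w * eps_at p r x) = w * eps_at p r (rmul y x)"
      using h x by (simp add: hom_extends_to_def eps_at_mult_def rmul_emb)
    then show "w * rmul (codeg_ext p r y) (eps_at p r x) = w * eps_at p r (rmul y x)"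
      using i w by (simp add: multipliersD(8))
  qed (use i in \<open>auto simp: multipliersD(2)\<close>)
qed

text \<open>Evaluate at s \<otimes> u \<otimes> t with \<epsilon>(u) = 1, which maps to s \<otimes>
  t: the middle factor becomes au, and \<epsilon>(au) = \<epsilon>(a).\<close>

lemma codeg_ext_mtens3:
  assumes X: "X \<in> mpow p" and Z: "Z \<in> mpow r"
  shows "codeg_ext p r (mtens3 p (Suc 0) r X (mtensor [embH a]) Z) = \<epsilon> a *\<^sub>C mtens p r X Z"
proof (rule mpow_append_eqI)
  let ?y = "mtens3 p (Suc 0) r X (mtensor [embH a]) Z"
  have y: "?y \<in> mpow3 p (Suc 0) r" by (intro mtens3_in X Z mtensor1_in embH_in)
  show "codeg_ext p r ?y \<in> mpow (p + r)" by (rule codeg_ext_in[OF y])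
  show "\<epsilon> a *\<^sub>C mtens p r X Z \<in> mpow (p + r)" by (intro mpow_scaleC mtens_in_mpow X Z)
  obtain u where u: "\<epsilon> u = 1" by (rule counit_nonzero)
  fix s t :: "'a tens" assume st: "s \<in> tpow p" "t \<in> tpow r"
  have "lmul (codeg_ext p r ?y) (eps_at p r (s \<odot> tensor [u] \<odot> t)) =
    eps_at p r (lmul ?y (s \<odot> tensor [u] \<odot> t))"
    by (rule codeg_ext_eps_at[OF y append3_in_tpow3[OF st(1) tensor1_in st(2)]])
  then show "lmul (codeg_ext p r ?y) (s \<odot> t) = lmul (\<epsilon> a *\<^sub>C mtens p r X Z) (s \<odot> t)"
    using st X Z
    by (simp add: eps_at_append u scaleC_one lmul_mtens3 mtensor1_in tensor1_in lmul_mtensor1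
      lmul_emb multipliersD(1)[OF X]
      multipliersD(1)[OF Z] eps_hom(2) lmul_mtens)
qed

section \<open>The spaces of multipliers\<close>

text \<open>The test tensors of \<open>M0\<close>, with the position of the 1 encoded by the two
  lists around it instead of by an index.\<close>

abbreviation slot :: "'a list \<Rightarrow> 'a list \<Rightarrow> 'a tens multiplier" where
  "slot as bs \<equiv> mtensor (map embH as @ oneH # map embH bs)"

abbreviation slot_sets :: "nat \<Rightarrow> nat \<Rightarrow> 'a multiplier set list" where
  "slot_sets p r \<equiv> replicate p EH @ NH # replicate r EH"

lemma replicate_Suc_middle: "replicate (k + Suc r) x = replicate k x @ x # replicate r x"
  by (simp add: replicate_app_Cons_same flip: replicate_add)

lemma slot_sets_MH: "set (slot_sets p r) \<subseteq> Pow MH"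
  using NH_MH by auto

lemma N_slot_eq:
  assumes "n = p + Suc r"
  shows "N_slot \<sigma> n (Suc p) = MSpan (slot_sets p r)"
proof -
  have "{mtensor ((map embH as)[Suc p - 1 := \<nu>]) |as \<nu>. length as = n \<and> \<nu> \<in> NH} =
      {mtensor ms |ms. list_all2 (\<in>) ms (slot_sets p r)}" (is "?L = ?R")
  proof (intro equalityI subsetI)
    fix z assume "z \<in> ?L"
    then obtain as \<nu> where z: "z = mtensor ((map embH as)[p := \<nu>])" "length as = p + Suc r" "\<nu> \<in> NH"
      using assms by auto
    obtain us a vs where as: "as = us @ a # vs" "length us = p" "length vs = r"
      using split_at_nth[OF z(2)] by metis
    have "list_all2 (\<in>) (map embH us @ \<nu> # map embH vs) (slot_sets p r)"
      using z(3) as by (auto intro!: list_all2_appendI simp: list_all2_replicate_EH)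
    moreover have "z = mtensor (map embH us @ \<nu> # map embH vs)"
      using z(1) as by (simp add: list_update_append)
    ultimately show "z \<in> ?R" by blast
  next
    fix z assume "z \<in> ?R"
    then obtain us \<nu> vs where z: "z = mtensor (map embH us @ \<nu> # map embH vs)" "length us = p"
      "length vs = r" "\<nu> \<in> NH"
      by (auto simp: list_all2_append2 list_all2_Cons2 list_all2_replicate_EH)
    \<comment> \<open>The arbitrary entry only holds the place that the update overwrites with
      \<nu>.\<close>
    then have "z = mtensor ((map embH (us @ undefined # vs))[Suc p - 1 := \<nu>])"
      "length (us @ undefined # vs) = n"
      using assms by (simp_all add: list_update_append)
    then show "z \<in> ?L" using z(4) by blast
  qed
  then show ?thesis by (simp add: N_slot_def MSpan_def)
qed

text \<open>The form in which membership is used: the two sides are merged into \<open>smul\<close>,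
  and the index i is replaced by the lists before and after the 1.\<close>

lemma M0_iff:
  "z \<in> M0 \<sigma> n \<longleftrightarrow> z \<in> mpow n \<and> (\<forall>s as bs. length as + Suc (length bs) = n \<longrightarrow>
     smul s z (slot as bs) \<in> MSpan (slot_sets (length as) (length bs)))"
proof (intro iffI conjI allI impI)
  assume z: "z \<in> M0 \<sigma> n"
  then show "z \<in> mpow n" by (simp add: M0_def)
  fix s and as bs :: "'a list" assume n: "length as + Suc (length bs) = n"
  let ?as = "as @ undefined # bs"
  have "\<forall>i\<in>{1..n}. \<forall>as. length as = n \<longrightarrow>
      z * mtensor ((map embH as)[i - 1 := oneH]) \<in> N_slot \<sigma> n i \<and> mtensor
        ((map embH as)[i - 1 := oneH]) * z \<in> N_slot \<sigma> n i"
    using z unfolding M0_def Let_def mem_Collect_eq by (rule conjunct2)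
  moreover have "Suc (length as) \<in> {1..n}" "length ?as = n" using n by auto
  moreover have "(map embH ?as)[Suc (length as) - 1 := oneH] = map embH as @ oneH # map embH bs"
    by (simp add: list_update_append)
  ultimately have "z * slot as bs \<in> N_slot \<sigma> n (Suc (length as)) \<and> slot as bs * z \<in> N_slot \<sigma> n
    (Suc (length as))"
    by metis
  then show "smul s z (slot as bs) \<in> MSpan (slot_sets (length as) (length bs))"
    using n by (auto simp: smul_def N_slot_eq[of n "length as" "length bs"])
next
  assume z: "z \<in> mpow n \<and> (\<forall>s as bs. length as + Suc (length bs) = n \<longrightarrow>
     smul s z (slot as bs) \<in> MSpan (slot_sets (length as) (length bs)))"
  show "z \<in> M0 \<sigma> n"
    unfolding M0_def Let_def
  proof (intro CollectI conjI ballI allI impI)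
    show "z \<in> mpow n" using z by simp
    fix i and as :: "'a list" assume "i \<in> {1..n}" and as: "length as = n"
    then obtain p where i: "i = Suc p" and p: "p < n" by (cases i) auto
    then have "length as = p + Suc (n - Suc p)" using as by simp
    then obtain us a vs where as: "as = us @ a # vs" "length us = p" "length vs = n - Suc p"
      using split_at_nth by metis
    have *: "(map embH as)[i - 1 := oneH] = map embH us @ oneH # map embH vs"
      using as i by (simp add: list_update_append)
    have "smul s z (slot us vs) \<in> N_slot \<sigma> n i" for s
    proof -
      have "length us + Suc (length vs) = n" using as p by simp
      then have "smul s z (slot us vs) \<in> MSpan (slot_sets (length us) (length vs))" using z by blast
      then show ?thesis using N_slot_eq[of n p "n - Suc p"] as p i by simp
    qed
    from this[of True] this[of False]
    show "z * mtensor ((map embH as)[i - 1 := oneH]) \<in> N_slot \<sigma> n i"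
      "mtensor ((map embH as)[i - 1 := oneH]) * z \<in> N_slot \<sigma> n i"
      unfolding * by (simp_all add: smul_def)
  qed
qed

lemmas M0_mpow = M0_iff[THEN iffD1, THEN conjunct1]

lemma M0_slot:
  assumes "z \<in> M0 \<sigma> n" "length as + Suc (length bs) = n" "length as = p" "length bs = r"
  shows "smul s z (slot as bs) \<in> MSpan (slot_sets p r)"
  using assms unfolding M0_iff by blast

lemma slot_in: "length as + Suc (length bs) = n \<Longrightarrow> slot as bs \<in> mpow n"
  by (rule mtensor_in_mpow) auto

text \<open>The multiplicativity argument, common to all positions of the 1. \<open>V\<close> stands
  in the two slots of the coproduct; \<open>C\<close> contains the c with V in the span of the
  \<Delta>(c)Q, with Q in \<open>\<Q>\<close>. Multiplying y by X \<otimes> c \<otimes> Z puts its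
  middle factor into \<open>K\<close>, and \<Delta>(K) times Q lies in the spaces \<open>Ls\<close>
  of the two slots.\<close>

lemma coface_ext_slot:
  assumes y: "y \<in> mpow3 p (Suc 0) r" and X: "X \<in> mpow p" and Z: "Z \<in> mpow r"
    and V: "V \<in> cspan {smul s (Delta_ext c) Q |c Q. c \<in> C \<and> Q \<in> \<Q>}" and C: "C \<subseteq> MH"
      and \<Q>: "\<Q> \<subseteq> mpow 2"
    and As: "set As \<subseteq> Pow MH" "length As = p" and Bs: "set Bs \<subseteq> Pow MH" "length Bs = r"
    and K: "K \<subseteq> MH" and Ls: "set Ls \<subseteq> Pow MH" "length Ls = 2"
    and yc: "\<And>c. c \<in> C \<Longrightarrow> smul s y (mtens3 p (Suc 0) r X (mtensor [c]) Z) \<in> MSpan (As @ K # Bs)"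
    and KQ: "\<And>\<kappa> Q. \<kappa> \<in> K \<Longrightarrow> Q \<in> \<Q> \<Longrightarrow> smul s (Delta_ext \<kappa>) Q \<in> MSpan Ls"
  shows "smul s (coface_ext p r y) (mtens3 p 2 r X V Z) \<in> MSpan (As @ Ls @ Bs)"
proof -
  note h = nd_hom_Delta_at[of p r]
  have Dy: "coface_ext p r y \<in> mpow3 p 2 r" unfolding coface_ext_def
    by (rule hom_extension_in_multipliers[OF h y])
  let ?U = "\<lambda>n. unit_multiplier (tpow n :: 'a tens set)"
  have U: "?U n \<in> mpow n" for n by (simp add: unit_in_multipliers nd_tpow)
  show ?thesis
  proof (rule clinear_on_span_mem[where f = "\<lambda>V. smul s (coface_ext p r y)
    (mtens3 p 2 r X V Z)", OF _ csubspace_mpow[of 2] _ V csubspace_MSpan])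
    show "clinear_on (mpow 2) (\<lambda>V. smul s (coface_ext p r y) (mtens3 p 2 r X V Z))"
      by (rule clinear_on_compose[OF clinear_on_mtens3_middle[OF X Z] _ clinear_on_smul_right[OF
        nd_tpow3 Dy]])
        (auto intro: mtens3_in X Z)
    show "{smul s (Delta_ext c) Q |c Q. c \<in> C \<and> Q \<in> \<Q>} \<subseteq> mpow 2"
      using C \<Q> by (auto intro!: smul_in_multipliers nd_tpow)
    fix v assume "v \<in> {smul s (Delta_ext c) Q |c Q. c \<in> C \<and> Q \<in> \<Q>}"
    then obtain c Q where v: "v = smul s (Delta_ext c) Q" and c: "c \<in> C" and Q: "Q \<in> \<Q>" by auto
    have cM: "c \<in> MH" and QM: "Q \<in> mpow 2" using c Q C \<Q> by auto
    let ?x = "mtens3 p (Suc 0) r X (mtensor [c]) Z" and ?q = "mtens3 p 2 r (?U p) Q (?U r)"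
    have x: "?x \<in> mpow3 p (Suc 0) r" by (intro mtens3_in X Z mtensor1_in cM)
    have q: "?q \<in> mpow3 p 2 r" by (intro mtens3_in U QM)
    \<comment> \<open>Splits off 1 \<otimes> Q \<otimes> 1. What is left is the extended coface of X
      \<otimes> c \<otimes> Z, so it can be merged with the coface of y before 1 \<otimes> Q
      \<otimes> 1 acts.\<close>
    have "mtens3 p 2 r X v Z = smul s (mtens3 p 2 r X (Delta_ext c) Z) ?q"
      using X Z cM QM by (simp add: v smul_mtens3 U smul_unit nd_tpow)
    then have "smul s (coface_ext p r y) (mtens3 p 2 r X v Z) =
      smul s (smul s (coface_ext p r y) (coface_ext p r ?x)) ?q"
      by (simp add: smul_assoc coface_ext_mtens3[OF X cM Z])
    also have "smul s (coface_ext p r y) (coface_ext p r ?x) = coface_ext p r (smul s y ?x)"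
      unfolding coface_ext_def by (rule hom_extension_smul[OF h y x, symmetric])
    also have "smul s (coface_ext p r (smul s y ?x)) ?q \<in> MSpan (As @ Ls @ Bs)"
    proof (rule MSpan_linear_memI[where f = "\<lambda>w. smul s (coface_ext p r w) ?q", OF _ _ _
      csubspace_MSpan _ yc[OF c]])
      show "set (As @ K # Bs) \<subseteq> Pow MH" "length (As @ K # Bs) = p + (Suc 0 + r)"
        using As Bs K by auto
      have "clinear_on (mpow3 p (Suc 0) r) (\<lambda>w. smul s (coface_ext p r w) ?q)"
        unfolding coface_ext_def
        by (rule clinear_on_compose[OF clinear_on_hom_extension[OF h] _ clinear_on_smul_left[OF
          nd_tpow3 q]])
          (auto intro: hom_extension_in_multipliers h)
      then show "clinear_on (mpow (p + (Suc 0 + r))) (\<lambda>w. smul s (coface_ext p r w) ?q)"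
        by (simp add: tpow3_def)
      fix ms assume "list_all2 (\<in>) ms (As @ K # Bs)"
      then obtain us \<kappa> vs where ms: "ms = us @ \<kappa> # vs" "list_all2 (\<in>) us As" "\<kappa> \<in> K"
        "list_all2 (\<in>) vs Bs"
        by (auto simp: list_all2_append2 list_all2_Cons2)
      have len: "length us = p" "length vs = r" using ms As Bs by (auto dest: list_all2_lengthD)
      have sub: "set us \<subseteq> MH" "set vs \<subseteq> MH" "\<kappa> \<in> MH"
        using ms list_all2_MH[OF ms(2) As(1)] list_all2_MH[OF ms(4) Bs(1)] K by auto
      have uv: "mtensor us \<in> mpow p" "mtensor vs \<in> mpow r" using sub len by
        (auto intro: mtensor_in_mpow)
      have "mtensor ms = mtens3 p (Suc 0) r (mtensor us) (mtensor [\<kappa>]) (mtensor vs)"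
        using mtens3_mtensor[of us "[\<kappa>]" vs p "Suc 0" r] sub len ms(1) by simp
      then have "smul s (coface_ext p r (mtensor ms)) ?q =
        mtens3 p 2 r (mtensor us) (smul s (Delta_ext \<kappa>) Q) (mtensor vs)"
        using uv sub QM by (simp add: coface_ext_mtens3 smul_mtens3 U smul_unit nd_tpow)
      also have "\<dots> \<in> MSpan (As @ Ls @ Bs)"
        by (rule mtens3_MSpan[OF As Ls Bs mtensor_in_MSpan[OF ms(2)] KQ[OF ms(3) Q]
          mtensor_in_MSpan[OF ms(4)]])
      finally show "smul s (coface_ext p r (mtensor ms)) ?q \<in> MSpan (As @ Ls @ Bs)" .
    qed
    finally show "smul s (coface_ext p r y) (mtens3 p 2 r X v Z) \<in> MSpan (As @ Ls @ Bs)" .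
  qed
qed

lemma mtens3_maps:
  assumes "length us = p" "length vs = r" "set us \<subseteq> MH" "set vs \<subseteq> MH" "set ks \<subseteq> MH" "length ks = m"
  shows "mtensor (us @ ks @ vs) = mtens3 p m r (mtensor us) (mtensor ks) (mtensor vs)"
  using mtens3_mtensor[of us ks vs p m r] assms by simp

lemma set_maps_MH: "set (map embH as) \<subseteq> MH" "set (map embH as @ oneH # map embH bs) \<subseteq> MH"
  for as bs :: "'a list"
  by auto

lemma mtensor_pair_span: "mtensor [embH a, embH b] \<in> cspan {smul s (Delta_ext c) Q |c Q. c \<in> EH \<and>
  Q \<in> range (q s)}"
proof -
  have sub: "{smul s (\<Delta> c) (q s d) |c d. True} \<subseteq> {smul s (Delta_ext c) Q |c Q. c \<in> EH \<and> Q \<in> range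
    (q s)}"
    by (auto simp flip: Delta_ext_emb)
  have "emb_tens 2 (tensor [a, b]) \<in> cspan {smul s (\<Delta> c) (q s d) |c d. True}"
    by (rule emb_in_span_Delta) (simp add: tensor_in_tpow)
  from subsetD[OF cspan_mono[OF sub] this] show ?thesis
    using mtensor_embH[of "[a, b]"] by (simp add: numeral_2_eq_2)
qed

text \<open>The coproduct fills the slots p + 1 and p + 2. The 1 of the test tensor lies before
  them, in the first, in the second, or after them. In the outer cases both slots hold elements of H
  and the factor in N(H) stays in an untouched block; in the inner cases it is comultiplied.\<close>

lemma coface_ext_M0:
  assumes y: "y \<in> M0 \<sigma> (p + Suc r)"
  shows "coface_ext p r y \<in> M0 \<sigma> (p + Suc r + 1)"
  unfolding M0_iff
proof (intro conjI allI impI)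
  have y3: "y \<in> mpow3 p (Suc 0) r" using M0_mpow[OF y] by (simp add: tpow3_def)
  have "coface_ext p r y \<in> mpow3 p 2 r" unfolding coface_ext_def
    by (rule hom_extension_in_multipliers[OF nd_hom_Delta_at y3])
  then show "coface_ext p r y \<in> mpow (p + Suc r + 1)" by (simp add: tpow3_def)
  fix s and as bs :: "'a list" assume len: "length as + Suc (length bs) = p + Suc r + 1"
  have E: "range (q s) \<subseteq> mpow 2" "\<And>\<kappa> Q. \<kappa> \<in> EH \<Longrightarrow> Q \<in> range (q s) \<Longrightarrow>
    smul s (Delta_ext \<kappa>) Q \<in> MSpan [EH, EH]"
    using Delta_ext_EH by auto
  have setE: "set [EH, EH] \<subseteq> Pow MH" "set [NH, EH] \<subseteq> Pow MH" "set [EH, NH] \<subseteq> Pow MH"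
    using NH_MH by auto
  have setR: "set (replicate n EH) \<subseteq> Pow MH" "length (replicate n EH) = n" for n by auto
  consider "length as < p" | "length as = p" | "length as = Suc p" | "length as > Suc p" by linarith
  then show "smul s (coface_ext p r y) (slot as bs) \<in> MSpan (slot_sets (length as) (length bs))"
  proof cases
    case 1
    \<comment> \<open>The number of slots strictly between the 1 and the pair of the
      coproduct.\<close>
    define k where "k = p - Suc (length as)"
    have p: "p = length as + Suc k" using 1 by (simp add: k_def)
    have "length bs = k + Suc (Suc r)" using len p by simp
    then obtain b1 a b' where b': "bs = b1 @ a # b'" "length b1 = k" "length b' = Suc r"
      using split_at_nth by metis
    then obtain b b2 where b: "bs = b1 @ a # b # b2" "length b1 = k" "length b2 = r"
      by (cases b') auto
    let ?X = "slot as b1" and ?Z = "mtensor (map embH b2)"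
    have X: "?X \<in> mpow p" by (rule slot_in) (use p b in simp)
    have Z: "?Z \<in> mpow r" by (rule mtensor_map_embH_in) (use b in simp)
    have eq: "slot as bs = mtens3 p 2 r ?X (mtensor [embH a, embH b]) ?Z"
      using mtens3_maps[of "map embH as @ oneH # map embH b1" p "map embH b2" r "[embH a, embH b]"
        2] set_maps_MH p b
      by simp
    have "smul s (coface_ext p r y) (mtens3 p 2 r ?X (mtensor [embH a, embH b]) ?Z) \<in> MSpan
      (slot_sets (length as) k @ [EH, EH] @ replicate r EH)"
    proof (rule coface_ext_slot[OF y3 X Z mtensor_pair_span EH_MH E(1) slot_sets_MH _ setR EH_MH
      setE(1) _ _ E(2)])
      fix c assume "c \<in> EH"
      then obtain c' where c: "c = embH c'" by auto
      have "mtens3 p (Suc 0) r ?X (mtensor [c]) ?Z = slot as (b1 @ c' # b2)"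
        using mtens3_maps[of "map embH as @ oneH # map embH b1" p "map embH b2" r "[c]"
          "Suc 0"] set_maps_MH p b c
        by simp
      then show "smul s y (mtens3 p (Suc 0) r ?X (mtensor [c]) ?Z) \<in> MSpan (slot_sets
        (length as) k @ EH # replicate r EH)"
        using M0_slot[OF y, of as "b1 @ c' # b2" "length as"
          "k + Suc r" s, unfolded replicate_Suc_middle] p b by simp
    qed (use p in auto)
    moreover have "replicate (length bs) EH = replicate k EH @ EH # EH # replicate r EH"
      using replicate_Suc_middle[of k "Suc r" EH] b by simp
    ultimately show ?thesis
      using eq by simp
  next
    case 2
    then obtain b b2 where b: "bs = b # b2" "length b2 = r" using len by (cases bs) auto
    let ?X = "mtensor (map embH as)" and ?Z = "mtensor (map embH b2)"
    have X: "?X \<in> mpow p" and Z: "?Z \<in> mpow r" using 2 b by (simp_all add: mtensor_map_embH_in)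
    have eq: "slot as bs = mtens3 p 2 r ?X (q1 b) ?Z"
      using mtens3_maps[of "map embH as" p "map embH b2" r "[oneH, embH b]" 2] set_maps_MH 2 b
      by simp
    \<comment> \<open>Since \<Delta>(1) = 1, no canonical map is needed here: c = 1 puts the 1 into
      slot p + 1 of the test tensor for y, and \<Delta>(N(H)) meets 1 \<otimes> b.\<close>
    have "q1 b = smul s (Delta_ext oneH) (q1 b)" by (simp add: Delta_ext_one smul_unit nd_tpow)
    then have V: "q1 b \<in> cspan {smul s (Delta_ext c) Q |c Q. c \<in> {oneH} \<and> Q \<in> {q1 b}}"
      by (intro cspan_base) blast
    have "smul s (coface_ext p r y) (mtens3 p 2 r ?X (q1 b) ?Z) \<in> MSpan
      (replicate p EH @ [NH, EH] @ replicate r EH)"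
    proof (rule coface_ext_slot[OF y3 X Z V _ _ setR setR NH_MH setE(2)])
      fix c :: "'a multiplier" assume "c \<in> {oneH}"
      then have "mtens3 p (Suc 0) r ?X (mtensor [c]) ?Z = slot as b2"
        using mtens3_maps[of "map embH as" p "map embH b2" r "[c]" "Suc 0"] set_maps_MH 2 b by simp
      then show "smul s y (mtens3 p (Suc 0) r ?X (mtensor [c]) ?Z) \<in> MSpan
        (replicate p EH @ NH # replicate r EH)"
        using M0_slot[OF y, of as b2 p r s] 2 b by simp
    qed (use Delta_ext_NH(1) in auto)
    then show ?thesis using eq 2 b by simp
  next
    case 3
    then have "length as = p + Suc 0" by simp
    then obtain a1 a a2 where a': "as = a1 @ a # a2" "length a1 = p" "length a2 = 0"
      using split_at_nth by metis
    then have a: "as = a1 @ [a]" "length a1 = p" by auto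
    have b: "length bs = r" using len 3 by simp
    let ?X = "mtensor (map embH a1)" and ?Z = "mtensor (map embH bs)"
    have X: "?X \<in> mpow p" and Z: "?Z \<in> mpow r" using a b by (simp_all add: mtensor_map_embH_in)
    have eq: "slot as bs = mtens3 p 2 r ?X (q0 a) ?Z"
      using mtens3_maps[of "map embH a1" p "map embH bs" r "[embH a, oneH]" 2] set_maps_MH a b
      by simp
    \<comment> \<open>As before with the slots exchanged: \<Delta>(N(H)) meets a \<otimes> 1, so the
      factor in N(H) ends up in the second slot of the pair.\<close>
    have "q0 a = smul s (Delta_ext oneH) (q0 a)" by (simp add: Delta_ext_one smul_unit nd_tpow)
    then have V: "q0 a \<in> cspan {smul s (Delta_ext c) Q |c Q. c \<in> {oneH} \<and> Q \<in> {q0 a}}"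
      by (intro cspan_base) blast
    have "smul s (coface_ext p r y) (mtens3 p 2 r ?X (q0 a) ?Z) \<in> MSpan
      (replicate p EH @ [EH, NH] @ replicate r EH)"
    proof (rule coface_ext_slot[OF y3 X Z V _ _ setR setR NH_MH setE(3)])
      fix c :: "'a multiplier" assume "c \<in> {oneH}"
      then have "mtens3 p (Suc 0) r ?X (mtensor [c]) ?Z = slot a1 bs"
        using mtens3_maps[of "map embH a1" p "map embH bs" r "[c]" "Suc 0"] set_maps_MH a b by simp
      then show "smul s y (mtens3 p (Suc 0) r ?X (mtensor [c]) ?Z) \<in> MSpan
        (replicate p EH @ NH # replicate r EH)"
        using M0_slot[OF y, of a1 bs p r s] a b by simp
    qed (use Delta_ext_NH(2) in auto)
    then show ?thesis using eq a b 3 by (simp add: replicate_app_Cons_same)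
  next
    case 4
    \<comment> \<open>The number of slots strictly between the pair of the coproduct and the
      1.\<close>
    define k where "k = length as - Suc (Suc p)"
    have k: "length as = p + Suc (Suc k)" using 4 by (simp add: k_def)
    then obtain a1 a b' where b': "as = a1 @ a # b'" "length a1 = p" "length b' = Suc k"
      using split_at_nth by metis
    then obtain b a2 where a: "as = a1 @ a # b # a2" "length a1 = p" "length a2 = k"
      by (cases b') auto
    have r: "r = k + Suc (length bs)" using len k by simp
    let ?X = "mtensor (map embH a1)" and ?Z = "slot a2 bs"
    have X: "?X \<in> mpow p" by (rule mtensor_map_embH_in) (use a in simp)
    have Z: "?Z \<in> mpow r" by (rule slot_in) (use a r in simp)
    have eq: "slot as bs = mtens3 p 2 r ?X (mtensor [embH a, embH b]) ?Z"
      using mtens3_maps[of "map embH a1" p "map embH a2 @ oneH # map embH bs" r "[embH a, embH b]"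
        2] set_maps_MH r a
      by simp
    have "smul s (coface_ext p r y) (mtens3 p 2 r ?X (mtensor [embH a, embH b]) ?Z) \<in> MSpan
      (replicate p EH @ [EH, EH] @ slot_sets k (length bs))"
    proof (rule coface_ext_slot[OF y3 X Z mtensor_pair_span EH_MH E(1) setR slot_sets_MH _ EH_MH
      setE(1) _ _ E(2)])
      fix c assume "c \<in> EH"
      then obtain c' where c: "c = embH c'" by auto
      have "mtens3 p (Suc 0) r ?X (mtensor [c]) ?Z = slot (a1 @ c' # a2) bs"
        using mtens3_maps[of "map embH a1" p "map embH a2 @ oneH # map embH bs" r "[c]"
          "Suc 0"] set_maps_MH r a c
        by simp
      then show "smul s y (mtens3 p (Suc 0) r ?X (mtensor [c]) ?Z) \<in> MSpan
        (replicate p EH @ EH # slot_sets k (length bs))"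
        using M0_slot[OF y, of "a1 @ c' # a2" bs "p + Suc k"
          "length bs" s, unfolded replicate_Suc_middle] r a by simp
    qed (use r in auto)
    moreover have "replicate (length as) EH = replicate p EH @ EH # EH # replicate k EH"
      using replicate_Suc_middle[of p "Suc k" EH] a by simp
    ultimately show ?thesis
      using eq by simp
  qed
qed

text \<open>X \<otimes> Z is the image of X \<otimes> u \<otimes> Z because \<epsilon>(u) = 1, so
  the product is the image of y(X \<otimes> u \<otimes> Z). As u lies in H, the slot to be removed
  has its factors in H, where \<epsilon> is a scalar-valued function that merely rescales the
  remaining tensor.\<close>

lemma codeg_ext_slot:
  assumes y: "y \<in> mpow3 p (Suc 0) r" and X: "X \<in> mpow p" and Z: "Z \<in> mpow r" and u: "\<epsilon> u = 1"
    and As: "set As \<subseteq> Pow MH" "length As = p" and Bs: "set Bs \<subseteq> Pow MH" "length Bs = r"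
    and yu: "smul s y (mtens3 p (Suc 0) r X (mtensor [embH u]) Z) \<in> MSpan (As @ EH # Bs)"
  shows "smul s (codeg_ext p r y) (mtens p r X Z) \<in> MSpan (As @ Bs)"
proof -
  note h = nd_hom_eps_at[of p r]
  let ?x = "mtens3 p (Suc 0) r X (mtensor [embH u]) Z"
  have x: "?x \<in> mpow3 p (Suc 0) r" by (intro mtens3_in X Z mtensor1_in embH_in)
  have "smul s (codeg_ext p r y) (mtens p r X Z) = smul s (codeg_ext p r y) (codeg_ext p r ?x)"
    by (simp add: codeg_ext_mtens3[OF X Z] u scaleC_one)
  also have "\<dots> = codeg_ext p r (smul s y ?x)"
    unfolding codeg_ext_def by (rule hom_extension_smul[OF h y x, symmetric])
  also have "\<dots> \<in> MSpan (As @ Bs)"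
  proof (rule MSpan_linear_memI[where f = "codeg_ext p r", OF _ _ _ csubspace_MSpan _ yu])
    show "set (As @ EH # Bs) \<subseteq> Pow MH" "length (As @ EH # Bs) = p + (Suc 0 + r)" using As Bs by auto
    show "clinear_on (mpow (p + (Suc 0 + r))) (codeg_ext p r)"
      using clinear_on_hom_extension[OF h] by (simp add: codeg_ext_def tpow3_def)
    fix ms assume "list_all2 (\<in>) ms (As @ EH # Bs)"
    then obtain us a vs where ms: "ms = us @ embH a # vs" "list_all2 (\<in>) us As"
      "list_all2 (\<in>) vs Bs"
      by (auto simp: list_all2_append2 list_all2_Cons2)
    have len: "length us = p" "length vs = r" using ms As Bs by (auto dest: list_all2_lengthD)
    have sub: "set us \<subseteq> MH" "set vs \<subseteq> MH"
      using list_all2_MH[OF ms(2) As(1)] list_all2_MH[OF ms(3) Bs(1)] by auto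
    have "mtensor ms = mtens3 p (Suc 0) r (mtensor us) (mtensor [embH a]) (mtensor vs)"
      using mtens3_maps[of us p vs r "[embH a]" "Suc 0"] sub len ms(1) by simp
    then have "codeg_ext p r (mtensor ms) = \<epsilon> a *\<^sub>C mtensor (us @ vs)"
      using sub len by (simp add: codeg_ext_mtens3 mtensor_in_mpow mtensor_append[of us vs p r])
    then show "codeg_ext p r (mtensor ms) \<in> MSpan (As @ Bs)"
      using mtensor_in_MSpan[OF list_all2_appendI[OF ms(2,3)]] by
        (simp add: csubspace_scale[OF csubspace_MSpan])
  qed
  finally show ?thesis .
qed

text \<open>The inserted u goes in after the first p slots of the test tensor. The 1 is either among
  those or behind them, and keeps its role in the test tensor for y.\<close>

lemma codeg_ext_M0:
  assumes y: "y \<in> M0 \<sigma> (p + Suc r)"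
  shows "codeg_ext p r y \<in> M0 \<sigma> (p + r)"
  unfolding M0_iff
proof (intro conjI allI impI)
  have y3: "y \<in> mpow3 p (Suc 0) r" using M0_mpow[OF y] by (simp add: tpow3_def)
  then show "codeg_ext p r y \<in> mpow (p + r)" by (rule codeg_ext_in)
  obtain u where u: "\<epsilon> u = 1" by (rule counit_nonzero)
  fix s and as bs :: "'a list" assume len: "length as + Suc (length bs) = p + r"
  have setR: "set (replicate n EH) \<subseteq> Pow MH" "length (replicate n EH) = n" for n by auto
  show "smul s (codeg_ext p r y) (slot as bs) \<in> MSpan (slot_sets (length as) (length bs))"
  proof (cases "length as < p")
    case True
    define k where "k = p - Suc (length as)"
    have p: "p = length as + Suc k" using True by (simp add: k_def)
    obtain b1 b2 where b: "bs = b1 @ b2" "length b1 = k" "length b2 = r"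
      using len p that[of "take k bs" "drop k bs"] by simp
    let ?X = "slot as b1" and ?Z = "mtensor (map embH b2)"
    have X: "?X \<in> mpow p" by (rule slot_in) (use p b in simp)
    have Z: "?Z \<in> mpow r" by (rule mtensor_map_embH_in) (use b in simp)
    have eq: "slot as bs = mtens p r ?X ?Z"
      using mtensor_append[of "map embH as @ oneH # map embH b1"
        "map embH b2" p r] set_maps_MH p b by simp
    have x: "mtens3 p (Suc 0) r ?X (mtensor [embH u]) ?Z = slot as (b1 @ u # b2)"
      using mtens3_maps[of "map embH as @ oneH # map embH b1" p "map embH b2" r "[embH u]"
        "Suc 0"] set_maps_MH p b by simp
    have "smul s (codeg_ext p r y) (mtens p r ?X ?Z) \<in> MSpan (slot_sets
      (length as) k @ replicate r EH)"
      by (rule codeg_ext_slot[OF y3 X Z u slot_sets_MH _ setR])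
        (use M0_slot[OF y, of as "b1 @ u # b2" "length as"
          "k + Suc r" s, unfolded replicate_Suc_middle] p b x in simp_all)
    then show ?thesis using eq b by (simp add: replicate_add)
  next
    case False
    define k where "k = length as - p"
    have k: "length as = p + k" using False by (simp add: k_def)
    have r: "r = k + Suc (length bs)" using len k by simp
    obtain a1 a2 where a: "as = a1 @ a2" "length a1 = p" "length a2 = k"
      using k that[of "take p as" "drop p as"] by simp
    let ?X = "mtensor (map embH a1)" and ?Z = "slot a2 bs"
    have X: "?X \<in> mpow p" by (rule mtensor_map_embH_in) (use a in simp)
    have Z: "?Z \<in> mpow r" by (rule slot_in) (use a r in simp)
    have eq: "slot as bs = mtens p r ?X ?Z"
      using mtensor_append[of "map embH a1" "map embH a2 @ oneH # map embH bs" p r] set_maps_MH r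
        a by simp
    have x: "mtens3 p (Suc 0) r ?X (mtensor [embH u]) ?Z = slot (a1 @ u # a2) bs"
      using mtens3_maps[of "map embH a1" p "map embH a2 @ oneH # map embH bs" r "[embH u]"
        "Suc 0"] set_maps_MH r a by simp
    have "smul s (codeg_ext p r y) (mtens p r ?X ?Z) \<in> MSpan (replicate p EH @ slot_sets k
      (length bs))"
      by (rule codeg_ext_slot[OF y3 X Z u setR slot_sets_MH])
        (use M0_slot[OF y, of "a1 @ u # a2" bs "p + Suc k"
          "length bs" s, unfolded replicate_Suc_middle] r a x in simp_all)
    then show ?thesis using eq a by (simp add: replicate_add)
  qed
qed

section \<open>The outer cofaces\<close>

lemma emb_tens_map: "length us = n \<Longrightarrow> mtensor (map embH us) = emb_tens n (tensor us)"
  for us :: "'a list"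
  using mtensor_embH[of us] by simp

text \<open>If the 1 is in the new first slot, the remaining test entries are all in H and y maps
  them into the tensor power of H, because it is a multiplier; the first factor is 1, which is in
  N(H). Otherwise the first factor is in H and the condition on y takes care of the rest.\<close>

lemma first_M0:
  assumes y: "y \<in> M0 \<sigma> n"
  shows "mtens 1 n (mtensor [oneH]) y \<in> M0 \<sigma> (n + 1)"
  unfolding M0_iff
proof (intro conjI allI impI)
  have yn: "y \<in> mpow n" by (rule M0_mpow[OF y])
  have one: "mtensor [oneH :: 'a multiplier] \<in> mpow (Suc 0)" by (simp add: mtensor1_in)
  show "mtens 1 n (mtensor [oneH]) y \<in> mpow (n + 1)"
    using mtens_in_mpow[OF one yn] by simp
  fix s and as bs :: "'a list" assume len: "length as + Suc (length bs) = n + 1"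
  have setR: "set (replicate n EH) \<subseteq> Pow MH" "length (replicate n EH) = n" for n by auto
  show "smul s (mtens 1 n (mtensor [oneH]) y) (slot as bs) \<in> MSpan (slot_sets (length as)
    (length bs))"
  proof (cases as)
    case Nil
    have b: "length bs = n" using len Nil by simp
    have B: "mtensor (map embH bs) \<in> mpow n" by (rule mtensor_map_embH_in[OF b])
    have "slot as bs = mtens (Suc 0) n (mtensor [oneH]) (mtensor (map embH bs))"
      using mtensor_append[of "[oneH]" "map embH bs" "Suc 0" n] set_maps_MH b Nil by simp
    then have "smul s (mtens 1 n (mtensor [oneH]) y) (slot as bs) =
        mtens (Suc 0) n (mtensor [oneH]) (smul s y (emb_tens n (tensor bs)))"
      using one yn B b by (simp add: smul_mtens smul_mtensor_single smul_oneH emb_tens_map)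
    also have "\<dots> \<in> MSpan ([NH] @ replicate n EH)"
    proof (rule mtens_MSpan[OF _ _ setR])
      show "mtensor [oneH] \<in> MSpan [NH]" by (rule mtensor_in_MSpan) (simp add: NH_generators)
      show "smul s y (emb_tens n (tensor bs)) \<in> MSpan (replicate n EH)"
        using b multipliersD(1,2)[OF yn tensor_in_tpow[OF b]]
        by (simp add: smul_emb nd_tpow yn tensor_in_tpow emb_in_MSpan)
    qed (use NH_MH in auto)
    finally show ?thesis using Nil b by simp
  next
    case (Cons a as')
    have n: "length as' + Suc (length bs) = n" using len Cons by simp
    have "slot as bs = mtens (Suc 0) n (mtensor [embH a]) (slot as' bs)"
      using mtensor_append[of "[embH a]" "map embH as' @ oneH # map embH bs"
        "Suc 0" n] set_maps_MH n Cons by simp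
    then have "smul s (mtens 1 n (mtensor [oneH]) y) (slot as bs) =
        mtens (Suc 0) n (mtensor [embH a]) (smul s y (slot as' bs))"
      using one yn slot_in[OF n] by (simp add: smul_mtens smul_mtensor_single smul_oneH mtensor1_in)
    also have "\<dots> \<in> MSpan ([EH] @ slot_sets (length as') (length bs))"
      by (rule mtens_MSpan[OF _ _ slot_sets_MH _ _ M0_slot[OF y n]])
        (use n in \<open>auto intro!: mtensor_in_MSpan\<close>)
    finally show ?thesis using Cons by simp
  qed
qed

text \<open>Mirror image of the first coface. With the 1 in the last slot the last factor is
  \<sigma> itself, which is why N(H) must contain \<sigma>; with b there it is \<sigma>b or
  b\<sigma>, which lies in H.\<close>

lemma last_M0:
  assumes y: "y \<in> M0 \<sigma> n"
  shows "mtens n 1 y (mtensor [\<sigma>]) \<in> M0 \<sigma> (n + 1)"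
  unfolding M0_iff
proof (intro conjI allI impI)
  have yn: "y \<in> mpow n" by (rule M0_mpow[OF y])
  have sig: "mtensor [\<sigma>] \<in> mpow (Suc 0)" by (simp add: mtensor1_in)
  show "mtens n 1 y (mtensor [\<sigma>]) \<in> mpow (n + 1)"
    using mtens_in_mpow[OF yn sig] by simp
  fix s and as bs :: "'a list" assume len: "length as + Suc (length bs) = n + 1"
  have setR: "set (replicate n EH) \<subseteq> Pow MH" "length (replicate n EH) = n" for n by auto
  show "smul s (mtens n 1 y (mtensor [\<sigma>])) (slot as bs) \<in> MSpan (slot_sets (length as) (length bs))"
  proof (cases bs rule: rev_cases)
    case Nil
    have b: "length as = n" using len Nil by simp
    have B: "mtensor (map embH as) \<in> mpow n" by (rule mtensor_map_embH_in[OF b])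
    have "slot as bs = mtens n (Suc 0) (mtensor (map embH as)) (mtensor [oneH])"
      using mtensor_append[of "map embH as" "[oneH]" n "Suc 0"] set_maps_MH b Nil by simp
    then have "smul s (mtens n 1 y (mtensor [\<sigma>])) (slot as bs) =
        mtens n (Suc 0) (smul s y (emb_tens n (tensor as))) (mtensor [\<sigma>])"
      using sig yn B b mtensor1_in[OF oneH_in] by
        (simp add: smul_mtens smul_mtensor_single smul_oneH emb_tens_map)
    also have "\<dots> \<in> MSpan (replicate n EH @ [NH])"
    proof (rule mtens_MSpan[OF setR])
      show "mtensor [\<sigma>] \<in> MSpan [NH]" by (rule mtensor_in_MSpan) (simp add: NH_generators)
      show "smul s y (emb_tens n (tensor as)) \<in> MSpan (replicate n EH)"
        using b multipliersD(1,2)[OF yn tensor_in_tpow[OF b]]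
        by (simp add: smul_emb nd_tpow yn tensor_in_tpow emb_in_MSpan)
    qed (use NH_MH in auto)
    finally show ?thesis using Nil b by simp
  next
    case (snoc bs' b)
    have n: "length as + Suc (length bs') = n" using len snoc by simp
    have "slot as bs = mtens n (Suc 0) (slot as bs') (mtensor [embH b])"
      using mtensor_append[of "map embH as @ oneH # map embH bs'"
        "[embH b]" n "Suc 0"] set_maps_MH n snoc by simp
    then have "smul s (mtens n 1 y (mtensor [\<sigma>])) (slot as bs) =
        mtens n (Suc 0) (smul s y (slot as bs')) (mtensor [smul s \<sigma> (embH b)])"
      using sig yn slot_in[OF n] by (simp add: smul_mtens smul_mtensor_single mtensor1_in)
    also have "\<dots> \<in> MSpan (slot_sets (length as) (length bs') @ [EH])"
      by (rule mtens_MSpan[OF slot_sets_MH _ _ _ M0_slot[OF y n]])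
        (use n smul_embH[OF sigma_in, of s b] in \<open>auto intro!: mtensor_in_MSpan\<close>)
    finally show ?thesis using snoc by (simp add: replicate_append_same)
  qed
qed

section \<open>The constructed maps are the canonical extensions\<close>

lemma M0_subset: "M0 \<sigma> n \<subseteq> mpow n"
  using M0_mpow by blast

lemma clinear_on_subset: "clinear_on A f \<Longrightarrow> B \<subseteq> A \<Longrightarrow> clinear_on B f"
  unfolding clinear_on_def by blast

lemma coface_first:
  "extends_coface \<Delta> \<sigma> n 0 (mtens 1 n (mtensor [oneH]))"
  unfolding extends_coface_def
proof (intro conjI ballI)
  have one: "mtensor [oneH :: 'a multiplier] \<in> mpow (Suc 0)" by (simp add: mtensor1_in)
  show "clinear_on (M0 \<sigma> n) (mtens 1 n (mtensor [oneH]))"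
    using clinear_on_subset[OF clinear_on_mtens_right[OF one] M0_subset] by simp
  fix x :: "'a tens" assume x: "x \<in> tpow n"
  have l: "clinear_on (tpow n) (\<lambda>x. mtens (Suc 0) n (mtensor [oneH]) (emb_tens n (x :: 'a tens)))"
    by (rule clinear_on_compose[OF clinear_on_emb _ clinear_on_mtens_right[OF one]])
      (auto simp: emb_tens_in)
  have eq: "mtens (Suc 0) n (mtensor [oneH]) (emb_tens n (tensor xs)) =
    mtensor (oneH # map embH xs)" if "length xs = n" for xs :: "'a list"
    using mtensor_append[of "[oneH]" "map embH xs" "Suc 0" n] set_maps_MH that by
      (simp add: emb_tens_map)
  \<comment> \<open>On lists of length n the function agrees with a linear map evaluated at
    elementary tensors, and so inherits multilinearity from it.\<close>
  have m: "mlin n (\<lambda>xs :: 'a list. mtensor (oneH # map embH xs))"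
    by (rule mlin_cong[OF mlin_clinear_tensor[OF l] eq])
  have "mtens (Suc 0) n (mtensor [oneH]) (emb_tens n x) =
    lift n (\<lambda>xs. mtensor (oneH # map embH xs)) x"
    by (rule tpow_eqI[OF x l clinear_on_lift_mlin[OF m]]) (simp add: lift_tensor_mlin[OF m] eq)
  then show "mtens 1 n (mtensor [oneH]) (emb_tens n x) = coface \<Delta> \<sigma> n 0 x"
    by (simp add: coface_def)
qed simp

lemma coface_last:
  "extends_coface \<Delta> \<sigma> n (n + 1) (\<lambda>y. mtens n 1 y (mtensor [\<sigma>]))"
  unfolding extends_coface_def
proof (intro conjI ballI)
  have sig: "mtensor [\<sigma>] \<in> mpow (Suc 0)" by (simp add: mtensor1_in)
  show "clinear_on (M0 \<sigma> n) (\<lambda>y. mtens n 1 y (mtensor [\<sigma>]))"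
    using clinear_on_subset[OF clinear_on_mtens_left[OF sig] M0_subset] by simp
  fix x :: "'a tens" assume x: "x \<in> tpow n"
  have l: "clinear_on (tpow n) (\<lambda>x. mtens n (Suc 0) (emb_tens n (x :: 'a tens)) (mtensor [\<sigma>]))"
    by (rule clinear_on_compose[OF clinear_on_emb _ clinear_on_mtens_left[OF sig]])
      (auto simp: emb_tens_in)
  have eq: "mtens n (Suc 0) (emb_tens n (tensor xs)) (mtensor [\<sigma>]) = mtensor (map embH xs @ [\<sigma>])"
    if "length xs = n" for xs :: "'a list"
    using mtensor_append[of "map embH xs" "[\<sigma>]" n "Suc 0"] set_maps_MH that by
      (simp add: emb_tens_map)
  have m: "mlin n (\<lambda>xs :: 'a list. mtensor (map embH xs @ [\<sigma>]))"
    by (rule mlin_cong[OF mlin_clinear_tensor[OF l] eq])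
  have "mtens n (Suc 0) (emb_tens n x) (mtensor [\<sigma>]) = lift n (\<lambda>xs. mtensor (map embH xs @ [\<sigma>])) x"
    by (rule tpow_eqI[OF x l clinear_on_lift_mlin[OF m]]) (simp add: lift_tensor_mlin[OF m] eq)
  then show "mtens n 1 (emb_tens n x) (mtensor [\<sigma>]) = coface \<Delta> \<sigma> n (n + 1) x"
    by (simp add: coface_def)
qed simp

lemma coface_middle:
  assumes n: "n = p + Suc r"
  shows "extends_coface \<Delta> \<sigma> n (Suc p) (coface_ext p r)"
proof -
  have A: "tpow3 p (Suc 0) r = (tpow n :: 'a tens set)" and B: "tpow3 p 2 r =
    (tpow (n + 1) :: 'a tens set)"
    by (simp_all add: tpow3_def n)
  have c: "coface \<Delta> \<sigma> n (Suc p) = Delta_at p r"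
    by (simp add: coface_def Delta_at_def n)
  note h = nd_hom_Delta_at[of p r, unfolded A B]
  have D: "coface_ext p r = hom_extension (tpow n) (tpow (n + 1)) (Delta_at p r)"
    unfolding coface_ext_def[abs_def] A B ..
  show ?thesis
    unfolding extends_coface_def c D
  proof (intro conjI ballI)
    show "clinear_on (M0 \<sigma> n) (hom_extension (tpow n) (tpow (n + 1)) (Delta_at p r))"
      by (rule clinear_on_subset[OF clinear_on_hom_extension[OF h] M0_subset])
    show "hom_extension (tpow n) (tpow (n + 1)) (Delta_at p r) (emb_tens n x) = Delta_at p r x"
      if "x \<in> tpow n" for x
      by (rule hom_extension_emb[OF h that])
  qed (use n hom_extends_hom_extension[OF h M0_mpow] in simp)
qed

lemma codegeneracy_extends:
  assumes n: "n = p + r"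
  shows "extends_codegeneracy \<epsilon> \<sigma> (n + 1) (Suc p) (codeg_ext p r)"
proof -
  have A: "tpow3 p (Suc 0) r = (tpow (n + 1) :: 'a tens set)"
    by (simp add: tpow3_def n)
  have c: "codegeneracy \<epsilon> (n + 1) (Suc p) = eps_at p r"
    by (simp add: eps_at_def n)
  have M: "y \<in> mpow3 p (Suc 0) r" if "y \<in> M0 \<sigma> (n + 1)" for y
    using M0_mpow[OF that] by (simp add: A)
  show ?thesis
    unfolding extends_codegeneracy_def c Let_def
  proof (intro conjI ballI allI impI)
    show "clinear_on (M0 \<sigma> (n + 1)) (codeg_ext p r)"
      using M clinear_on_subset[OF clinear_on_hom_extension[OF nd_hom_eps_at]] unfolding
        codeg_ext_def[abs_def] by blast
    show "codeg_ext p r (emb_tens (n + 1) x) = emb_tens (n + 1 - 1) (eps_at p r x)"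
      if "x \<in> tpow (n + 1)" for x
      using hom_extension_emb[OF nd_hom_eps_at[of p r], of x] that by
        (simp add: A codeg_ext_def eps_at_mult_def n)
    fix y and as :: "'a list" assume y: "y \<in> M0 \<sigma> (n + 1)" and as: "length as = n + 1"
    then have "length as = p + Suc r" by (simp add: n)
    then obtain us a vs where as: "as = us @ a # vs" "length us = p" "length vs = r"
      using split_at_nth by metis
    have t: "tensor as \<in> tpow3 p (Suc 0) r"
      using as by (simp add: tpow3_def tensor_in_tpow)
    have uv: "tensor (us @ vs) \<in> tpow (p + r)" using as by (simp add: tensor_in_tpow)
    \<comment> \<open>Linearity of the extension turns this scalar into the factor on the left of
      the required identities; a may have counit 0, so nothing is divided.\<close>
    have "eps_at p r (tensor as) = \<epsilon> a *\<^sub>C tensor (us @ vs)"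
      using eps_at_tensor[OF as(2,3)] as(1) by simp
    then show "\<epsilon> (as ! (Suc p - 1)) *\<^sub>C lmul (codeg_ext p r y) (tensor (take (Suc p - 1) as @ drop
      (Suc p) as)) = eps_at p r (lmul y (tensor as))"
      "\<epsilon> (as ! (Suc p - 1)) *\<^sub>C rmul (codeg_ext p r y) (tensor (take (Suc p - 1) as @ drop
        (Suc p) as)) = eps_at p r (rmul y (tensor as))"
      using codeg_ext_eps_at[OF M[OF y] t] as clinear_on_scaleC[OF multipliersD(3)[OF
        codeg_ext_in[OF M[OF y]]] uv]
        clinear_on_scaleC[OF multipliersD(4)[OF codeg_ext_in[OF M[OF y]]] uv]
      by (simp_all add: nth_append)
  qed
qed

end

theorem proposition4p4:
  fixes \<Delta> :: "'a::complex_algebra \<Rightarrow> 'a tens multiplier"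
    and \<epsilon> \<delta> :: "'a \<Rightarrow> complex"
    and S :: "'a \<Rightarrow> 'a"
    and \<sigma> :: "'a multiplier"
    and n :: nat
  assumes "regular_multiplier_Hopf_algebra \<Delta>"
    and "is_counit \<Delta> \<epsilon>"
    and "is_antipode \<Delta> \<epsilon> S"
    and "modular_pair_in_involution \<Delta> S \<delta> \<sigma>"
  shows "(\<forall>i\<in>{0..n + 1}. \<exists>D. D \<in> M0 \<sigma> n \<rightarrow> M0 \<sigma> (n + 1) \<and> extends_coface \<Delta> \<sigma> n i D) \<and>
    (\<forall>i\<in>{1..n + 1}. \<exists>E. E \<in> M0 \<sigma> (n + 1) \<rightarrow> M0 \<sigma> n \<and> extends_codegeneracy \<epsilon> \<sigma> (n + 1) i E)"
proof -
  have \<delta>: "clinear \<delta>" "\<exists>a. \<delta> a \<noteq> 0"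
    using assms(4) by (auto simp: modular_pair_in_involution_def is_character_def algebra_hom_def)
  interpret cosimplicial "TYPE('a)" \<Delta> \<epsilon> \<sigma>
  proof unfold_locales
    show "nd_algebra (UNIV :: 'a set)"
      using assms(1) by (simp add: nd_algebra_def regular_multiplier_Hopf_algebra_def
        multiplier_Hopf_algebra_def
          csubspace_UNIV)
    show "group_like \<Delta> \<sigma>" using assms(4) by (simp add: modular_pair_in_involution_def)
    \<comment> \<open>A linear functional that is not identically 0 excludes H = 0.\<close>
    show "\<exists>a :: 'a. a \<noteq> 0" using \<delta> clinear_0D by metis
  qed (rule assms)+
  have "\<exists>D. D \<in> M0 \<sigma> n \<rightarrow> M0 \<sigma> (n + 1) \<and> extends_coface \<Delta> \<sigma> n i D" if i: "i \<in> {0..n + 1}" for i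
  proof -
    have "i = 0 \<or> i = n + 1 \<or> (\<exists>p r. i = Suc p \<and> n = p + Suc r)"
    proof (cases "i = 0 \<or> i = n + 1")
      case False
      \<comment> \<open>There are i - 1 factors before the comultiplied one and n - i after
        it.\<close>
      then have *: "i = Suc (i - 1)" "n = (i - 1) + Suc (n - i)" using i by auto
      show ?thesis by (intro disjI2 exI conjI) (rule *)+
    qed blast
    then consider "i = 0" | "i = n + 1" | "\<exists>p r. i = Suc p \<and> n = p + Suc r" by blast
    then show ?thesis
    proof cases
      case 1
      have "mtens 1 n (mtensor [oneH]) \<in> M0 \<sigma> n \<rightarrow> M0 \<sigma> (n + 1)" by (intro funcsetI first_M0)
      from conjI[OF this coface_first] show ?thesis unfolding 1
        by (rule exI[of _ "mtens 1 n (mtensor [oneH])"])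
    next
      case 2
      have "(\<lambda>y. mtens n 1 y (mtensor [\<sigma>])) \<in> M0 \<sigma> n \<rightarrow> M0 \<sigma> (n + 1)" by (intro funcsetI last_M0)
      from conjI[OF this coface_last] show ?thesis unfolding 2
        by (rule exI[of _ "\<lambda>y. mtens n 1 y (mtensor [\<sigma>])"])
    next
      case 3
      then obtain p r where i: "i = Suc p" and n: "n = p + Suc r" by blast
      have "coface_ext p r \<in> M0 \<sigma> n \<rightarrow> M0 \<sigma> (n + 1)" unfolding n by (intro funcsetI coface_ext_M0)
      from conjI[OF this coface_middle[OF n]] show ?thesis unfolding i
        by (rule exI[of _ "coface_ext p r"])
    qed
  qed
  moreover have "\<exists>E. E \<in> M0 \<sigma> (n + 1) \<rightarrow> M0 \<sigma> n \<and> extends_codegeneracy \<epsilon> \<sigma> (n + 1) i E"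
    if i: "i \<in> {1..n + 1}" for i
  proof -
    obtain p where p: "i = Suc p" "p \<le> n" using i by (cases i) auto
    then obtain r where "n = p + r" by (auto simp: le_iff_add)
    then show ?thesis
      using codegeneracy_extends[of n p r] codeg_ext_M0[of _ p r] p by auto
  qed
  ultimately show ?thesis by blast
qed

end
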